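(* Let $\Gamma$ be a compact connected metric graph, let $\kappa\in L_\infty(\Gamma)$ satisfy $\operatorname{ess\,inf}_\Gamma\kappa\ge\kappa_0>0$, let $a:\Gamma\to\mathbb R$ be Lipschitz and positive with $a_0=\min_\Gamma a>0$, and for each vertex $v$ let $A_v,B_v$ be $d_v\times d_v$ matrices such that $(A_v,B_v)$ has maximal rank $d_v$ and $A_vB_v^*$ is self-adjoint. Let $L$ be the operator on $L_2(\Gamma)$ acting on each edge by $(Lu)_e=-(a_eu_e')'+\kappa_e^2u_e$ with domain $$D(L)=\{u\in\widetilde H^2(\Gamma): A_vF(v)+a(v)B_vF'(v)=0\ \ \forall v\in\mathcal V\}.$$ Suppose at least one of the following holds: (A1) with $S=\max_v\|\Lambda_v\|_2$ one has $\kappa_0^2>4S/\min_el_e$ and $2S\max_el_e\le a_0$; (A2) $\Lambda_v$ is non-positive definite for every $v\in\mathcal V$. Let $\mathcal W$ be Gaussian white noise on $L_2(\Gamma)$ defined on a probability space $(\Omega,\mathcal F,\mathbb P)$. Then, for any $\beta>0$ and any $\epsilon>0$, there exists a unique solution $u\in L_2(\Omega,\dot H_L^{2\beta-\frac12-\epsilon}(\Gamma))$ to $$L^\beta u=\mathcal W\quad\text{on }\Gamma.$$ Further, if $\beta>\frac14$, then $u\in L_2(\Omega,L_2(\Gamma))$.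
   Context: A compact metric graph $\Gamma$ consists of a finite vertex set $\mathcal V$ and a finite edge set $\mathcal E$ (loops and multiple edges allowed); each edge $e$ is identified with an interval $[0,l_e]$, $0<l_e<\infty$; $\Gamma$ carries the shortest-path metric. $\mathcal E_v$ is the set of edges incident to $v$ (a loop at $v$ counted twice, once per end) and $d_v=|\mathcal E_v|$. $u_e$ is the restriction of $u$ to $e$; $L_2(\Gamma)=\bigoplus_eL_2(e)$ with inner product $(\cdot,\cdot)$, $\widetilde H^2(\Gamma)=\bigoplus_eH^2(e)$. $\partial_eu(v)$ is the derivative of $u$ along $e$ at $v$ in the direction away from $v$ ($u_e'(0)$ if $v$ sits at $0$, $-u_e'(l_e)$ if $v$ sits at $l_e$). $F(v)\in\mathbb R^{d_v}$ is the vector of values $u_e(v)$, $e\in\mathcal E_v$, and $F'(v)$ the vector of the $\partial_eu(v)$. Definition of $\Lambda_v$: let $R_v=\operatorname{Range}(B_v^* )$ and $R_{1v}=\operatorname{Range}(B_v)$, with orthogonal projections $Q_v,Q_{1v}$; $Q_{1v}B_vQ_v:R_v\to R_{1v}$ is invertible with inverse $B_v^{(-1)}$, and $\Lambda_v=B_v^{(-1)}A_v$, a self-adjoint operator on $R_v$; $\|\cdot\|_2$ is the spectral norm. Under (A1) or (A2), $L$ is self-adjoint and positive definite with compact inverse; let $\{e_k\}_{k\in\mathbb N}$ be an orthonormal basis of $L_2(\Gamma)$ of eigenvectors with eigenvalues $\lambda_k>0$. For $s\ge0$, $\dot H_L^s(\Gamma)=\{u\in L_2(\Gamma):\|u\|^2_{\dot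 H^s_L}=\sum_k\lambda_k^s(u,e_k)^2<\infty\}$ and $\dot H_L^{-s}(\Gamma)$ is its dual (equivalently, formal series $\sum_kc_ke_k$ with $\sum_k\lambda_k^{-s}c_k^2<\infty$). $L^\beta$ is defined spectrally, $L^\beta u=\sum_k\lambda_k^\beta(u,e_k)e_k$, and extends uniquely to an isometric isomorphism $\dot H_L^s(\Gamma)\to\dot H_L^{s-2\beta}(\Gamma)$ for every $s\in\mathbb R$; the equation is understood in this sense. White noise is $\mathcal W=\sum_k\xi_ke_k$ with $\{\xi_k\}$ independent standard normal random variables on $(\Omega,\mathcal F,\mathbb P)$. $L_2(\Omega,H)$ is the space of $H$-valued random variables with $\mathbb E\|\cdot\|_H^2<\infty$. *)

theory Defs
  imports "HOL-Probability.Probability"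
    "Graph_Theory.Digraph_Component"
    "Jordan_Normal_Form.DL_Rank"
begin

section \<open>Compact metric graphs\<close>

text \<open>
  The combinatorial graph is a finite digraph with loops and multiple arcs allowed.  The direction
  of an arc \<open>e\<close> only fixes the identification of \<open>e\<close> with the interval \<open>[0, len e]\<close>: the tail sits
  at \<open>0\<close> and the head at \<open>len e\<close>.
\<close>

datatype ('v, 'e) gpoint = Vertex 'v | Inner 'e real

definition edge_point :: "('v, 'e) pre_digraph \<Rightarrow> ('e \<Rightarrow> real) \<Rightarrow> 'e \<Rightarrow> real \<Rightarrow> ('v, 'e) gpoint" where
  "edge_point G len e x =
     (if x = 0 then Vertex (tail G e) else if x = len e then Vertex (head G e) else Inner e x)"

definition points :: "('v, 'e) pre_digraph \<Rightarrow> ('e \<Rightarrow> real) \<Rightarrow> ('v, 'e) gpoint set" where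
  "points G len =
     Vertex ` verts G \<union> {edge_point G len e x | e x. e \<in> arcs G \<and> x \<in> {0..len e}}"

text \<open>\<open>path_length G len p r q\<close>: some concatenation of segments of edges, of total length \<open>r\<close>,
  leads from \<open>p\<close> to \<open>q\<close>.\<close>

inductive path_length ::
  "('v, 'e) pre_digraph \<Rightarrow> ('e \<Rightarrow> real) \<Rightarrow> ('v, 'e) gpoint \<Rightarrow> real \<Rightarrow> ('v, 'e) gpoint \<Rightarrow> bool"
  for G :: "('v, 'e) pre_digraph" and len :: "'e \<Rightarrow> real" where
  refl: "p \<in> points G len \<Longrightarrow> path_length G len p 0 p"
| step: "\<lbrakk>path_length G len p r (edge_point G len e x); e \<in> arcs G; x \<in> {0..len e}; y \<in> {0..len e}\<rbrakk>
    \<Longrightarrow> path_length G len p (r + \<bar>x - y\<bar>) (edge_point G len e y)"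

definition path_dist ::
  "('v, 'e) pre_digraph \<Rightarrow> ('e \<Rightarrow> real) \<Rightarrow> ('v, 'e) gpoint \<Rightarrow> ('v, 'e) gpoint \<Rightarrow> real" where
  "path_dist G len p q = Inf {r. path_length G len p r q}"

definition lipschitz_on_graph ::
  "('v, 'e) pre_digraph \<Rightarrow> ('e \<Rightarrow> real) \<Rightarrow> (('v, 'e) gpoint \<Rightarrow> real) \<Rightarrow> bool" where
  "lipschitz_on_graph G len a \<longleftrightarrow>
     (\<exists>K. \<forall>p\<in>points G len. \<forall>q\<in>points G len. \<bar>a p - a q\<bar> \<le> K * path_dist G len p q)"

text \<open>
  The set \<open>\<E>\<^sub>v\<close>: an edge end is a pair \<open>(e, b)\<close>, where \<open>b\<close> says whether it is the end at \<open>len e\<close>.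
  A loop at \<open>v\<close> thus contributes two ends, and the degree \<open>d\<^sub>v\<close> is the number of ends at \<open>v\<close>.
\<close>

definition ends_at :: "('v, 'e) pre_digraph \<Rightarrow> 'v \<Rightarrow> ('e \<times> bool) set" where
  "ends_at G v = {(e, b). e \<in> arcs G \<and> (if b then head G e else tail G e) = v}"

definition deg :: "('v, 'e) pre_digraph \<Rightarrow> 'v \<Rightarrow> nat" where
  "deg G v = card (ends_at G v)"


section \<open>Function spaces\<close>

text \<open>Elements of Lebesgue and Sobolev spaces are represented by functions, with equality almost
  everywhere on each edge.\<close>

definition sq_integrable :: "real \<Rightarrow> (real \<Rightarrow> real) \<Rightarrow> bool" where
  "sq_integrable l f \<longleftrightarrow> f \<in> borel_measurable (lebesgue_on {0..l}) \<and>
     integrable (lebesgue_on {0..l}) (\<lambda>x. (f x)\<^sup>2)"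

definition test_function :: "real \<Rightarrow> (real \<Rightarrow> real) \<Rightarrow> (real \<Rightarrow> real) \<Rightarrow> bool" where
  "test_function l \<phi> \<phi>' \<longleftrightarrow>
     (\<forall>x. (\<phi> has_real_derivative \<phi>' x) (at x)) \<and> continuous_on UNIV \<phi>' \<and>
     (\<exists>c d. 0 < c \<and> d < l \<and> (\<forall>x. x \<notin> {c..d} \<longrightarrow> \<phi> x = 0))"

definition has_weak_deriv :: "real \<Rightarrow> (real \<Rightarrow> real) \<Rightarrow> (real \<Rightarrow> real) \<Rightarrow> bool" where
  "has_weak_deriv l u w \<longleftrightarrow>
     (\<forall>\<phi> \<phi>'. test_function l \<phi> \<phi>' \<longrightarrow>
        (LINT x|lebesgue_on {0..l}. u x * \<phi>' x) = - (LINT x|lebesgue_on {0..l}. w x * \<phi> x))"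

definition weak_deriv :: "real \<Rightarrow> (real \<Rightarrow> real) \<Rightarrow> real \<Rightarrow> real" where
  "weak_deriv l u = (SOME w. sq_integrable l w \<and> has_weak_deriv l u w)"

definition H1 :: "real \<Rightarrow> (real \<Rightarrow> real) \<Rightarrow> bool" where
  "H1 l u \<longleftrightarrow> sq_integrable l u \<and> (\<exists>w. sq_integrable l w \<and> has_weak_deriv l u w)"

definition H2 :: "real \<Rightarrow> (real \<Rightarrow> real) \<Rightarrow> bool" where
  "H2 l u \<longleftrightarrow> H1 l u \<and> H1 l (weak_deriv l u)"

text \<open>Boundary values of an \<open>H\<^sup>1\<close> function are those of its continuous representative.\<close>

definition cont_rep :: "real \<Rightarrow> (real \<Rightarrow> real) \<Rightarrow> real \<Rightarrow> real" where
  "cont_rep l u = (SOME g. continuous_on {0..l} g \<and> (AE x in lebesgue_on {0..l}. g x = u x))"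

definition L2_graph :: "('v, 'e) pre_digraph \<Rightarrow> ('e \<Rightarrow> real) \<Rightarrow> ('e \<Rightarrow> real \<Rightarrow> real) set" where
  "L2_graph G len = {u. \<forall>e\<in>arcs G. sq_integrable (len e) (u e)}"

definition L2_inner ::
  "('v, 'e) pre_digraph \<Rightarrow> ('e \<Rightarrow> real) \<Rightarrow> ('e \<Rightarrow> real \<Rightarrow> real) \<Rightarrow> ('e \<Rightarrow> real \<Rightarrow> real) \<Rightarrow> real" where
  "L2_inner G len u w = (\<Sum>e\<in>arcs G. LINT x|lebesgue_on {0..len e}. u e x * w e x)"

definition L2_norm :: "('v, 'e) pre_digraph \<Rightarrow> ('e \<Rightarrow> real) \<Rightarrow> ('e \<Rightarrow> real \<Rightarrow> real) \<Rightarrow> real" where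
  "L2_norm G len u = sqrt (L2_inner G len u u)"

text \<open>\<open>L\<^sub>\<infinity>\<close> coefficients: measurable and essentially bounded on each edge.\<close>

definition Linf_graph :: "('v, 'e) pre_digraph \<Rightarrow> ('e \<Rightarrow> real) \<Rightarrow> ('e \<Rightarrow> real \<Rightarrow> real) set" where
  "Linf_graph G len = {f. \<forall>e\<in>arcs G. f e \<in> borel_measurable (lebesgue_on {0..len e}) \<and>
     (\<exists>K. AE x in lebesgue_on {0..len e}. \<bar>f e x\<bar> \<le> K)}"


section \<open>Vertex conditions and the operator\<close>

text \<open>
  \<open>es v\<close> lists the edge ends at \<open>v\<close>; it fixes the order of the coordinates of the vectors
  \<open>F(v)\<close> and \<open>F'(v)\<close>.
\<close>

definition F_vec ::
  "('e \<Rightarrow> real) \<Rightarrow> ('v \<Rightarrow> ('e \<times> bool) list) \<Rightarrow> ('e \<Rightarrow> real \<Rightarrow> real) \<Rightarrow> 'v \<Rightarrow> real vec" where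
  "F_vec len es u v = Matrix.vec (length (es v))
     (\<lambda>i. case es v ! i of (e, b) \<Rightarrow> cont_rep (len e) (u e) (if b then len e else 0))"

definition F'_vec ::
  "('e \<Rightarrow> real) \<Rightarrow> ('v \<Rightarrow> ('e \<times> bool) list) \<Rightarrow> ('e \<Rightarrow> real \<Rightarrow> real) \<Rightarrow> 'v \<Rightarrow> real vec" where
  "F'_vec len es u v = Matrix.vec (length (es v))
     (\<lambda>i. case es v ! i of (e, b) \<Rightarrow>
        if b then - cont_rep (len e) (weak_deriv (len e) (u e)) (len e)
        else cont_rep (len e) (weak_deriv (len e) (u e)) 0)"

definition dom_L ::
  "('v, 'e) pre_digraph \<Rightarrow> ('e \<Rightarrow> real) \<Rightarrow> ('v \<Rightarrow> ('e \<times> bool) list) \<Rightarrow> (('v, 'e) gpoint \<Rightarrow> real) \<Rightarrow>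
   ('v \<Rightarrow> real mat) \<Rightarrow> ('v \<Rightarrow> real mat) \<Rightarrow> ('e \<Rightarrow> real \<Rightarrow> real) set" where
  "dom_L G len es a A B = {u. (\<forall>e\<in>arcs G. H2 (len e) (u e)) \<and>
     (\<forall>v\<in>verts G. A v *\<^sub>v F_vec len es u v + a (Vertex v) \<cdot>\<^sub>v (B v *\<^sub>v F'_vec len es u v)
        = 0\<^sub>v (deg G v))}"

definition op_L ::
  "('v, 'e) pre_digraph \<Rightarrow> ('e \<Rightarrow> real) \<Rightarrow> (('v, 'e) gpoint \<Rightarrow> real) \<Rightarrow> ('e \<Rightarrow> real \<Rightarrow> real) \<Rightarrow>
   ('e \<Rightarrow> real \<Rightarrow> real) \<Rightarrow> 'e \<Rightarrow> real \<Rightarrow> real" where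
  "op_L G len a \<kappa> u e x =
     - weak_deriv (len e) (\<lambda>y. a (edge_point G len e y) * weak_deriv (len e) (u e) y) x
     + (\<kappa> e x)\<^sup>2 * u e x"

definition mat_range :: "real mat \<Rightarrow> real vec set" where
  "mat_range M = {M *\<^sub>v x | x. x \<in> carrier_vec (dim_col M)}"

definition orth_proj :: "real vec set \<Rightarrow> real vec \<Rightarrow> real vec" where
  "orth_proj W x = (THE y. y \<in> W \<and> (\<forall>w\<in>W. scalar_prod w (x - y) = 0))"

text \<open>The inverse of \<open>Q\<^sub>1 B Q\<close> as a map from \<open>R = Range(B\<^sup>*)\<close> onto \<open>R\<^sub>1 = Range(B)\<close>.\<close>

definition range_inverse :: "real mat \<Rightarrow> real vec \<Rightarrow> real vec" where
  "range_inverse B = the_inv_into (mat_range (transpose_mat B))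
     (\<lambda>x. orth_proj (mat_range B) (B *\<^sub>v orth_proj (mat_range (transpose_mat B)) x))"

definition Lam :: "real mat \<Rightarrow> real mat \<Rightarrow> real vec \<Rightarrow> real vec" where
  "Lam A B x = range_inverse B (A *\<^sub>v x)"

definition vec_norm2 :: "real vec \<Rightarrow> real" where
  "vec_norm2 x = sqrt (scalar_prod x x)"

definition spectral_norm_on :: "real vec set \<Rightarrow> (real vec \<Rightarrow> real vec) \<Rightarrow> real" where
  "spectral_norm_on R T = Sup {vec_norm2 (T x) | x. x \<in> R \<and> vec_norm2 x \<le> 1}"

definition Lam_bound :: "('v, 'e) pre_digraph \<Rightarrow> ('v \<Rightarrow> real mat) \<Rightarrow> ('v \<Rightarrow> real mat) \<Rightarrow> real" where
  "Lam_bound G A B =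
     Max ((\<lambda>v. spectral_norm_on (mat_range (transpose_mat (B v))) (Lam (A v) (B v))) ` verts G)"

definition Lam_nonpositive :: "real mat \<Rightarrow> real mat \<Rightarrow> bool" where
  "Lam_nonpositive A B \<longleftrightarrow> (\<forall>x\<in>mat_range (transpose_mat B). scalar_prod (Lam A B x) x \<le> 0)"

definition is_eigenbasis ::
  "('v, 'e) pre_digraph \<Rightarrow> ('e \<Rightarrow> real) \<Rightarrow> ('v \<Rightarrow> ('e \<times> bool) list) \<Rightarrow> (('v, 'e) gpoint \<Rightarrow> real) \<Rightarrow>
   ('e \<Rightarrow> real \<Rightarrow> real) \<Rightarrow> ('v \<Rightarrow> real mat) \<Rightarrow> ('v \<Rightarrow> real mat) \<Rightarrow>
   (nat \<Rightarrow> 'e \<Rightarrow> real \<Rightarrow> real) \<Rightarrow> (nat \<Rightarrow> real) \<Rightarrow> bool" where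
  "is_eigenbasis G len es a \<kappa> A B \<psi> eig \<longleftrightarrow>
     (\<forall>k. \<psi> k \<in> dom_L G len es a A B \<and>
        (\<forall>e\<in>arcs G. AE x in lebesgue_on {0..len e}. op_L G len a \<kappa> (\<psi> k) e x = eig k * \<psi> k e x)) \<and>
     (\<forall>j k. L2_inner G len (\<psi> j) (\<psi> k) = (if j = k then 1 else 0)) \<and>
     (\<forall>u\<in>L2_graph G len.
        (\<lambda>n. L2_norm G len (\<lambda>e x. u e x - (\<Sum>k<n. L2_inner G len u (\<psi> k) * \<psi> k e x))) \<longlonglongrightarrow> 0)"


section \<open>Spaces associated with the operator, random variables\<close>

text \<open>
  Elements of \<open>H\<^sup>s\<close> are represented by their coefficient sequences with respect to the eigenbasis
  \<open>\<psi>\<close>: for \<open>s \<ge> 0\<close> these are the sequences \<open>(u, \<psi>\<^sub>k)\<close> of functions \<open>u\<close> in \<open>L\<^sub>2\<close>, for \<open>s < 0\<close> the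
  coefficients of formal series.
\<close>

definition Hdot ::
  "('v, 'e) pre_digraph \<Rightarrow> ('e \<Rightarrow> real) \<Rightarrow> (nat \<Rightarrow> 'e \<Rightarrow> real \<Rightarrow> real) \<Rightarrow> (nat \<Rightarrow> real) \<Rightarrow> real \<Rightarrow>
   (nat \<Rightarrow> real) set" where
  "Hdot G len \<psi> eig s =
     {c. (0 \<le> s \<longrightarrow> (\<exists>u\<in>L2_graph G len. \<forall>k. c k = L2_inner G len u (\<psi> k))) \<and>
         summable (\<lambda>k. eig k powr s * (c k)\<^sup>2)}"

definition Hdot_norm :: "(nat \<Rightarrow> real) \<Rightarrow> real \<Rightarrow> (nat \<Rightarrow> real) \<Rightarrow> real" where
  "Hdot_norm eig s c = sqrt (\<Sum>k. eig k powr s * (c k)\<^sup>2)"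

definition L_power :: "(nat \<Rightarrow> real) \<Rightarrow> real \<Rightarrow> (nat \<Rightarrow> real) \<Rightarrow> nat \<Rightarrow> real" where
  "L_power eig \<beta> c k = eig k powr \<beta> * c k"

text \<open>The \<open>\<sigma>\<close>-algebra on \<open>X\<close> generated by the sets that are open for the (semi)norm \<open>N\<close>.\<close>

definition norm_borel :: "('b::minus) set \<Rightarrow> ('b \<Rightarrow> real) \<Rightarrow> 'b measure" where
  "norm_borel X N = sigma X {U. U \<subseteq> X \<and> (\<forall>u\<in>U. \<exists>r>0. \<forall>w\<in>X. N (w - u) < r \<longrightarrow> w \<in> U)}"

definition L2_rv :: "'w measure \<Rightarrow> ('b::minus) set \<Rightarrow> ('b \<Rightarrow> real) \<Rightarrow> ('w \<Rightarrow> 'b) set" where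
  "L2_rv M X N = {Z \<in> measurable M (norm_borel X N). integrable M (\<lambda>\<omega>. (N (Z \<omega>))\<^sup>2)}"

text \<open>White noise is given by its coefficients with respect to the eigenbasis.\<close>

definition white_noise :: "'w measure \<Rightarrow> ('w \<Rightarrow> nat \<Rightarrow> real) \<Rightarrow> bool" where
  "white_noise M W \<longleftrightarrow>
     prob_space.indep_vars M (\<lambda>_. borel) (\<lambda>k \<omega>. W \<omega> k) UNIV \<and>
     (\<forall>k. distributed M lborel (\<lambda>\<omega>. W \<omega> k) std_normal_density)"

definition solves :: "'w measure \<Rightarrow> (nat \<Rightarrow> real) \<Rightarrow> real \<Rightarrow> ('w \<Rightarrow> nat \<Rightarrow> real) \<Rightarrow>
    ('w \<Rightarrow> nat \<Rightarrow> real) \<Rightarrow> bool" where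
  "solves M eig \<beta> W u \<longleftrightarrow> (AE \<omega> in M. L_power eig \<beta> (u \<omega>) = W \<omega>)"

end

theory Submission
  imports Defs
begin

text \<open>
  In the eigenbasis the equation is diagonal, so its only candidate solution is
  \<open>u\<^sub>k = \<lambda>\<^sub>k powr (-\<beta>) * \<xi>\<^sub>k\<close>, and \<open>\<bbbE> \<parallel>u\<parallel>\<^sup>2\<close> in \<open>H\<^sup>s\<close> with \<open>s = 2\<beta> - 1/2 - \<epsilon>\<close> is
  \<open>\<Sum>\<^sub>k \<lambda>\<^sub>k powr (-1/2 - \<epsilon>)\<close>.  Everything thus rests on \<open>\<lambda>\<^sub>k > 0\<close> and on the Weyl type bound
  \<open>#{k. \<lambda>\<^sub>k \<le> t} \<le> C \<surd>t\<close>.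

  At a vertex, maximal rank and self-adjointness of \<open>A B\<^sup>*\<close> turn \<open>A F + B G = 0\<close> into
  \<open>F = B\<^sup>* y\<close>, \<open>G = - A\<^sup>* y\<close>, whence \<open>F \<bullet> G = - \<Lambda>\<^sub>v F \<bullet> F\<close>.  Integrating by parts, the quadratic form
  of \<open>L\<close> is \<open>\<integral>a u'\<^sup>2 + \<kappa>\<^sup>2 u\<^sup>2\<close> minus \<open>\<Sum>\<^sub>v \<Lambda>\<^sub>v F \<bullet> F\<close>, and the trace inequality
  \<open>u(x)\<^sup>2 \<le> (2/h) \<integral>u\<^sup>2 + h \<integral>u'\<^sup>2\<close> makes it positive and bounds \<open>\<parallel>u'\<parallel>\<^sup>2\<close> by \<open>C t \<parallel>u\<parallel>\<^sup>2\<close> on the span of the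
  eigenfunctions with \<open>\<lambda>\<^sub>k \<le> t\<close>.  The same inequality with \<open>h\<close> of order \<open>1/\<surd>t\<close> yields
  \<open>\<Sum>\<^sub>k \<psi>\<^sub>k(x)\<^sup>2 \<le> C \<surd>t\<close> for every \<open>x\<close>; integrating over the graph counts the eigenvalues.
\<close>

section \<open>Integration by parts for absolutely continuous functions\<close>

text \<open>Boundary terms decide the sign of the form, but \<open>weak_deriv\<close> and
  \<open>cont_rep\<close> are chosen only up to null sets. Weak derivatives are therefore traded for
  primitives of integrable densities: on an edge, an eigenfunction and its flux become genuine
  functions with values at both ends, and integration by parts is Fubini on a square. The flux
  \<open>a u'\<close> has this form because a Lipschitz coefficient has a bounded density. The bound
  on \<open>u(x)\<^sup>2\<close> over a spectral subspace becomes a bound on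
  \<open>\<Sum>\<^sub>k \<psi>\<^sub>k(x)\<^sup>2\<close> by a reproducing kernel argument: it is
  applied to the combination whose coefficients are the values \<open>\<psi>\<^sub>k(x)\<close>
  themselves. Three definitions carry obligations of their own. The spectral norm is a supremum,
  informative only once its set is bounded; elements of \<open>H\<^sup>s\<close> with
  \<open>s \<ge> 0\<close> must come from functions, which calls for Riesz-Fischer; random elements
  must be measurable for the sets open in the norm, which calls for a countable dense set. The
  condition \<beta> > 1/4 makes \<open>2 * \<beta>\<close> exceed the exponent 1/2 above which the
  counting bound sums the powers of the eigenvalues.\<close>

abbreviation (input) Leb :: "real \<Rightarrow> real measure" where
  "Leb l \<equiv> lebesgue_on {0..l}"

abbreviation (input) integral_to :: "real \<Rightarrow> (real \<Rightarrow> real) \<Rightarrow> real \<Rightarrow> real" where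
  "integral_to l f x \<equiv> LINT t|Leb l. indicator {..x} t * f t"

text \<open>Absolute continuity with density \<open>f'\<close>. The identity is demanded at every
  point, so \<open>f\<close> is the continuous representative itself and has end values, whereas
  \<open>f'\<close> matters only up to null sets.\<close>

definition prim_on :: "real \<Rightarrow> (real \<Rightarrow> real) \<Rightarrow> (real \<Rightarrow> real) \<Rightarrow> bool" where
  "prim_on l f f' \<longleftrightarrow>
     integrable (Leb l) f' \<and> (\<forall>x\<in>{0..l}. f x = f 0 + (LINT t|Leb x. f' t))"

lemmas lint_cong = Bochner_Integration.integral_cong[OF HOL.refl]

lemma finite_measure_Leb: "finite_measure (Leb l)"
  by (rule finite_measure_lebesgue_on) simp

lemma measure_Leb: "0 \<le> l \<Longrightarrow> measure (Leb l) (space (Leb l)) = l"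
  by (simp add: measure_restrict_space)

lemma AE_Leb_neq: "AE s in Leb l. s \<noteq> t"
proof -
  have "AE s in lebesgue. s \<noteq> t"
    using negligible_sing[of t] by (auto simp: negligible_iff_null_sets intro!: AE_I'[of "{t}"])
  then show ?thesis by (auto simp: AE_restrict_space_iff elim: eventually_mono)
qed

text \<open>Moving the upper limit into an indicator keeps the measure space the same for all
  \<open>x\<close>, as Fubini and linearity require.\<close>

lemma integral_Leb_le:
  assumes "x \<in> {0..l}"
  shows "(LINT t|Leb x. f t) = (LINT t|Leb l. indicator {..x} t * (f t :: real))"
proof -
  have "(LINT t|Leb x. f t) = (LINT t|lebesgue. indicator {0..x} t *\<^sub>R f t)"
    by (rule integral_restrict_space) auto
  also have "\<dots> = (LINT t|lebesgue. indicator {0..l} t *\<^sub>R (indicator {..x} t * f t))"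
    using assms by (intro Bochner_Integration.integral_cong) (auto simp: indicator_def)
  also have "\<dots> = integral_to l f x"
    by (rule integral_restrict_space[symmetric]) auto
  finally show ?thesis .
qed

lemma integrable_indicator_mult:
  assumes "integrable (Leb l) f" "A \<in> sets borel"
  shows "integrable (Leb l) (\<lambda>t. indicator A t * (f t :: real))"
proof -
  have m: "A \<inter> {0..l} \<in> sets (Leb l)"
    using assms(2) by (subst sets_restrict_space_iff) auto
  have "integrable (Leb l) (\<lambda>t. indicator (A \<inter> {0..l}) t *\<^sub>R f t)"
    using integrable_mult_indicator[OF m assms(1)] .
  then show ?thesis
    by (rule Bochner_Integration.integrable_cong[THEN iffD1, rotated 2]) (auto simp: indicator_def)
qed

lemma prim_on_indicator:
  "prim_on l f f' \<Longrightarrow> x \<in> {0..l} \<Longrightarrow> f x = f 0 + integral_to l f' x"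
  unfolding prim_on_def integral_Leb_le[of x l, symmetric] by blast

text \<open>The constant \<open>c\<close> need not be given as \<open>f 0\<close>: at
  \<open>x = 0\<close> the integral sees a single point, which forces it.\<close>

lemma prim_onI:
  assumes "integrable (Leb l) f'"
    and "\<And>x. x \<in> {0..l} \<Longrightarrow> f x = c + integral_to l f' x"
  shows "prim_on l f f'"
proof (cases "0 \<le> l")
  case True
  have z: "integral_to l f' 0 = 0"
  proof (rule integral_eq_zero_AE)
    show "AE t in Leb l. indicator {..0::real} t * f' t = 0"
      using AE_Leb_neq[of 0 l] AE_space[of "Leb l"] by eventually_elim (auto simp: indicator_def)
  qed
  then have c: "c = f 0" using assms(2)[of 0] True by simp
  show ?thesis unfolding prim_on_def
  proof (intro conjI ballI assms(1))
    fix x assume x: "x \<in> {0..l}"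
    show "f x = f 0 + (LINT t|Leb x. f' t)"
      unfolding integral_Leb_le[OF x] by (subst assms(2)[OF x]) (simp add: c)
  qed
qed (use assms(1) in \<open>simp add: prim_on_def\<close>)

lemma prim_on_integrable: "prim_on l f f' \<Longrightarrow> integrable (Leb l) f'"
  by (simp add: prim_on_def)

lemma prim_on_continuous:
  assumes "prim_on l f f'" shows "continuous_on {0..l} f"
proof -
  have "continuous_on {0..l} (\<lambda>x. f 0 + (LINT t|Leb x. f' t))"
    by (intro continuous_intros indefinite_integral_continuous_real prim_on_integrable[OF assms])
  then show ?thesis
    by (rule continuous_on_eq) (metis assms prim_on_def)
qed

lemma continuous_measurable_Leb: "continuous_on {0..l} f \<Longrightarrow> (f :: real \<Rightarrow> real) \<in> borel_measurable (Leb l)"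
  by (rule continuous_imp_measurable_on_sets_lebesgue) auto

lemma continuous_on_bounded_Icc:
  assumes "continuous_on {0..l} (f :: real \<Rightarrow> real)"
  obtains C where "0 \<le> C" "\<And>x. x \<in> {0..l} \<Longrightarrow> \<bar>f x\<bar> \<le> C"
proof -
  have "bounded (f ` {0..l})"
    by (rule compact_imp_bounded[OF compact_continuous_image[OF assms]]) simp
  then obtain C where "\<And>x. x \<in> {0..l} \<Longrightarrow> \<bar>f x\<bar> \<le> C"
    unfolding bounded_iff by fastforce
  then show ?thesis using that[of "max 0 C"] by fastforce
qed

lemma integrable_mult_continuous:
  assumes "integrable (Leb l) f" "continuous_on {0..l} g"
  shows "integrable (Leb l) (\<lambda>x. f x * (g x :: real))"
proof -
  obtain C where C: "0 \<le> C" "\<And>x. x \<in> {0..l} \<Longrightarrow> \<bar>g x\<bar> \<le> C"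
    using continuous_on_bounded_Icc[OF assms(2)] by blast
  show ?thesis
  proof (rule Bochner_Integration.integrable_bound[of _ "\<lambda>x. C * f x"])
    show "(\<lambda>x. f x * g x) \<in> borel_measurable (Leb l)"
      using assms continuous_measurable_Leb by auto
    show "AE x in Leb l. norm (f x * g x) \<le> norm (C * f x)"
    proof (rule AE_I2)
      fix x assume "x \<in> space (Leb l)"
      then have "\<bar>g x\<bar> \<le> C" using C by simp
      then have "\<bar>g x\<bar> * \<bar>f x\<bar> \<le> C * \<bar>f x\<bar>" by (rule mult_right_mono) simp
      then show "norm (f x * g x) \<le> norm (C * f x)" using C by (simp add: abs_mult mult.commute)
    qed
  qed (use assms in simp)
qed

lemma pair_Leb: "pair_sigma_finite (Leb l) (Leb l)"
  using finite_measure_Leb by (simp add: pair_sigma_finite_def finite_measure_def)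

text \<open>Fubini for \<open>F t * G s\<close> on the square: the two summands on the left are the
  integrals over the triangles on either side of the diagonal, and the diagonal is a null
  set.\<close>

lemma integral_prod_triangles:
  fixes F G :: "real \<Rightarrow> real"
  assumes F: "integrable (Leb l) F" and G: "integrable (Leb l) G"
  defines "P \<equiv> \<lambda>t. LINT s|Leb l. indicator {..t} s * G s"
    and "Q \<equiv> \<lambda>s. LINT t|Leb l. indicator {..s} t * F t"
  shows "(LINT t|Leb l. F t * P t) + (LINT s|Leb l. G s * Q s) = (LINT t|Leb l. F t) * (LINT s|Leb l. G s)"
proof -
  interpret pair_sigma_finite "Leb l" "Leb l" by (rule pair_Leb)
  interpret finite_measure "Leb l" by (rule finite_measure_Leb)
  note [measurable] = borel_measurable_integrable[OF F] borel_measurable_integrable[OF G]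
  have id[measurable]: "(\<lambda>x::real. x) \<in> borel_measurable (Leb l)"
    by (rule continuous_measurable_Leb) (rule continuous_on_id)
  have int: "integrable (Leb l \<Otimes>\<^sub>M Leb l) (\<lambda>(s,t). F t * G s)"
  proof (rule Fubini_integrable)
    show "integrable (Leb l) (\<lambda>x. LINT y|Leb l. norm (case (x, y) of (s, t) \<Rightarrow> F t * G s))"
      using F G by (simp add: abs_mult)
  qed (use F G in \<open>auto simp: case_prod_beta intro!: measurable_fst'' measurable_snd'' borel_measurable_times\<close>)
  have m: "(\<lambda>(s,t). indicator {..t} s * (F t * G s)) \<in> borel_measurable (Leb l \<Otimes>\<^sub>M Leb l)"
  proof -
    have [measurable]: "Measurable.pred (Leb l \<Otimes>\<^sub>M Leb l) (\<lambda>z. fst z \<le> snd z)"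
      by measurable
    have "(\<lambda>z. (if fst z \<le> snd z then 1 else 0) * (F (snd z) * G (fst z))) \<in> borel_measurable (Leb l \<Otimes>\<^sub>M Leb l)"
      by measurable
    then show ?thesis by (simp add: case_prod_beta indicator_def cong: if_cong)
  qed
  have int2: "integrable (Leb l \<Otimes>\<^sub>M Leb l) (\<lambda>(s,t). indicator {..t} s * (F t * G s))"
    by (rule Bochner_Integration.integrable_bound[OF int m]) (auto simp: indicator_def)
  have "(LINT t|Leb l. F t * P t) = (LINT t|Leb l. LINT s|Leb l. indicator {..t} s * (F t * G s))"
    unfolding P_def by (simp add: integral_mult_right_zero[symmetric] ac_simps del: integral_mult_right_zero)
  also have "\<dots> = (LINT s|Leb l. LINT t|Leb l. indicator {..t} s * (F t * G s))"
    using Fubini_integral[OF int2] by simp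
  also have "\<dots> = (LINT s|Leb l. G s * ((LINT t|Leb l. F t) - Q s))"
  proof (intro lint_cong)
    fix s
    have "(LINT t|Leb l. indicator {..t} s * (F t * G s)) = (LINT t|Leb l. G s * (F t - indicator {..s} t * F t))"
    proof (rule integral_cong_AE)
      have "(\<lambda>t. indicator {..t} s * (F t * G s)) = (\<lambda>t. indicator {s..} t * F t * G s)"
        by (auto simp: indicator_def)
      then show "(\<lambda>t. indicator {..t} s * (F t * G s)) \<in> borel_measurable (Leb l)"
        using integrable_indicator_mult[OF F, of "{s..}"] by simp
      show "(\<lambda>t. G s * (F t - indicator {..s} t * F t)) \<in> borel_measurable (Leb l)"
        using integrable_indicator_mult[OF F, of "{..s}"] by simp
      show "AE t in Leb l. indicator {..t} s * (F t * G s) = G s * (F t - indicator {..s} t * F t)"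
        using AE_Leb_neq[of s l] by eventually_elim (auto simp: indicator_def)
    qed
    also have "\<dots> = G s * ((LINT t|Leb l. F t) - Q s)"
      unfolding Q_def using integrable_indicator_mult[OF F, of "{..s}"] F by simp
    finally show "(LINT t|Leb l. indicator {..t} s * (F t * G s)) = G s * ((LINT t|Leb l. F t) - Q s)" .
  qed
  also have "\<dots> = (LINT s|Leb l. G s * (LINT t|Leb l. F t)) - (LINT s|Leb l. G s * Q s)"
  proof -
    have "prim_on l Q F" by (rule prim_onI[OF F, of _ 0]) (simp add: Q_def)
    then have "integrable (Leb l) (\<lambda>s. G s * Q s)"
      by (intro integrable_mult_continuous G prim_on_continuous)
    then show ?thesis using G by (simp add: algebra_simps)
  qed
  finally show ?thesis by simp
qed

text \<open>With both densities cut off at \<open>x\<close>, the triangle identity yields the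
  product of the increments \<open>(f x - f 0) * (g x - g 0)\<close>; the mixed terms with
  \<open>g 0\<close> and \<open>f 0\<close> complete it to
  \<open>f x * g x - f 0 * g 0\<close>.\<close>

lemma prim_on_mult:
  assumes f: "prim_on l f f'" and g: "prim_on l g g'"
  shows "prim_on l (\<lambda>x. f x * g x) (\<lambda>x. f' x * g x + f x * g' x)"
proof (rule prim_onI[of _ _ _ "f 0 * g 0"])
  note fi = prim_on_integrable[OF f] and gi = prim_on_integrable[OF g]
  have 1: "integrable (Leb l) (\<lambda>x. f' x * g x)"
    by (intro integrable_mult_continuous fi prim_on_continuous[OF g])
  have 2: "integrable (Leb l) (\<lambda>x. f x * g' x)"
    using integrable_mult_continuous[OF gi prim_on_continuous[OF f]] by (simp add: mult.commute)
  show "integrable (Leb l) (\<lambda>x. f' x * g x + f x * g' x)" using 1 2 by simp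
  fix x assume x: "x \<in> {0..l}"
  define F where "F = (\<lambda>t. indicator {..x} t * f' t)"
  define G where "G = (\<lambda>t. indicator {..x} t * g' t)"
  have Fi: "integrable (Leb l) F" and Gi: "integrable (Leb l) G"
    unfolding F_def G_def by (auto intro!: integrable_indicator_mult fi gi)
  define P where "P = (\<lambda>t. LINT s|Leb l. indicator {..t} s * G s)"
  define Q where "Q = (\<lambda>t. LINT s|Leb l. indicator {..t} s * F s)"
  have Pp: "prim_on l P G" by (rule prim_onI[OF Gi, of _ 0]) (simp add: P_def)
  have Qp: "prim_on l Q F" by (rule prim_onI[OF Fi, of _ 0]) (simp add: Q_def)
  have gP: "g t = g 0 + P t" and fQ: "f t = f 0 + Q t" if "t \<in> {0..l}" "t \<le> x" for t
  proof -
    have "P t = integral_to l g' t" "Q t = integral_to l f' t"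
      unfolding P_def Q_def F_def G_def using that
      by (auto intro!: Bochner_Integration.integral_cong simp: indicator_def)
    then show "g t = g 0 + P t" "f t = f 0 + Q t"
      using prim_on_indicator[OF g that(1)] prim_on_indicator[OF f that(1)] by auto
  qed
  have "(LINT t|Leb l. indicator {..x} t * (f' t * g t + f t * g' t))
     = (LINT t|Leb l. (F t * P t + G t * Q t) + (F t * g 0 + f 0 * G t))"
  proof (intro lint_cong)
    fix t assume "t \<in> space (Leb l)"
    then have t: "t \<in> {0..l}" by simp
    show "indicator {..x} t * (f' t * g t + f t * g' t) = (F t * P t + G t * Q t) + (F t * g 0 + f 0 * G t)"
      using gP[OF t] fQ[OF t] by (cases "t \<le> x") (auto simp: F_def G_def algebra_simps)
  qed
  also have "\<dots> = ((LINT t|Leb l. F t * P t) + (LINT t|Leb l. G t * Q t)) + ((LINT t|Leb l. F t) * g 0 + f 0 * (LINT t|Leb l. G t))"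
    using Fi Gi integrable_mult_continuous[OF Fi prim_on_continuous[OF Pp]]
      integrable_mult_continuous[OF Gi prim_on_continuous[OF Qp]] by simp
  also have "\<dots> = (LINT t|Leb l. F t) * (LINT t|Leb l. G t) + ((LINT t|Leb l. F t) * g 0 + f 0 * (LINT t|Leb l. G t))"
    using integral_prod_triangles[OF Fi Gi] unfolding P_def Q_def by simp
  finally show "f x * g x = f 0 * g 0 + (LINT t|Leb l. indicator {..x} t * (f' t * g t + f t * g' t))"
    using prim_on_indicator[OF f x] prim_on_indicator[OF g x]
    unfolding F_def[symmetric] G_def[symmetric] by (simp add: algebra_simps)
qed

lemma prim_on_sum:
  assumes "\<And>k. k \<in> K \<Longrightarrow> prim_on l (f k) (f' k)"
  shows "prim_on l (\<lambda>x. \<Sum>k\<in>K. c k * f k x) (\<lambda>x. \<Sum>k\<in>K. c k * f' k x)"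
proof (rule prim_onI[of _ _ _ "\<Sum>k\<in>K. c k * f k 0"])
  have i: "k \<in> K \<Longrightarrow> integrable (Leb l) (f' k)" for k using assms prim_on_integrable by blast
  then show "integrable (Leb l) (\<lambda>x. \<Sum>k\<in>K. c k * f' k x)" by auto
  fix x assume x: "x \<in> {0..l}"
  have "(LINT t|Leb l. indicator {..x} t * (\<Sum>k\<in>K. c k * f' k t))
     = (LINT t|Leb l. (\<Sum>k\<in>K. c k * (indicator {..x} t * f' k t)))"
    by (simp add: sum_distrib_left mult.left_commute)
  also have "\<dots> = (\<Sum>k\<in>K. c k * (LINT t|Leb l. indicator {..x} t * f' k t))"
    using i integrable_indicator_mult by (subst Bochner_Integration.integral_sum) auto
  finally show "(\<Sum>k\<in>K. c k * f k x) = (\<Sum>k\<in>K. c k * f k 0) + (LINT t|Leb l. indicator {..x} t * (\<Sum>k\<in>K. c k * f' k t))"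
    using prim_on_indicator[OF assms x]
    by (simp add: sum.distrib[symmetric] distrib_left[symmetric] cong: sum.cong)
qed

lemma prim_on_C1:
  assumes "\<And>x. (f has_real_derivative f' x) (at x)" "continuous_on UNIV f'"
  shows "prim_on l f f'"
  unfolding prim_on_def
proof safe
  show "integrable (Leb l) f'"
    by (intro continuous_imp_integrable_real continuous_on_subset[OF assms(2)]) auto
  fix x assume x: "x \<in> {0..l}"
  have "integrable (Leb x) f'"
    by (intro continuous_imp_integrable_real continuous_on_subset[OF assms(2)]) auto
  then have "(LINT t|Leb x. f' t) = integral {0..x} f'" by (rule lebesgue_integral_eq_integral) simp
  also have "\<dots> = f x - f 0"
    using x assms(1) by (intro integral_unique fundamental_theorem_of_calculus)
      (auto simp: has_real_derivative_iff_has_vector_derivative[symmetric] intro: DERIV_subset)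
  finally show "f x = f 0 + (LINT t|Leb x. f' t)" by simp
qed

section \<open>Weak derivatives on an interval\<close>

lemma prim_on_end: "prim_on l f f' \<Longrightarrow> 0 < l \<Longrightarrow> f l = f 0 + (LINT t|Leb l. f' t)"
  unfolding prim_on_def by (drule conjunct2, drule bspec[of _ _ l]) simp_all

text \<open>The polynomial \<open>x * (l - x)\<close> stands in for the distance to the ends: a
  cut-off that vanishes where it is below \<open>r * l\<close> is supported in
  \<open>{r..l - r}\<close>.\<close>

lemma parabola_less:
  fixes x :: real
  assumes out: "x \<notin> {r..l - r}" and r: "0 < r" and l: "0 < l"
  shows "x * (l - x) < r * l"
proof (cases "0 < x \<and> x < l")
  case True
  then have "x * (l - x) \<le> x * l" "(l - x) * x \<le> (l - x) * l" by (auto intro!: mult_left_mono)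
  moreover have "x < r \<or> l - x < r" using out by auto
  then have "x * l < r * l \<or> (l - x) * l < r * l" using l by auto
  ultimately show ?thesis by (auto simp: mult.commute)
next
  case False
  then have "x * (l - x) \<le> 0" using l by (auto simp: mult_le_0_iff)
  also have "0 < r * l" using r l by simp
  finally show ?thesis .
qed

text \<open>Continuous functions supported inside the open interval converge to \<open>sgn f\<close>
  almost everywhere: take continuous approximants, clip them to \<open>[-1, 1]\<close> and multiply
  by a cut-off. Dominated convergence with majorant \<open>\<bar>f x\<bar>\<close> then shows that
  the integral of \<open>\<bar>f x\<bar>\<close> vanishes.\<close>

lemma AE_zero_if_orthogonal:
  fixes f :: "real \<Rightarrow> real"
  assumes f: "integrable (Leb l) f" and l: "0 < l"
    and orth: "\<And>\<psi> c d. continuous_on UNIV \<psi> \<Longrightarrow> 0 < c \<Longrightarrow> d < l \<Longrightarrow> (\<And>x. x \<notin> {c..d} \<Longrightarrow> \<psi> x = 0) \<Longrightarrow>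
      (LINT x|Leb l. f x * \<psi> x) = 0"
  shows "AE x in Leb l. f x = 0"
proof -
  note [measurable] = borel_measurable_integrable[OF f]
  define S where "S = (\<lambda>x. if x \<in> {0..l} then sgn (f x) else 0)"
  have "(\<lambda>x. sgn (f x)) \<in> borel_measurable (Leb l)" by measurable
  then have "S \<in> borel_measurable lebesgue"
    unfolding S_def by (subst borel_measurable_if) auto
  then have "S measurable_on {0..l}" by (rule lebesgue_measurable_imp_measurable_on) auto
  then obtain N g where N: "negligible N" and g: "\<And>n. continuous_on UNIV (g n)"
    and lim: "\<And>x. x \<notin> N \<Longrightarrow> (\<lambda>n. g n x) \<longlonglongrightarrow> (if x \<in> {0..l} then S x else 0)"
    unfolding measurable_on_def by blast
  \<comment> \<open>At a fixed interior \<open>x\<close> the cut-off is 1 once \<open>n\<close>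
    exceeds \<open>2 / (x * (l - x))\<close>; the offset 1 is what makes it vanish near both
    ends.\<close>
  define cut where "cut = (\<lambda>n x. min 1 (max 0 (real (Suc n) * (x * (l - x)) - 1)))"
  define \<psi> where "\<psi> = (\<lambda>n x. max (-1) (min 1 (g n x)) * cut n x)"
  have cont: "continuous_on UNIV (\<psi> n)" for n
    unfolding \<psi>_def cut_def by (intro continuous_intros g)
  have cut0: "cut n x = 0" if out: "x \<notin> {1 / (real (Suc n) * l)..l - 1 / (real (Suc n) * l)}" for n x
  proof -
    have "x * (l - x) < 1 / (real (Suc n) * l) * l" by (rule parabola_less[OF out]) (use l in simp_all)
    then have "real (Suc n) * (x * (l - x)) < 1" using l by (simp add: pos_less_divide_eq mult.commute del: of_nat_Suc)
    then show ?thesis by (simp add: cut_def)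
  qed
  have zero: "(LINT x|Leb l. f x * \<psi> n x) = 0" for n
    by (rule orth[OF cont, of "1 / (real (Suc n) * l)" "l - 1 / (real (Suc n) * l)"])
      (use l cut0 in \<open>auto simp: \<psi>_def\<close>)
  have bnd: "\<bar>\<psi> n x\<bar> \<le> 1" for n x
  proof -
    have "\<bar>max (-1) (min 1 (g n x))\<bar> \<le> 1" "\<bar>cut n x\<bar> \<le> 1" by (auto simp: cut_def)
    then have "\<bar>max (-1) (min 1 (g n x))\<bar> * \<bar>cut n x\<bar> \<le> 1 * 1" by (intro mult_mono) auto
    then show ?thesis by (simp add: \<psi>_def abs_mult)
  qed
  have "(\<lambda>n. LINT x|Leb l. f x * \<psi> n x) \<longlonglongrightarrow> (LINT x|Leb l. \<bar>f x\<bar>)"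
  proof (rule integral_dominated_convergence[where w = "\<lambda>x. \<bar>f x\<bar>"])
    show "(\<lambda>x. f x * \<psi> i x) \<in> borel_measurable (Leb l)" for i
      using continuous_measurable_Leb[OF continuous_on_subset[OF cont[of i]], of l] by auto
    show "AE x in Leb l. norm (f x * \<psi> i x) \<le> \<bar>f x\<bar>" for i
    proof (rule AE_I2)
      fix x
      have "\<bar>f x\<bar> * \<bar>\<psi> i x\<bar> \<le> \<bar>f x\<bar> * 1" by (intro mult_left_mono bnd) simp
      then show "norm (f x * \<psi> i x) \<le> \<bar>f x\<bar>" by (simp add: abs_mult)
    qed
    have "AE x in Leb l. x \<notin> N"
    proof -
      have "AE x in lebesgue. x \<notin> N" using N by (auto simp: negligible_iff_null_sets intro!: AE_I'[of N])
      then show ?thesis by (auto simp: AE_restrict_space_iff elim: eventually_mono)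
    qed
    then show "AE x in Leb l. (\<lambda>i. f x * \<psi> i x) \<longlonglongrightarrow> \<bar>f x\<bar>"
      using AE_Leb_neq[of 0 l] AE_Leb_neq[of l l] AE_space
    proof eventually_elim
      case (elim x)
      then have x: "x \<in> {0<..<l}" by auto
      then have p: "0 < x * (l - x)" by simp
      have "(\<lambda>n. g n x) \<longlonglongrightarrow> sgn (f x)" using lim[of x] elim x by (simp add: S_def)
      then have 1: "(\<lambda>n. max (-1) (min 1 (g n x))) \<longlonglongrightarrow> max (-1) (min 1 (sgn (f x)))" by (intro tendsto_intros)
      obtain m where m: "2 / (x * (l - x)) < real m" using reals_Archimedean2 by blast
      have "eventually (\<lambda>n. cut n x = 1) sequentially"
        using eventually_ge_at_top[of m]
      proof eventually_elim
        case (elim n)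
        have "2 < real m * (x * (l - x))" using m p by (simp add: divide_less_eq)
        also have "\<dots> \<le> real (Suc n) * (x * (l - x))" using elim p by (intro mult_right_mono) auto
        finally show ?case by (simp add: cut_def)
      qed
      then have 2: "(\<lambda>n. cut n x) \<longlonglongrightarrow> 1" by (rule tendsto_eventually)
      have "(\<lambda>n. f x * \<psi> n x) \<longlonglongrightarrow> f x * (max (-1) (min 1 (sgn (f x))) * 1)"
        unfolding \<psi>_def by (intro tendsto_intros 1 2)
      moreover have "f x * (max (-1) (min 1 (sgn (f x))) * 1) = \<bar>f x\<bar>" by (simp add: sgn_if)
      ultimately show ?case by (simp only:)
    qed
  qed (use f in auto)
  then have "(LINT x|Leb l. \<bar>f x\<bar>) = 0" by (simp add: zero LIMSEQ_const_iff)
  then have "AE x in Leb l. \<bar>f x\<bar> = 0"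
    using f by (subst (asm) integral_nonneg_eq_0_iff_AE) auto
  then show ?thesis by simp
qed

text \<open>In the integration by parts against a polynomial all terms containing \<open>F\<close>
  vanish, so \<open>w\<close> is orthogonal to polynomials and, by Stone-Weierstrass, to all
  continuous functions. This is uniqueness of densities.\<close>

lemma prim_on_zero_AE:
  assumes F: "prim_on l F w" and 0: "\<And>x. x \<in> {0..l} \<Longrightarrow> F x = 0" and l: "0 < l"
  shows "AE x in Leb l. w x = 0"
proof (rule AE_zero_if_orthogonal[OF prim_on_integrable[OF F] l])
  fix \<psi> :: "real \<Rightarrow> real" assume \<psi>: "continuous_on UNIV \<psi>"
  have w: "integrable (Leb l) w" by (rule prim_on_integrable[OF F])
  have poly: "(LINT x|Leb l. w x * p x) = 0" if p: "real_polynomial_function p" for p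
  proof -
    obtain p' where p': "real_polynomial_function p'" "\<And>x. (p has_real_derivative p' x) (at x)"
      using has_real_derivative_polynomial_function[OF p] by blast
    have c: "continuous_on UNIV p'"
      using p'(1) by (intro continuous_on_polymonial_function) (simp add: real_polynomial_function_eq)
    have "F l * p l = F 0 * p 0 + (LINT x|Leb l. w x * p x + F x * p' x)"
      by (rule prim_on_end[OF prim_on_mult[OF F prim_on_C1[OF p'(2) c]] l])
    also have "(LINT x|Leb l. w x * p x + F x * p' x) = (LINT x|Leb l. w x * p x)"
      by (rule Bochner_Integration.integral_cong) (simp_all add: 0)
    finally show ?thesis using 0[of l] 0[of 0] l by simp
  qed
  have bound: "\<bar>LINT x|Leb l. w x * \<psi> x\<bar> \<le> e * (LINT x|Leb l. \<bar>w x\<bar>)" if e: "0 < e" for e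
  proof -
    obtain p where p: "real_polynomial_function p" "\<And>x. x \<in> {0..l} \<Longrightarrow> \<bar>\<psi> x - p x\<bar> < e"
      using Stone_Weierstrass_real_polynomial_function[of "{0..l}" \<psi> e] \<psi> e
      by (metis compact_Icc continuous_on_subset top_greatest)
    have pc: "continuous_on {0..l} p"
      using p(1) by (intro continuous_on_polymonial_function) (simp add: real_polynomial_function_eq)
    have i1: "integrable (Leb l) (\<lambda>x. w x * \<psi> x)" and i2: "integrable (Leb l) (\<lambda>x. w x * p x)"
      using integrable_mult_continuous[OF w] pc \<psi> continuous_on_subset by blast+
    have "(LINT x|Leb l. w x * \<psi> x) = (LINT x|Leb l. w x * \<psi> x - w x * p x)"
      using i1 i2 poly[OF p(1)] by simp
    also have "\<bar>\<dots>\<bar> \<le> (LINT x|Leb l. \<bar>w x * \<psi> x - w x * p x\<bar>)" by (rule integral_abs_bound)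
    also have "\<dots> \<le> (LINT x|Leb l. e * \<bar>w x\<bar>)"
    proof (rule integral_mono)
      fix x assume "x \<in> space (Leb l)"
      then have "\<bar>\<psi> x - p x\<bar> \<le> e" using p(2)[of x] by simp
      then have "\<bar>w x\<bar> * \<bar>\<psi> x - p x\<bar> \<le> \<bar>w x\<bar> * e" by (intro mult_left_mono) auto
      then show "\<bar>w x * \<psi> x - w x * p x\<bar> \<le> e * \<bar>w x\<bar>"
        by (simp add: abs_mult[symmetric] algebra_simps)
    qed (use i1 i2 w in auto)
    finally show ?thesis by simp
  qed
  show "(LINT x|Leb l. w x * \<psi> x) = 0"
  proof (rule ccontr)
    assume n: "(LINT x|Leb l. w x * \<psi> x) \<noteq> 0"
    define I where "I = (LINT x|Leb l. \<bar>w x\<bar>)"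
    have I: "0 \<le> I" by (simp add: I_def)
    \<comment> \<open>This accuracy makes the bound at most half of the quantity itself; the summand
      1 covers \<open>I = 0\<close>.\<close>
    have "\<bar>LINT x|Leb l. w x * \<psi> x\<bar> \<le> \<bar>LINT x|Leb l. w x * \<psi> x\<bar> / (2 * (I + 1)) * I"
      unfolding I_def by (rule bound) (use n I in \<open>simp add: I_def add_nonneg_pos\<close>)
    also have "\<dots> \<le> \<bar>LINT x|Leb l. w x * \<psi> x\<bar> / 2"
      using I by (simp add: field_simps mult_left_mono)
    finally show False using n by simp
  qed
qed

lemma prim_on_cong:
  assumes "prim_on l f f'" "\<And>x. x \<in> {0..l} \<Longrightarrow> g x = f x"
  shows "prim_on l g f'"
proof (rule prim_onI[OF prim_on_integrable[OF assms(1)], of _ "f 0"])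
  fix x assume x: "x \<in> {0..l}"
  show "g x = f 0 + integral_to l f' x"
    unfolding assms(2)[OF x] by (rule prim_on_indicator[OF assms(1) x])
qed

lemma continuous_AE_eq:
  assumes "continuous_on {0..l} f" "continuous_on {0..l} g" "AE x in Leb l. f x = (g x :: real)" "0 < l"
    and x: "x \<in> {0..l}"
  shows "f x = g x"
proof -
  have c: "continuous_on {0..l} (\<lambda>x. \<bar>f x - g x\<bar>)" by (intro continuous_intros assms)
  have "(LINT x|Leb l. \<bar>f x - g x\<bar>) = 0"
    by (rule integral_eq_zero_AE) (use assms(3) in auto)
  then have "integral {0..l} (\<lambda>x. \<bar>f x - g x\<bar>) = 0"
    using lebesgue_integral_eq_integral[OF continuous_imp_integrable_real[OF c]] by simp
  then show ?thesis using integral_eq_0_iff[OF c \<open>0 < l\<close>] x by auto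
qed

section \<open>Closure properties of square integrable functions\<close>

lemma sq_integrable_mult:
  assumes "sq_integrable l u" "sq_integrable l v"
  shows "integrable (Leb l) (\<lambda>x. u x * v x)"
proof (rule Bochner_Integration.integrable_bound[of _ "\<lambda>x. (u x)\<^sup>2 + (v x)\<^sup>2"])
  show "AE x in Leb l. norm (u x * v x) \<le> norm ((u x)\<^sup>2 + (v x)\<^sup>2)"
  proof (rule AE_I2)
    fix x
    have "0 \<le> (\<bar>u x\<bar> - \<bar>v x\<bar>)\<^sup>2" by simp
    then have "2 * (\<bar>u x\<bar> * \<bar>v x\<bar>) \<le> (u x)\<^sup>2 + (v x)\<^sup>2" by (simp add: power2_diff)
    moreover have "0 \<le> \<bar>u x\<bar> * \<bar>v x\<bar>" by simp
    ultimately have "\<bar>u x\<bar> * \<bar>v x\<bar> \<le> (u x)\<^sup>2 + (v x)\<^sup>2"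
      by (smt (verit, ccfv_threshold))
    moreover have "norm (u x * v x) = \<bar>u x\<bar> * \<bar>v x\<bar>" by (simp add: abs_mult)
    moreover have "norm ((u x)\<^sup>2 + (v x)\<^sup>2) = (u x)\<^sup>2 + (v x)\<^sup>2" by simp
    ultimately show "norm (u x * v x) \<le> norm ((u x)\<^sup>2 + (v x)\<^sup>2)" by (simp only:)
  qed
qed (use assms in \<open>auto simp: sq_integrable_def\<close>)

lemma sq_integrable_const: "sq_integrable l (\<lambda>_. c)"
  using finite_measure.integrable_const[OF finite_measure_Leb] by (simp add: sq_integrable_def)

lemma sq_integrable_integrable: "sq_integrable l u \<Longrightarrow> integrable (Leb l) u"
  using sq_integrable_mult[OF _ sq_integrable_const, of l u 1] by simp

lemma sq_integrable_add:
  assumes "sq_integrable l u" "sq_integrable l v" shows "sq_integrable l (\<lambda>x. u x + v x)"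
  using assms sq_integrable_mult[OF assms]
  unfolding sq_integrable_def by (auto simp: power2_sum mult.assoc)

lemma sq_integrable_cmult: "sq_integrable l u \<Longrightarrow> sq_integrable l (\<lambda>x. c * u x)"
  unfolding sq_integrable_def by (auto simp: power_mult_distrib)

lemma sq_integrable_sum:
  assumes "\<And>k. k \<in> K \<Longrightarrow> sq_integrable l (f k)" shows "sq_integrable l (\<lambda>x. \<Sum>k\<in>K. c k * f k x)"
  using assms
proof (induction K rule: infinite_finite_induct)
  case (insert a K)
  then show ?case by (simp add: sq_integrable_add sq_integrable_cmult)
qed (simp_all add: sq_integrable_const)

lemma sq_integrable_continuous:
  assumes "continuous_on {0..l} u" shows "sq_integrable l u"
  unfolding sq_integrable_def using continuous_measurable_Leb[OF assms]
  by (auto intro!: continuous_imp_integrable_real continuous_intros assms)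

lemma sq_integrable_bounded_mult:
  assumes u: "sq_integrable l u" and g: "g \<in> borel_measurable (Leb l)" "AE x in Leb l. \<bar>g x\<bar> \<le> C"
  shows "sq_integrable l (\<lambda>x. g x * u x)"
proof -
  have "integrable (Leb l) (\<lambda>x. (g x * u x)\<^sup>2)"
  proof (rule Bochner_Integration.integrable_bound[of _ "\<lambda>x. C\<^sup>2 * (u x)\<^sup>2"])
    show "AE x in Leb l. norm ((g x * u x)\<^sup>2) \<le> norm (C\<^sup>2 * (u x)\<^sup>2)"
      using g(2)
    proof eventually_elim
      case (elim x)
      then have "(g x)\<^sup>2 \<le> C\<^sup>2" by (metis abs_ge_zero power2_abs power_mono)
      then show ?case by (simp add: power_mult_distrib mult_right_mono)
    qed
  qed (use u g in \<open>auto simp: sq_integrable_def\<close>)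
  then show ?thesis using u g by (auto simp: sq_integrable_def)
qed

lemma prim_on_has_weak_deriv:
  assumes f: "prim_on l f w" and u: "AE x in Leb l. u x = f x" "u \<in> borel_measurable (Leb l)" and l: "0 < l"
  shows "has_weak_deriv l u w"
  unfolding has_weak_deriv_def
proof (intro allI impI)
  fix \<phi> \<phi>' assume "test_function l \<phi> \<phi>'"
  then obtain c d where t: "\<And>x. (\<phi> has_real_derivative \<phi>' x) (at x)" "continuous_on UNIV \<phi>'"
    "0 < c" "d < l" "\<And>x. x \<notin> {c..d} \<Longrightarrow> \<phi> x = 0" unfolding test_function_def by blast
  have p: "prim_on l \<phi> \<phi>'" by (rule prim_on_C1[OF t(1,2)])
  have m: "f \<in> borel_measurable (Leb l)" "\<phi>' \<in> borel_measurable (Leb l)"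
    using prim_on_continuous[OF f] prim_on_integrable[OF p] continuous_measurable_Leb by auto
  have i1: "integrable (Leb l) (\<lambda>x. w x * \<phi> x)"
    by (intro integrable_mult_continuous prim_on_integrable[OF f] prim_on_continuous[OF p])
  have i2: "integrable (Leb l) (\<lambda>x. f x * \<phi>' x)"
    using integrable_mult_continuous[OF prim_on_integrable[OF p] prim_on_continuous[OF f]] by (simp add: mult.commute)
  have "f l * \<phi> l = f 0 * \<phi> 0 + (LINT x|Leb l. w x * \<phi> x + f x * \<phi>' x)"
    by (rule prim_on_end[OF prim_on_mult[OF f p] l])
  moreover have "\<phi> l = 0" "\<phi> 0 = 0" using t(3-) by auto
  ultimately have "(LINT x|Leb l. f x * \<phi>' x) = - (LINT x|Leb l. w x * \<phi> x)"
    using i1 i2 by simp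
  moreover have "(LINT x|Leb l. u x * \<phi>' x) = (LINT x|Leb l. f x * \<phi>' x)"
    by (rule integral_cong_AE) (use u m in auto)
  ultimately show "(LINT x|Leb l. u x * \<phi>' x) = - (LINT x|Leb l. w x * \<phi> x)" by simp
qed

lemma antiderivative_continuous:
  fixes \<psi> :: "real \<Rightarrow> real"
  assumes "continuous_on UNIV \<psi>"
  obtains F where "\<And>x. (F has_real_derivative \<psi> x) (at x)" "F 0 = 0"
proof -
  obtain F where F: "\<And>x::real. (F has_vector_derivative \<psi> x) (at x)"
    using einterval_antiderivative[of "-\<infinity>" "\<infinity>" \<psi>] assms
    by (auto simp: continuous_on_eq_continuous_at)
  show ?thesis
  proof
    show "((\<lambda>x. F x - F 0) has_real_derivative \<psi> x) (at x)" for x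
      using F[of x] by (auto simp: has_real_derivative_iff_has_vector_derivative[symmetric] intro!: derivative_eq_intros)
  qed simp
qed

text \<open>Every continuous function of mean zero with compact support in the open interval is the
  derivative of a test function, and any such \<open>\<psi>\<close> acquires mean zero by
  subtracting a multiple of one fixed bump \<open>\<eta>\<close>. Orthogonality of \<open>u\<close>
  to these differences is orthogonality of \<open>u - C\<close> to every
  \<open>\<psi>\<close>.\<close>

lemma du_Bois_Reymond:
  assumes u: "integrable (Leb l) u" and l: "0 < l"
    and weak: "\<And>\<phi> \<phi>'. test_function l \<phi> \<phi>' \<Longrightarrow> (LINT x|Leb l. u x * \<phi>' x) = 0"
  obtains c where "AE x in Leb l. u x = c"
proof -
  have mean0: "(LINT x|Leb l. u x * \<theta> x) = 0"
    if \<theta>: "continuous_on UNIV \<theta>" "0 < c" "d < l" "\<And>x. x \<notin> {c..d} \<Longrightarrow> \<theta> x = 0" "(LINT x|Leb l. \<theta> x) = 0"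
    for \<theta> c d
  proof -
    obtain \<phi> where \<phi>: "\<And>x. (\<phi> has_real_derivative \<theta> x) (at x)" "\<phi> 0 = 0"
      using antiderivative_continuous[OF \<theta>(1)] by blast
    have "prim_on l \<phi> \<theta>" by (rule prim_on_C1[OF \<phi>(1) \<theta>(1)])
    then have \<phi>l: "\<phi> l = 0"
      using prim_on_end[of l \<phi> \<theta>] l \<theta>(5) \<phi>(2) by simp
    \<comment> \<open>Beyond the support the antiderivative is constant on either side; its values
      at 0 and at \<open>l\<close> are both 0 because the mean vanishes.\<close>
    have const: "\<phi> x = \<phi> y" if "convex T" "x \<in> T" "y \<in> T" "\<And>z. z \<in> T \<Longrightarrow> z \<notin> {c..d}" for T x y
    proof -
      have "\<exists>k. \<forall>z\<in>T. \<phi> z = k"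
        using \<phi>(1) \<theta>(4) that by (intro has_field_derivative_zero_constant) (metis DERIV_subset subset_UNIV)+
      then show ?thesis using that by auto
    qed
    have "\<phi> x = 0" if "x \<notin> {c..d}" for x
    proof (cases "x < c")
      case True
      then show ?thesis using const[of "{..<c}" x 0] \<phi>(2) \<theta>(2) by auto
    next
      case False
      then show ?thesis using const[of "{d<..}" x l] \<phi>l \<theta>(3) that by auto
    qed
    then have "test_function l \<phi> \<theta>" unfolding test_function_def using \<phi> \<theta> by blast
    then show ?thesis by (rule weak)
  qed
  \<comment> \<open>The threshold \<open>l\<^sup>2 / 8\<close> is \<open>r * l\<close> for
    \<open>r = l / 8\<close> and lies below the maximum \<open>l\<^sup>2 / 4\<close> of the
    parabola, so the bump has positive mean.\<close>
  define \<eta> where "\<eta> = (\<lambda>x. max 0 (x * (l - x) - l\<^sup>2 / 8))"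
  have \<eta>c: "continuous_on S \<eta>" for S unfolding \<eta>_def by (intro continuous_intros)
  have \<eta>0: "\<eta> x = 0" if out: "x \<notin> {l/8..l - l/8}" for x
    using parabola_less[OF out] l by (simp add: \<eta>_def power2_eq_square)
  define m where "m = (LINT x|Leb l. \<eta> x)"
  have \<eta>i: "integrable (Leb l) \<eta>" by (rule continuous_imp_integrable_real[OF \<eta>c])
  have "m \<noteq> 0"
  proof
    assume "m = 0"
    then have "AE x in Leb l. \<eta> x = 0"
      unfolding m_def using \<eta>i by (subst (asm) integral_nonneg_eq_0_iff_AE) (auto simp: \<eta>_def)
    then have "\<eta> (l/2) = 0" by (rule continuous_AE_eq[OF \<eta>c continuous_on_const _ l]) (use l in auto)
    then show False using l by (simp add: \<eta>_def power2_eq_square field_simps max_def split: if_splits)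
  qed
  define C where "C = (LINT x|Leb l. u x * \<eta> x) / m"
  have ui: "integrable (Leb l) (\<lambda>x. u x - C)"
    using u finite_measure.integrable_const[OF finite_measure_Leb] by auto
  have "AE x in Leb l. u x - C = 0"
  proof (rule AE_zero_if_orthogonal[OF ui l])
    fix \<psi> :: "real \<Rightarrow> real" and c d
    assume \<psi>: "continuous_on UNIV \<psi>" "0 < c" "d < l" "\<And>x. x \<notin> {c..d} \<Longrightarrow> \<psi> x = 0"
    define I where "I = (LINT x|Leb l. \<psi> x)"
    have \<psi>c: "continuous_on {0..l} \<psi>" by (rule continuous_on_subset[OF \<psi>(1)]) auto
    have \<psi>i: "integrable (Leb l) \<psi>" by (rule continuous_imp_integrable_real[OF \<psi>c])
    have i: "integrable (Leb l) (\<lambda>x. u x * \<psi> x)" "integrable (Leb l) (\<lambda>x. u x * \<eta> x)"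
      using integrable_mult_continuous[OF u] \<psi>c \<eta>c by auto
    have "(LINT x|Leb l. u x * (\<psi> x - I / m * \<eta> x)) = 0"
    proof (rule mean0[of _ "min c (l/8)" "max d (l - l/8)"])
      show "continuous_on UNIV (\<lambda>x. \<psi> x - I / m * \<eta> x)" by (intro continuous_intros \<psi> \<eta>c)
      show "(LINT x|Leb l. \<psi> x - I / m * \<eta> x) = 0"
        using \<psi>i \<eta>i \<open>m \<noteq> 0\<close> by (simp add: I_def m_def)
      fix x assume "x \<notin> {min c (l/8)..max d (l - l/8)}"
      then have "x \<notin> {c..d}" "x \<notin> {l/8..l - l/8}" by auto
      then show "\<psi> x - I / m * \<eta> x = 0" using \<psi>(4) \<eta>0 by simp
    qed (use \<psi> l in auto)
    then have "(LINT x|Leb l. u x * \<psi> x) = C * I"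
      using i by (simp add: algebra_simps C_def)
    then show "(LINT x|Leb l. (u x - C) * \<psi> x) = 0"
      using i \<psi>i by (simp add: algebra_simps I_def)
  qed
  then show ?thesis using that[of C] by simp
qed

text \<open>Subtracting the primitive of \<open>w\<close> from \<open>u\<close> leaves weak
  derivative zero, hence a constant almost everywhere.\<close>

lemma weak_deriv_prim_on:
  assumes u: "sq_integrable l u" and w: "sq_integrable l w" and weak: "has_weak_deriv l u w" and l: "0 < l"
  obtains U where "prim_on l U w" "AE x in Leb l. U x = u x"
proof -
  note wi = sq_integrable_integrable[OF w] and ui = sq_integrable_integrable[OF u]
  define V where "V = (\<lambda>x. LINT t|Leb l. indicator {..x} t * w t)"
  have V: "prim_on l V w" by (rule prim_onI[OF wi, of _ 0]) (simp add: V_def)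
  have Vi: "integrable (Leb l) V" by (rule continuous_imp_integrable_real[OF prim_on_continuous[OF V]])
  have Vw: "has_weak_deriv l V w"
    by (rule prim_on_has_weak_deriv[OF V _ _ l]) (use Vi in auto)
  have ui': "integrable (Leb l) (\<lambda>x. u x - V x)" using ui Vi by simp
  obtain c where c: "AE x in Leb l. u x - V x = c"
  proof (rule du_Bois_Reymond[OF ui' l])
    fix \<phi> \<phi>' assume t: "test_function l \<phi> \<phi>'"
    then have c: "continuous_on {0..l} \<phi>'" by (auto simp: test_function_def intro: continuous_on_subset)
    show "(LINT x|Leb l. (u x - V x) * \<phi>' x) = 0"
      using weak Vw t integrable_mult_continuous[OF ui c] integrable_mult_continuous[OF Vi c]
      by (simp add: has_weak_deriv_def left_diff_distrib)
  qed blast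
  show ?thesis
  proof
    show "prim_on l (\<lambda>x. V x + c) w"
      by (rule prim_onI[OF wi, of _ c]) (simp add: V_def)
    show "AE x in Leb l. V x + c = u x" using c by eventually_elim simp
  qed
qed

text \<open>\<open>cont_rep\<close> is an arbitrary choice; it is pinned down because continuous
  functions that agree almost everywhere on an interval of positive length agree everywhere.\<close>

lemma cont_rep_eq:
  assumes U: "continuous_on {0..l} U" "AE x in Leb l. U x = u x" and l: "0 < l"
  shows "\<And>x. x \<in> {0..l} \<Longrightarrow> cont_rep l u x = U x" "AE x in Leb l. cont_rep l u x = u x"
proof -
  have c: "continuous_on {0..l} (cont_rep l u) \<and> (AE x in Leb l. cont_rep l u x = u x)"
    using someI_ex[of "\<lambda>g. continuous_on {0..l} g \<and> (AE x in Leb l. g x = u x)"] U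
    unfolding cont_rep_def by blast
  then show "AE x in Leb l. cont_rep l u x = u x" by simp
  have "AE x in Leb l. cont_rep l u x = U x"
    using c U(2) by (auto elim: eventually_elim2)
  then show "x \<in> {0..l} \<Longrightarrow> cont_rep l u x = U x" for x
    using continuous_AE_eq[OF _ U(1) _ l] c by blast
qed

lemma cont_rep_prim_on:
  assumes "sq_integrable l u" "sq_integrable l w" "has_weak_deriv l u w" "0 < l"
  shows "prim_on l (cont_rep l u) w" "AE x in Leb l. cont_rep l u x = u x"
proof -
  obtain U where U: "prim_on l U w" "AE x in Leb l. U x = u x"
    using weak_deriv_prim_on[OF assms] by blast
  note c = cont_rep_eq[OF prim_on_continuous[OF U(1)] U(2) \<open>0 < l\<close>]
  show "prim_on l (cont_rep l u) w" by (rule prim_on_cong[OF U(1) c(1)])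
  show "AE x in Leb l. cont_rep l u x = u x" by (rule c(2))
qed

lemma H1_weak_deriv:
  assumes "H1 l u"
  shows "sq_integrable l (weak_deriv l u)" "has_weak_deriv l u (weak_deriv l u)"
proof -
  have "sq_integrable l (weak_deriv l u) \<and> has_weak_deriv l u (weak_deriv l u)"
    using someI_ex[of "\<lambda>w. sq_integrable l w \<and> has_weak_deriv l u w"] assms
    unfolding weak_deriv_def H1_def by blast
  then show "sq_integrable l (weak_deriv l u)" "has_weak_deriv l u (weak_deriv l u)" by auto
qed

lemma H1_cont_rep:
  assumes "H1 l u" "0 < l"
  shows "prim_on l (cont_rep l u) (weak_deriv l u)" "AE x in Leb l. cont_rep l u x = u x"
  using cont_rep_prim_on[OF _ H1_weak_deriv[OF assms(1)] assms(2)] assms(1)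
  by (auto simp: H1_def)

section \<open>Lipschitz coefficients and traces\<close>

lemma prim_on_linear:
  assumes f: "prim_on l f f'" and g: "prim_on l g g'"
  shows "prim_on l (\<lambda>x. a * f x + b * g x) (\<lambda>x. a * f' x + b * g' x)"
proof (rule prim_onI[of _ _ _ "a * f 0 + b * g 0"])
  note i = prim_on_integrable[OF f] prim_on_integrable[OF g]
  show "integrable (Leb l) (\<lambda>x. a * f' x + b * g' x)" using i by simp
  fix x assume x: "x \<in> {0..l}"
  have "(LINT t|Leb l. indicator {..x} t * (a * f' t + b * g' t))
    = (LINT t|Leb l. a * (indicator {..x} t * f' t) + b * (indicator {..x} t * g' t))"
    by (intro lint_cong) (simp add: algebra_simps)
  also have "\<dots> = a * integral_to l f' x + b * integral_to l g' x"
    using integrable_indicator_mult[OF i(1), of "{..x}"] integrable_indicator_mult[OF i(2), of "{..x}"] by simp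
  finally show "a * f x + b * g x = a * f 0 + b * g 0 + (LINT t|Leb l. indicator {..x} t * (a * f' t + b * g' t))"
    using prim_on_indicator[OF f x] prim_on_indicator[OF g x] by (simp add: algebra_simps)
qed

text \<open>The density is the Radon-Nikodym derivative of the image of Lebesgue measure under the
  (1-Lipschitz) inverse of \<open>H\<close>; null sets are preserved because \<open>H\<close> is Lipschitz.\<close>

lemma bilipschitz_primitive:
  fixes H :: "real \<Rightarrow> real"
  assumes lower: "\<And>x y. x \<le> y \<Longrightarrow> y - x \<le> H y - H x"
    and upper: "\<And>x y. x \<le> y \<Longrightarrow> H y - H x \<le> C * (y - x)"
    and l: "0 < l"
  obtains h where "prim_on l H h" "\<And>x. 0 \<le> h x"
proof -
  have smono: "H x < H y" if "x < y" for x y using lower[of x y] that by linarith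
  have inj: "inj H" by (rule injI) (metis smono less_irrefl linorder_neqE)
  have le_iff: "H x \<le> H y \<longleftrightarrow> x \<le> y" for x y by (metis smono not_le order_le_less)
  have lip: "\<bar>H x - H y\<bar> \<le> C * \<bar>x - y\<bar>" for x y
    using upper[of x y] upper[of y x] lower[of x y] lower[of y x] by (cases "x \<le> y") auto
  have cont: "isCont H x" for x
  proof -
    have "((\<lambda>y. C * \<bar>y - x\<bar>) \<longlongrightarrow> C * \<bar>x - x\<bar>) (at x)" by (intro tendsto_intros)
    then have "((\<lambda>y. C * \<bar>y - x\<bar>) \<longlongrightarrow> 0) (at x)" by simp
    then have "((\<lambda>y. H y - H x) \<longlongrightarrow> 0) (at x)"
      by (rule Lim_null_comparison[rotated]) (use lip in auto)
    then show ?thesis using LIM_zero_cancel isCont_def by blast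
  qed
  have surj: "surj H"
    unfolding surj_def
  proof
    fix y
    have 1: "H (- \<bar>y - H 0\<bar>) \<le> y" using lower[of "- \<bar>y - H 0\<bar>" 0] by (auto simp: abs_if split: if_splits)
    have 2: "y \<le> H \<bar>y - H 0\<bar>" using lower[of 0 "\<bar>y - H 0\<bar>"] by (auto simp: abs_if split: if_splits)
    show "\<exists>x. y = H x"
      using IVT[of H "- \<bar>y - H 0\<bar>" y "\<bar>y - H 0\<bar>"] 1 2 cont by fastforce
  qed
  define G where "G = inv_into UNIV H"
  have GH: "G (H x) = x" and HG: "H (G y) = y" for x y
    by (auto simp: G_def inv_f_f[OF inj] surj_f_inv_f[OF surj])
  have "mono G" by (rule monoI) (metis HG le_iff)
  then have Gm[measurable]: "G \<in> borel_measurable borel" by (rule borel_measurable_mono)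
  define \<mu> where "\<mu> = distr lborel borel G"
  have Gv: "G -` A = H ` A" for A :: "real set" using GH HG by (auto simp: image_iff) metis
  have "absolutely_continuous lborel \<mu>"
    unfolding absolutely_continuous_def
  proof
    fix A :: "real set" assume A: "A \<in> null_sets lborel"
    then have Ab: "A \<in> sets borel" by auto
    have "negligible A" using A by (simp add: negligible_iff_null_sets null_sets_completionI)
    then have "negligible (H ` A)"
    proof (rule negligible_locally_Lipschitz_image[rotated])
      fix x
      show "\<exists>T B. open T \<and> x \<in> T \<and> (\<forall>y\<in>A \<inter> T. norm (H y - H x) \<le> B * norm (y - x))"
        using lip by (intro exI[of _ UNIV] exI[of _ C]) auto
    qed simp
    then have "G -` A \<in> null_sets lebesgue" unfolding Gv by (simp add: negligible_iff_null_sets)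
    moreover have "G -` A \<in> sets lborel" using measurable_sets[OF Gm Ab] by simp
    ultimately have "G -` A \<in> null_sets lborel" by (simp add: null_sets_completion_iff)
    then have "emeasure lborel (G -` A) = 0" by auto
    then show "A \<in> null_sets \<mu>" using Ab by (auto simp: \<mu>_def null_sets_def emeasure_distr)
  qed
  then obtain f where f[measurable]: "f \<in> borel_measurable lborel" and d: "density lborel f = \<mu>"
    using sigma_finite_measure.Radon_Nikodym[of lborel \<mu>] sigma_finite_lborel by (auto simp: \<mu>_def)
  have val: "(\<integral>\<^sup>+t. f t * indicator {0<..x} t \<partial>lborel) = ennreal (H x - H 0)" if "0 \<le> x" for x
  proof -
    have "(\<integral>\<^sup>+t. f t * indicator {0<..x} t \<partial>lborel) = emeasure (density lborel f) {0<..x}"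
      by (rule emeasure_density[symmetric]) auto
    also have "\<dots> = emeasure lborel (G -` {0<..x})" by (simp add: d \<mu>_def emeasure_distr)
    also have "G -` {0<..x} = {H 0<..H x}"
      using le_iff HG by (auto simp: not_le[symmetric]) (metis HG le_iff)+
    also have "emeasure lborel {H 0<..H x} = ennreal (H x - H 0)"
      using that by (simp add: le_iff)
    finally show ?thesis .
  qed
  \<comment> \<open>The integral over \<open>{0<..l}\<close> is finite, so the density is infinite
    there only on a null set and \<open>enn2real\<close> alters no integral.\<close>
  define h where "h = (\<lambda>t. enn2real (f t * indicator {0<..l} t))"
  have hm[measurable]: "h \<in> borel_measurable lborel" unfolding h_def by measurable
  have fin: "AE t in lborel. f t * indicator {0<..l} t \<noteq> \<infinity>"
    by (rule nn_integral_PInf_AE) (use val[of l] l in auto)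
  have hb: "has_bochner_integral lborel (\<lambda>t. indicator {..x} t * h t) (H x - H 0)" if x: "x \<in> {0..l}" for x
  proof (rule has_bochner_integral_nn_integral)
    have "(\<integral>\<^sup>+t. ennreal (indicator {..x} t * h t) \<partial>lborel) = (\<integral>\<^sup>+t. f t * indicator {0<..x} t \<partial>lborel)"
    proof (rule nn_integral_cong_AE)
      show "AE t in lborel. ennreal (indicator {..x} t * h t) = f t * indicator {0<..x} t"
        using fin
      proof eventually_elim
        case (elim t)
        then show ?case using x by (auto simp: h_def indicator_def less_top)
      qed
    qed
    then show "(\<integral>\<^sup>+t. ennreal (indicator {..x} t * h t) \<partial>lborel) = ennreal (H x - H 0)" using val x by simp
  qed (use x le_iff[of 0 x] in \<open>auto simp: h_def\<close>)
  have ind: "(\<lambda>t. indicator {0..l} t *\<^sub>R (indicator {..x} t * h t)) = (\<lambda>t. indicator {..x} t * h t)" for x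
    by (auto simp: h_def indicator_def fun_eq_iff)
  have "prim_on l H h"
  proof (rule prim_onI[of _ _ _ "H 0"])
    have "integrable lborel (\<lambda>t. indicator {..l} t * h t)" using hb[of l] l by (auto simp: has_bochner_integral_iff)
    then have "integrable lebesgue (\<lambda>t. indicator {..l} t * h t)" by (subst integrable_completion) auto
    moreover have "(\<lambda>t. indicator {..l} t * h t) = (\<lambda>t. indicator {0..l} t *\<^sub>R h t)"
      by (auto simp: h_def indicator_def fun_eq_iff)
    ultimately show "integrable (Leb l) h" by (subst integrable_restrict_space) auto
    fix x assume x: "x \<in> {0..l}"
    have "integral_to l h x = (LINT t|lebesgue. indicator {..x} t * h t)"
      by (subst integral_restrict_space) (auto simp: ind[unfolded real_scaleR_def])
    also have "\<dots> = (LINT t|lborel. indicator {..x} t * h t)" by (rule integral_completion) measurable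
    also have "\<dots> = H x - H 0" using hb[OF x] by (simp add: has_bochner_integral_iff)
    finally show "H x = H 0 + integral_to l h x" by simp
  qed
  then show ?thesis using that[of h] by (simp add: h_def)
qed

text \<open>\<open>C * x + g x\<close> and \<open>C * x - g x\<close> both increase with slope at
  least 1, so each has a nonnegative density. The two densities add up to \<open>2 * C\<close>
  almost everywhere, hence lie between 0 and \<open>2 * C\<close>, and subtracting \<open>C\<close>
  from the first leaves a density of \<open>f\<close> bounded by \<open>C\<close>.\<close>

lemma lipschitz_primitive:
  fixes f :: "real \<Rightarrow> real"
  assumes lip: "\<And>x y. x \<in> {0..l} \<Longrightarrow> y \<in> {0..l} \<Longrightarrow> \<bar>f x - f y\<bar> \<le> K * \<bar>x - y\<bar>" and l: "0 < l"
  obtains f' C where "prim_on l f f'" "AE x in Leb l. \<bar>f' x\<bar> \<le> C"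
proof -
  \<comment> \<open>Constant extension beyond the ends, since \<open>bilipschitz_primitive\<close>
    needs a function on the whole line.\<close>
  define g where "g = (\<lambda>x. f (max 0 (min l x)))"
  define C where "C = \<bar>K\<bar> + 1"
  have g: "\<bar>g x - g y\<bar> \<le> \<bar>K\<bar> * \<bar>x - y\<bar>" for x y
  proof -
    have "\<bar>g x - g y\<bar> \<le> K * \<bar>max 0 (min l x) - max 0 (min l y)\<bar>"
      unfolding g_def using l by (intro lip) auto
    also have "\<dots> \<le> \<bar>K\<bar> * \<bar>x - y\<bar>" by (intro mult_mono) auto
    finally show ?thesis .
  qed
  have C: "\<bar>g x - g y\<bar> \<le> C * \<bar>x - y\<bar> - \<bar>x - y\<bar>" for x y
    using g[of x y] by (simp add: C_def algebra_simps)
  have ex: "\<exists>h. prim_on l (\<lambda>x. C * x + \<sigma> * g x) h \<and> (\<forall>x. 0 \<le> h x)" if \<sigma>: "\<bar>\<sigma>\<bar> = 1" for \<sigma>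
  proof (rule bilipschitz_primitive[of "\<lambda>x. C * x + \<sigma> * g x" "2 * C" l])
    fix x y :: real assume "x \<le> y"
    then have "\<bar>\<sigma> * (g y - g x)\<bar> \<le> C * (y - x) - (y - x)" using C[of y x] \<sigma> by (simp add: abs_mult)
    then show "y - x \<le> C * y + \<sigma> * g y - (C * x + \<sigma> * g x)" "C * y + \<sigma> * g y - (C * x + \<sigma> * g x) \<le> 2 * C * (y - x)"
      using \<open>x \<le> y\<close> by (auto simp: abs_le_iff algebra_simps)
  qed (use l in blast)+
  obtain h1 where h1: "prim_on l (\<lambda>x. C * x + 1 * g x) h1" "\<And>x. 0 \<le> h1 x" using ex[of 1] by auto
  obtain h2 where h2: "prim_on l (\<lambda>x. C * x + (-1) * g x) h2" "\<And>x. 0 \<le> h2 x" using ex[of "-1"] by auto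
  have id: "prim_on l (\<lambda>x. x) (\<lambda>_. 1)"
    by (rule prim_on_C1) (auto intro!: derivative_eq_intros)
  have "prim_on l (\<lambda>x. 1 * (1 * (C * x + 1 * g x) + 1 * (C * x + (-1) * g x)) + (- 2 * C) * x)
    (\<lambda>x. 1 * (1 * h1 x + 1 * h2 x) + (- 2 * C) * 1)"
    by (intro prim_on_linear h1 h2 id)
  then have "AE x in Leb l. 1 * (1 * h1 x + 1 * h2 x) + (- 2 * C) * 1 = 0"
    by (rule prim_on_zero_AE) (use l in auto)
  then have "AE x in Leb l. \<bar>1 * h1 x + (- C) * 1\<bar> \<le> C"
  proof eventually_elim
    case (elim x)
    then show ?case using h1(2)[of x] h2(2)[of x] by (simp add: abs_le_iff)
  qed
  moreover have "prim_on l (\<lambda>x. 1 * (C * x + 1 * g x) + (- C) * x) (\<lambda>x. 1 * h1 x + (- C) * 1)"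
    by (intro prim_on_linear h1 id)
  then have "prim_on l f (\<lambda>x. 1 * h1 x + (- C) * 1)"
    by (rule prim_on_cong) (use l in \<open>auto simp: g_def\<close>)
  ultimately show ?thesis using that by blast
qed

section \<open>Cauchy-Schwarz and the trace inequality\<close>

lemma integral_Cauchy_Schwarz:
  fixes f g :: "'a \<Rightarrow> real"
  assumes "integrable M (\<lambda>x. (f x)\<^sup>2)" "integrable M (\<lambda>x. (g x)\<^sup>2)" "integrable M (\<lambda>x. f x * g x)"
  shows "(LINT x|M. f x * g x)\<^sup>2 \<le> (LINT x|M. (f x)\<^sup>2) * (LINT x|M. (g x)\<^sup>2)"
proof -
  define A B C where "A = (LINT x|M. (f x)\<^sup>2)" and "B = (LINT x|M. f x * g x)" and "C = (LINT x|M. (g x)\<^sup>2)"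
  have q: "0 \<le> A - 2 * t * B + t\<^sup>2 * C" for t
  proof -
    have "0 \<le> (LINT x|M. (f x - t * g x)\<^sup>2)" by simp
    also have "\<dots> = (LINT x|M. (f x)\<^sup>2 - 2 * t * (f x * g x) + t\<^sup>2 * (g x)\<^sup>2)"
      by (intro lint_cong) (simp add: power2_eq_square algebra_simps)
    also have "\<dots> = A - 2 * t * B + t\<^sup>2 * C" using assms by (simp add: A_def B_def C_def)
    finally show ?thesis .
  qed
  have C0: "0 \<le> C" by (simp add: C_def)
  have "B\<^sup>2 \<le> A * C"
  proof (cases "C = 0")
    case True
    have "B = 0"
    proof (rule ccontr)
      assume "B \<noteq> 0"
      \<comment> \<open>For \<open>C = 0\<close> the quadratic is affine in \<open>t\<close>, and at
        this point it takes the value -1.\<close>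
      then show False using q[of "(A + 1) / (2 * B)"] True by simp
    qed
    then show ?thesis using True by simp
  next
    case False
    then have "0 < C" using C0 by simp
    then show ?thesis using q[of "B / C"] by (simp add: field_simps power2_eq_square)
  qed
  then show ?thesis by (simp add: A_def B_def C_def)
qed

lemma prim_on_increment_le:
  assumes U: "prim_on l U w" and w: "sq_integrable l w" and xy: "x \<in> {0..l}" "y \<in> {0..l}" "y \<le> x"
  shows "(U x - U y)\<^sup>2 \<le> (x - y) * (LINT t|Leb l. (w t)\<^sup>2)"
proof -
  note wi = prim_on_integrable[OF U]
  have "U x - U y = integral_to l w x - integral_to l w y"
    using prim_on_indicator[OF U xy(1)] prim_on_indicator[OF U xy(2)] by simp
  also have "\<dots> = (LINT t|Leb l. indicator {..x} t * w t - indicator {..y} t * w t)"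
    by (rule Bochner_Integration.integral_diff[symmetric]) (auto intro!: integrable_indicator_mult wi)
  also have "\<dots> = (LINT t|Leb l. indicator {y<..x} t * w t)"
    by (intro lint_cong) (use xy in \<open>auto simp: indicator_def\<close>)
  finally have eq: "U x - U y = (LINT t|Leb l. indicator {y<..x} t * w t)" .
  have i2: "(\<lambda>t. (indicator {y<..x} t)\<^sup>2 :: real) = indicator {y<..x}" by (auto simp: indicator_def)
  have "integrable (Leb l) (\<lambda>t. indicator {y<..x} t * (1::real))"
    using finite_measure.integrable_const[OF finite_measure_Leb] by (intro integrable_indicator_mult) auto
  then have ii: "integrable (Leb l) (indicator {y<..x} :: real \<Rightarrow> real)" by simp
  have "(LINT t|Leb l. indicator {y<..x} t * (1::real)) = (LINT t|lebesgue. indicator {0..l} t *\<^sub>R (indicator {y<..x} t * 1))"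
    by (rule integral_restrict_space) auto
  also have "\<dots> = (LINT t|lebesgue. indicator {y<..x} t)"
    by (intro lint_cong) (use xy in \<open>auto simp: indicator_def\<close>)
  also have "\<dots> = x - y" using xy by simp
  finally have m: "(LINT t|Leb l. (indicator {y<..x} t)\<^sup>2) = x - y" unfolding i2 by simp
  show ?thesis unfolding eq m[symmetric]
    by (rule integral_Cauchy_Schwarz) (use w ii i2 integrable_indicator_mult[OF wi, of "{y<..x}"] in \<open>auto simp: sq_integrable_def\<close>)
qed

text \<open>Average \<open>(U x)\<^sup>2 \<le> 2 * (U y)\<^sup>2 + 2 * J * \<bar>x - y\<bar>\<close>
  over an interval of length \<open>h\<close> that has \<open>x\<close> as an endpoint; the mean of
  \<open>\<bar>x - y\<bar>\<close> is \<open>h / 2\<close>. The hypothesis on \<open>h\<close> says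
  that such an interval fits on at least one side of \<open>x\<close>.\<close>

lemma trace_ineq:
  assumes U: "prim_on l U w" and w: "sq_integrable l w"
    and x: "x \<in> {0..l}" and h: "0 < h" "h \<le> x \<or> x + h \<le> l"
  shows "(U x)\<^sup>2 \<le> 2 / h * (LINT t|Leb l. (U t)\<^sup>2) + h * (LINT t|Leb l. (w t)\<^sup>2)"
proof -
  define J where "J = (LINT t|Leb l. (w t)\<^sup>2)"
  have J: "0 \<le> J" by (simp add: J_def)
  define c where "c = (if h \<le> x then x - h else x)"
  have c: "{c..c+h} \<subseteq> {0..l}" using x h by (auto simp: c_def)
  have pt: "(U x)\<^sup>2 \<le> 2 * (U y)\<^sup>2 + 2 * J * \<bar>x - y\<bar>" if "y \<in> {0..l}" for y
  proof -
    have "(U x - U y)\<^sup>2 \<le> \<bar>x - y\<bar> * J"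
      using prim_on_increment_le[OF U w x that] prim_on_increment_le[OF U w that x]
      by (cases "y \<le> x") (auto simp: J_def power2_commute)
    \<comment> \<open>This square equals
      \<open>2 * (U y)\<^sup>2 + 2 * (U x - U y)\<^sup>2 - (U x)\<^sup>2\<close>.\<close>
    moreover have "0 \<le> (U x - 2 * U y)\<^sup>2" by simp
    ultimately show ?thesis by (simp add: power2_eq_square algebra_simps)
  qed
  have tr: "(LINT t|Leb l. indicator {c..c+h} t * g t) = integral {c..c+h} g" if "continuous_on {c..c+h} g" for g :: "real \<Rightarrow> real"
  proof -
    have "(LINT t|Leb l. indicator {c..c+h} t * g t) = (LINT t|lebesgue. indicator {0..l} t *\<^sub>R (indicator {c..c+h} t * g t))"
      by (rule integral_restrict_space) auto
    also have "\<dots> = (LINT t|lebesgue. indicator {c..c+h} t *\<^sub>R g t)"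
      by (intro lint_cong) (use c in \<open>auto simp: indicator_def\<close>)
    also have "\<dots> = (LINT t|lebesgue_on {c..c+h}. g t)" by (rule integral_restrict_space[symmetric]) auto
    also have "\<dots> = integral {c..c+h} g"
      by (rule lebesgue_integral_eq_integral) (auto intro: continuous_imp_integrable_real that)
    finally show ?thesis .
  qed
  have "(LINT t|Leb l. indicator {c..c+h} t * (1::real)) = h" using h by (subst tr) auto
  then have one: "(LINT t|Leb l. indicator {c..c+h} t) = h" by simp
  have dist: "(LINT t|Leb l. indicator {c..c+h} t * \<bar>x - t\<bar>) = h\<^sup>2 / 2"
  proof -
    have "(LINT t|Leb l. indicator {c..c+h} t * \<bar>x - t\<bar>) = integral {c..c+h} (\<lambda>t. \<bar>x - t\<bar>)"
      by (rule tr) (intro continuous_intros)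
    also have "\<dots> = h\<^sup>2 / 2"
    proof -
      \<comment> \<open>The sign records whether \<open>x\<close> is the right or the left end of
        the interval, where \<open>\<bar>x - t\<bar>\<close> is linear.\<close>
      define \<sigma> :: real where "\<sigma> = (if h \<le> x then -1 else 1)"
      have "((\<lambda>t. \<bar>x - t\<bar>) has_integral \<sigma> * (x - (c + h))\<^sup>2 / 2 - \<sigma> * (x - c)\<^sup>2 / 2) {c..c+h}"
      proof (rule fundamental_theorem_of_calculus)
        fix t assume "t \<in> {c..c+h}"
        then have "\<bar>x - t\<bar> = \<sigma> * (t - x)" by (auto simp: c_def \<sigma>_def split: if_splits)
        then show "((\<lambda>t. \<sigma> * (x - t)\<^sup>2 / 2) has_vector_derivative \<bar>x - t\<bar>) (at t within {c..c+h})"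
          by (auto simp: has_real_derivative_iff_has_vector_derivative[symmetric] field_simps intro!: derivative_eq_intros)
      qed (use h in simp)
      then show ?thesis by (simp add: c_def \<sigma>_def integral_unique split: if_splits)
    qed
    finally show ?thesis .
  qed
  have U2: "integrable (Leb l) (\<lambda>t. (U t)\<^sup>2)"
    using sq_integrable_continuous[OF prim_on_continuous[OF U]] by (simp add: sq_integrable_def)
  have d: "integrable (Leb l) (\<lambda>t. \<bar>x - t\<bar>)" by (intro continuous_imp_integrable_real continuous_intros)
  have "integrable (Leb l) (\<lambda>t. indicator {c..c+h} t * (1::real))"
    using finite_measure.integrable_const[OF finite_measure_Leb] by (intro integrable_indicator_mult) auto
  then have ii: "integrable (Leb l) (indicator {c..c+h} :: real \<Rightarrow> real)" by simp
  have di: "integrable (Leb l) (\<lambda>t. indicator {c..c+h} t * \<bar>x - t\<bar>)" by (rule integrable_indicator_mult[OF d]) simp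
  have "h * (U x)\<^sup>2 = (LINT t|Leb l. (U x)\<^sup>2 * indicator {c..c+h} t)" using one ii by simp
  also have "\<dots> \<le> (LINT t|Leb l. 2 * (U t)\<^sup>2 + 2 * J * (indicator {c..c+h} t * \<bar>x - t\<bar>))"
  proof (rule integral_mono)
    fix t assume "t \<in> space (Leb l)"
    then show "(U x)\<^sup>2 * indicator {c..c+h} t \<le> 2 * (U t)\<^sup>2 + 2 * J * (indicator {c..c+h} t * \<bar>x - t\<bar>)"
      using pt[of t] by (auto simp: indicator_def)
  qed (use ii U2 di in auto)
  also have "\<dots> = 2 * (LINT t|Leb l. (U t)\<^sup>2) + J * h\<^sup>2"
    using U2 di dist by simp
  finally have "h * (U x)\<^sup>2 \<le> h * (2 / h * (LINT t|Leb l. (U t)\<^sup>2) + h * J)"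
    using h by (simp add: algebra_simps power2_eq_square)
  then show ?thesis using h unfolding J_def by (metis mult_le_cancel_left_pos)
qed

text \<open>The domain of the operator controls only the derivative of \<open>u'\<close>.
  Multiplying by a Lipschitz coefficient stays within \<open>H1\<close> because the density of the
  coefficient is bounded; the chosen weak derivative in \<open>op_L\<close> is thereby the density
  of a continuous flux, which is the function that enters the boundary terms.\<close>

lemma flux_prim_on:
  assumes u: "H2 l u" and l: "0 < l"
    and lip: "\<And>x y. x \<in> {0..l} \<Longrightarrow> y \<in> {0..l} \<Longrightarrow> \<bar>\<alpha> x - \<alpha> y\<bar> \<le> K * \<bar>x - y\<bar>"
  shows "prim_on l (\<lambda>x. \<alpha> x * cont_rep l (weak_deriv l u) x) (weak_deriv l (\<lambda>y. \<alpha> y * weak_deriv l u y))"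
    and "sq_integrable l (weak_deriv l (\<lambda>y. \<alpha> y * weak_deriv l u y))"
proof -
  define w where "w = weak_deriv l u"
  have w1: "H1 l w" using u by (simp add: H2_def w_def)
  then have wsq: "sq_integrable l w" by (simp add: H1_def)
  note cw = H1_cont_rep[OF w1 l] and w2 = H1_weak_deriv[OF w1]
  obtain \<alpha>' C where \<alpha>: "prim_on l \<alpha> \<alpha>'" "AE x in Leb l. \<bar>\<alpha>' x\<bar> \<le> C"
    using lipschitz_primitive[of l \<alpha> K, OF lip l] by blast
  have \<alpha>c: "continuous_on {0..l} \<alpha>" by (rule prim_on_continuous[OF \<alpha>(1)])
  obtain D where D: "\<And>x. x \<in> {0..l} \<Longrightarrow> \<bar>\<alpha> x\<bar> \<le> D" using continuous_on_bounded_Icc[OF \<alpha>c] by blast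
  have AED: "AE x in Leb l. \<bar>\<alpha> x\<bar> \<le> D" by (rule AE_I2) (simp add: D)
  have p: "prim_on l (\<lambda>x. \<alpha> x * cont_rep l w x) (\<lambda>x. \<alpha>' x * cont_rep l w x + \<alpha> x * weak_deriv l w x)"
    by (rule prim_on_mult[OF \<alpha>(1) cw(1)])
  have "sq_integrable l (\<lambda>x. \<alpha>' x * cont_rep l w x + \<alpha> x * weak_deriv l w x)"
    by (intro sq_integrable_add sq_integrable_bounded_mult[OF _ _ \<alpha>(2)] sq_integrable_bounded_mult[OF _ _ AED]
        sq_integrable_continuous[OF prim_on_continuous[OF cw(1)]] w2
        borel_measurable_integrable[OF prim_on_integrable[OF \<alpha>(1)]] continuous_measurable_Leb \<alpha>c)
  moreover have "sq_integrable l (\<lambda>x. \<alpha> x * w x)"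
    by (intro sq_integrable_bounded_mult[OF _ _ AED] wsq continuous_measurable_Leb \<alpha>c)
  moreover have AEw: "AE x in Leb l. \<alpha> x * w x = \<alpha> x * cont_rep l w x" using cw(2) by eventually_elim simp
  then have "has_weak_deriv l (\<lambda>x. \<alpha> x * w x) (\<lambda>x. \<alpha>' x * cont_rep l w x + \<alpha> x * weak_deriv l w x)"
    by (rule prim_on_has_weak_deriv[OF p _ _ l])
      (use calculation(2) in \<open>simp add: sq_integrable_def\<close>)
  ultimately have H: "H1 l (\<lambda>x. \<alpha> x * w x)" unfolding H1_def by blast
  show "sq_integrable l (weak_deriv l (\<lambda>y. \<alpha> y * weak_deriv l u y))"
    using H1_weak_deriv(1)[OF H] by (simp add: w_def)
  have "AE x in Leb l. \<alpha> x * cont_rep l w x = \<alpha> x * w x" using cw(2) by eventually_elim simp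
  then have "cont_rep l (\<lambda>x. \<alpha> x * w x) x = \<alpha> x * cont_rep l w x" if "x \<in> {0..l}" for x
    by (rule cont_rep_eq(1)[OF prim_on_continuous[OF p] _ l that])
  then have "prim_on l (\<lambda>x. \<alpha> x * cont_rep l w x) (weak_deriv l (\<lambda>x. \<alpha> x * w x))"
    by (intro prim_on_cong[OF H1_cont_rep(1)[OF H l]]) simp
  then show "prim_on l (\<lambda>x. \<alpha> x * cont_rep l (weak_deriv l u) x) (weak_deriv l (\<lambda>y. \<alpha> y * weak_deriv l u y))"
    by (simp add: w_def)
qed

section \<open>Vertex conditions\<close>

abbreviation sprod :: "real vec \<Rightarrow> real vec \<Rightarrow> real" where
  "sprod x y \<equiv> scalar_prod x y"

lemma sprod_self_nonneg: "0 \<le> sprod x x"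
  by (auto simp: scalar_prod_def intro!: sum_nonneg)

lemma sprod_self_zero:
  assumes "x \<in> carrier_vec n" "sprod x x = 0" shows "x = 0\<^sub>v n"
proof (rule eq_vecI)
  fix i assume i: "i < dim_vec (0\<^sub>v n :: real vec)"
  have "\<forall>j\<in>{0..<dim_vec x}. x $ j * x $ j = 0"
    using assms(2) unfolding scalar_prod_def by (subst (asm) sum_nonneg_eq_0_iff) auto
  then show "x $ i = 0\<^sub>v n $ i" using i assms(1) by auto
qed (use assms in auto)

text \<open>Rank \<open>n\<close> provides \<open>n\<close> linearly independent columns; they form
  an invertible \<open>N\<close>, and \<open>y\<close>, orthogonal to all of them, solves
  \<open>N\<^sup>T y = 0\<close>.\<close>

lemma full_rank_transpose_inj:
  fixes C :: "real mat"
  assumes C: "C \<in> carrier_mat n m" and rank: "vec_space.rank n C = n"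
    and y: "y \<in> carrier_vec n" and 0: "\<And>c. c \<in> set (cols C) \<Longrightarrow> sprod c y = 0"
  shows "y = 0\<^sub>v n"
proof (rule ccontr)
  assume ny: "y \<noteq> 0\<^sub>v n"
  interpret vec_space "TYPE(real)" n .
  have cC: "set (cols C) \<subseteq> carrier_vec n" using C cols_dim by blast
  obtain S where S: "maximal S (\<lambda>T. T \<subseteq> set (cols C) \<and> lin_indpt T)"
    using maximal_exists[of "(\<lambda>T. T \<subseteq> set (cols C) \<and> lin_indpt T)" "card (set (cols C))" "{}"]
    by (meson List.finite_set card_mono empty_iff empty_subsetI finite_lin_indpt2 rev_finite_subset)
  then have S2: "S \<subseteq> set (cols C)" "lin_indpt S" by (auto simp: maximal_def)
  have "card S = n" using rank_card_indpt[OF C S] rank by simp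
  moreover have fS: "finite S" using S2 finite_subset by blast
  ultimately obtain vs where vs: "set vs = S" "distinct vs" "length vs = n"
    using finite_distinct_list distinct_card by metis
  define N where "N = mat_of_cols n vs"
  have N: "N \<in> carrier_mat n n" using mat_of_cols_carrier(1)[of n vs] by (simp add: N_def vs)
  have cN: "cols N = vs" unfolding N_def using vs S2 cC by (intro cols_mat_of_cols) auto
  have "rank N = n" by (rule lin_indpt_full_rank[OF N]) (simp_all add: cN vs S2)
  then have "Determinant.det N \<noteq> 0" using det_rank_iff[OF N] by simp
  then have "Determinant.det (N\<^sup>T) \<noteq> 0" by (simp add: det_transpose[OF N])
  moreover have "N\<^sup>T *\<^sub>v y = 0\<^sub>v n"
  proof (rule eq_vecI)
    fix i assume "i < dim_vec (0\<^sub>v n :: real vec)"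
    then have i: "i < n" by simp
    then have "col N i \<in> S" using vs(1) cN N by (metis carrier_matD(2) cols_length cols_nth nth_mem vs(3))
    then have "sprod (col N i) y = 0" using 0 S2 by blast
    then show "(N\<^sup>T *\<^sub>v y) $ i = 0\<^sub>v n $ i" using N i by simp
  qed (use N in simp)
  ultimately show False
    using det_0_iff_vec_prod_zero_field[of "N\<^sup>T" n] N y ny by auto
qed

lemma mat_inverse_ex:
  fixes H :: "real mat"
  assumes H: "H \<in> carrier_mat n n" and inj: "\<And>y. y \<in> carrier_vec n \<Longrightarrow> H *\<^sub>v y = 0\<^sub>v n \<Longrightarrow> y = 0\<^sub>v n"
  obtains H' where "H' \<in> carrier_mat n n" "H * H' = 1\<^sub>m n"
proof -
  have "Determinant.det H \<noteq> 0" using det_0_iff_vec_prod_zero_field[OF H] inj by blast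
  then have "H \<in> Units (ring_mat TYPE(real) n ())" by (rule det_non_zero_imp_unit[OF H])
  then show ?thesis using that by (auto simp: Units_def ring_mat_def)
qed

text \<open>The kernel of the block row \<open>(A B)\<close> is the Lagrangian subspace of all
  \<open>(B\<^sup>T y, - A\<^sup>T y)\<close>. The parametrisation comes from an explicit inverse:
  self-adjointness of \<open>A * B\<^sup>T\<close> cancels the off-diagonal blocks of
  \<open>N * R\<close>, and the first block of \<open>N (F, G)\<close> is the vertex condition, so
  \<open>(F, G) = R (0, q)\<close>.\<close>

lemma lagrangian_kernel:
  fixes A B :: "real mat"
  assumes A: "A \<in> carrier_mat n n" and B: "B \<in> carrier_mat n n"
    and rank: "vec_space.rank n (mat_of_cols n (cols A @ cols B)) = n"
    and sym: "transpose_mat (A * B\<^sup>T) = A * B\<^sup>T"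
    and F: "F \<in> carrier_vec n" and G: "G \<in> carrier_vec n"
    and eq: "A *\<^sub>v F + B *\<^sub>v G = 0\<^sub>v n"
  obtains y where "y \<in> carrier_vec n" "F = B\<^sup>T *\<^sub>v y" "G = - (A\<^sup>T *\<^sub>v y)"
proof -
  let ?At = "A\<^sup>T" and ?Bt = "B\<^sup>T"
  have At: "?At \<in> carrier_mat n n" and Bt: "?Bt \<in> carrier_mat n n" using A B by auto
  have comm: "A * ?Bt = B * ?At" using sym A B transpose_mult[OF A Bt] by simp
  \<comment> \<open>\<open>H\<close> is a Gram matrix: its form at \<open>y\<close> is the sum of
    the squared lengths of \<open>A\<^sup>T y\<close> and \<open>B\<^sup>T y\<close>, and maximal
    rank lets both vanish only at 0.\<close>
  define H where "H = A * ?At + B * ?Bt"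
  have H: "H \<in> carrier_mat n n" using A B by (simp add: H_def)
  have norm_id: "sprod y ((M * M\<^sup>T) *\<^sub>v y) = sprod (M\<^sup>T *\<^sub>v y) (M\<^sup>T *\<^sub>v y)"
    if M: "M \<in> carrier_mat n n" and y: "y \<in> carrier_vec n" for M y
    using transpose_vec_mult_scalar[OF M _ y, of "M\<^sup>T *\<^sub>v y"] M y by simp
  have "y = 0\<^sub>v n" if y: "y \<in> carrier_vec n" and Hy: "H *\<^sub>v y = 0\<^sub>v n" for y
  proof -
    have "0 = sprod y (H *\<^sub>v y)" using y Hy by simp
    also have "H *\<^sub>v y = (A * ?At) *\<^sub>v y + (B * ?Bt) *\<^sub>v y"
      unfolding H_def using A B y by (intro add_mult_distrib_mat_vec) auto
    also have "sprod y \<dots> = sprod y ((A * ?At) *\<^sub>v y) + sprod y ((B * ?Bt) *\<^sub>v y)"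
      using A B y by (intro scalar_prod_add_distrib[of _ n]) auto
    finally have "sprod (?At *\<^sub>v y) (?At *\<^sub>v y) + sprod (?Bt *\<^sub>v y) (?Bt *\<^sub>v y) = 0"
      using norm_id[OF A y] norm_id[OF B y] by simp
    then have z: "sprod (?At *\<^sub>v y) (?At *\<^sub>v y) = 0" "sprod (?Bt *\<^sub>v y) (?Bt *\<^sub>v y) = 0"
      using sprod_self_nonneg[of "?At *\<^sub>v y"] sprod_self_nonneg[of "?Bt *\<^sub>v y"] by auto
    have zz: "?At *\<^sub>v y = 0\<^sub>v n" "?Bt *\<^sub>v y = 0\<^sub>v n"
      using A B y z by (auto intro!: sprod_self_zero)
    show ?thesis
    proof (rule full_rank_transpose_inj[OF _ rank y])
      show "mat_of_cols n (cols A @ cols B) \<in> carrier_mat n (length (cols A @ cols B))"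
        by (rule mat_of_cols_carrier(1))
      have sub: "set (cols A @ cols B) \<subseteq> carrier_vec n" using A B cols_dim[of A] cols_dim[of B] by (metis Un_least carrier_matD(1) set_append)
      fix c assume "c \<in> set (cols (mat_of_cols n (cols A @ cols B)))"
      then have "c \<in> set (cols A) \<or> c \<in> set (cols B)" using cols_mat_of_cols[OF sub] by auto
      moreover have "sprod c y = 0" if M: "M \<in> carrier_mat n n" "M\<^sup>T *\<^sub>v y = 0\<^sub>v n" "c \<in> set (cols M)" for M
      proof -
        obtain i where i: "i < n" "c = col M i" using M(1,3) by (auto simp: cols_def)
        have "(M\<^sup>T *\<^sub>v y) $ i = sprod (col M i) y" using M(1) i by simp
        then show ?thesis using M(2) i by simp
      qed
      ultimately show "sprod c y = 0" using A B zz by blast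
    qed
  qed
  then obtain H' where H': "H' \<in> carrier_mat n n" "H * H' = 1\<^sub>m n" using mat_inverse_ex[OF H] by blast
  define N where "N = four_block_mat A B B (- A)"
  define R where "R = four_block_mat (?At * H') (?Bt * H') (?Bt * H') (- (?At * H'))"
  have mA: "- A \<in> carrier_mat n n" using A by simp
  have c: "?At * H' \<in> carrier_mat n n" "?Bt * H' \<in> carrier_mat n n" "- (?At * H') \<in> carrier_mat n n"
    using At Bt H' by auto
  have Nc: "N \<in> carrier_mat (n + n) (n + n)" unfolding N_def using A B mA by simp
  have Rc: "R \<in> carrier_mat (n + n) (n + n)" unfolding R_def using c by simp
  have AA: "A * (?At * H') + B * (?Bt * H') = 1\<^sub>m n"
  proof -
    have "A * (?At * H') + B * (?Bt * H') = A * ?At * H' + B * ?Bt * H'"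
      using A B At Bt H' by (simp add: assoc_mult_mat[of _ n n _ n _ n])
    also have "\<dots> = H * H'" unfolding H_def using A B At Bt H' by (intro add_mult_distrib_mat[symmetric]) auto
    finally show ?thesis using H' by simp
  qed
  have AB: "A * (?Bt * H') = B * (?At * H')"
    using comm assoc_mult_mat[OF A Bt H'(1)] assoc_mult_mat[OF B At H'(1)] by simp
  have "N * R = four_block_mat (A * (?At * H') + B * (?Bt * H')) (A * (?Bt * H') + B * - (?At * H'))
      (B * (?At * H') + - A * (?Bt * H')) (B * (?Bt * H') + - A * - (?At * H'))"
    unfolding N_def R_def by (rule mult_four_block_mat[OF A B B mA c(1,2,2,3)])
  also have "A * (?Bt * H') + B * - (?At * H') = 0\<^sub>m n n"
    using A B c AB by (subst uminus_mult_right_mat) (auto intro!: eq_matI)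
  also have "B * (?At * H') + - A * (?Bt * H') = 0\<^sub>m n n"
    using A B c AB by (subst uminus_mult_left_mat) (auto intro!: eq_matI)
  also have "B * (?Bt * H') + - A * - (?At * H') = A * (?At * H') + B * (?Bt * H')"
    using A B c by (subst uminus_mult_left_mat, simp, subst uminus_mult_right_mat, simp) (auto intro!: eq_matI)
  finally have "N * R = 1\<^sub>m (n + n)" unfolding AA by simp
  then have RN: "R * N = 1\<^sub>m (n + n)" by (rule mat_mult_left_right_inverse[OF Nc Rc])
  define q where "q = B *\<^sub>v F + - A *\<^sub>v G"
  have z0: "M *\<^sub>v 0\<^sub>v n = 0\<^sub>v n" if "M \<in> carrier_mat n n" for M :: "real mat"
    using that by (intro eq_vecI) auto
  have q: "q \<in> carrier_vec n" using A B F G by (simp add: q_def)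
  have "F @\<^sub>v G = R *\<^sub>v (N *\<^sub>v (F @\<^sub>v G))"
    using assoc_mult_mat_vec[OF Rc Nc, of "F @\<^sub>v G"] RN F G by simp
  also have "N *\<^sub>v (F @\<^sub>v G) = 0\<^sub>v n @\<^sub>v q"
    unfolding N_def four_block_mat_mult_vec[OF A B B mA F G] eq q_def ..
  also have "R *\<^sub>v (0\<^sub>v n @\<^sub>v q) = (?At * H' *\<^sub>v 0\<^sub>v n + ?Bt * H' *\<^sub>v q) @\<^sub>v (?Bt * H' *\<^sub>v 0\<^sub>v n + - (?At * H') *\<^sub>v q)"
    unfolding R_def by (rule four_block_mat_mult_vec[OF c(1,2,2,3) _ q]) simp
  also have "?At * H' *\<^sub>v 0\<^sub>v n + ?Bt * H' *\<^sub>v q = ?Bt *\<^sub>v (H' *\<^sub>v q)"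
    using At Bt H' q z0[OF c(1)] by (simp add: assoc_mult_mat_vec[OF Bt H'(1) q])
  also have "?Bt * H' *\<^sub>v 0\<^sub>v n + - (?At * H') *\<^sub>v q = - (?At *\<^sub>v (H' *\<^sub>v q))"
    using At Bt H' q z0[OF c(2)] by (subst uminus_mult_mat_vec) (simp_all add: assoc_mult_mat_vec[OF At H'(1) q])
  finally have "F = ?Bt *\<^sub>v (H' *\<^sub>v q) \<and> G = - (?At *\<^sub>v (H' *\<^sub>v q))"
    using append_vec_eq[OF F, of "?Bt *\<^sub>v (H' *\<^sub>v q)"] Bt H' q by auto
  then show ?thesis using that[of "H' *\<^sub>v q"] H' q by auto
qed

section \<open>Euclidean norms, projections and seminorm bounds on matrix ranges\<close>

lemma vec_norm2_L2_set: "x \<in> carrier_vec n \<Longrightarrow> vec_norm2 x = L2_set (\<lambda>i. x $ i) {0..<n}"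
  by (auto simp: vec_norm2_def L2_set_def scalar_prod_def power2_eq_square)

lemma sprod_le_norms:
  assumes "x \<in> carrier_vec n" "y \<in> carrier_vec n" shows "\<bar>sprod x y\<bar> \<le> vec_norm2 x * vec_norm2 y"
proof -
  have "\<bar>sprod x y\<bar> \<le> (\<Sum>i = 0..<n. \<bar>x $ i\<bar> * \<bar>y $ i\<bar>)"
    using assms unfolding scalar_prod_def by (auto simp: abs_mult[symmetric] intro!: sum_abs)
  also have "\<dots> \<le> vec_norm2 x * vec_norm2 y"
    unfolding assms[THEN vec_norm2_L2_set] by (rule L2_set_mult_ineq)
  finally show ?thesis .
qed

lemma vec_norm2_triangle:
  assumes "x \<in> carrier_vec n" "y \<in> carrier_vec n" shows "vec_norm2 (x + y) \<le> vec_norm2 x + vec_norm2 y"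
proof -
  have "vec_norm2 (x + y) = L2_set (\<lambda>i. (x + y) $ i) {0..<n}"
    by (rule vec_norm2_L2_set) (use assms in auto)
  also have "\<dots> = L2_set (\<lambda>i. x $ i + y $ i) {0..<n}"
    by (rule L2_set_cong) (use assms in auto)
  also have "\<dots> \<le> vec_norm2 x + vec_norm2 y"
    unfolding assms[THEN vec_norm2_L2_set] by (rule L2_set_triangle_ineq)
  finally show ?thesis .
qed

lemma vec_norm2_smult: "x \<in> carrier_vec n \<Longrightarrow> vec_norm2 (c \<cdot>\<^sub>v x) = \<bar>c\<bar> * vec_norm2 x"
  by (simp add: vec_norm2_def real_sqrt_mult power2_eq_square[symmetric] mult.assoc[symmetric])

lemma vec_norm2_nonneg: "0 \<le> vec_norm2 x"
  by (simp add: vec_norm2_def sprod_self_nonneg)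

lemma vec_norm2_square: "(vec_norm2 x)\<^sup>2 = sprod x x"
  by (simp add: vec_norm2_def sprod_self_nonneg)

definition seminorm_on :: "real vec set \<Rightarrow> (real vec \<Rightarrow> real) \<Rightarrow> bool" where
  "seminorm_on W f \<longleftrightarrow> (\<forall>x\<in>W. 0 \<le> f x) \<and> (\<forall>x\<in>W. \<forall>y\<in>W. f (x + y) \<le> f x + f y) \<and>
     (\<forall>c. \<forall>x\<in>W. f (c \<cdot>\<^sub>v x) = \<bar>c\<bar> * f x)"

text \<open>Finite-dimensional subspaces, characterised by what is needed of them: orthogonal projections
  exist and seminorms are bounded.  Adding one spanning vector preserves both.\<close>

definition tame :: "nat \<Rightarrow> real vec set \<Rightarrow> bool" where
  "tame n W \<longleftrightarrow> W \<subseteq> carrier_vec n \<and> 0\<^sub>v n \<in> W \<and> (\<forall>x\<in>W. \<forall>y\<in>W. x + y \<in> W) \<and> (\<forall>c. \<forall>x\<in>W. c \<cdot>\<^sub>v x \<in> W) \<and>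
     (\<forall>x\<in>carrier_vec n. \<exists>p\<in>W. \<forall>w\<in>W. sprod w (x - p) = 0) \<and>
     (\<forall>f. seminorm_on W f \<longrightarrow> (\<exists>C\<ge>0. \<forall>x\<in>W. f x \<le> C * vec_norm2 x))"

lemma tame_zero: "tame n {0\<^sub>v n}"
proof -
  have "f (0\<^sub>v n) = 0" if "seminorm_on {0\<^sub>v n} f" for f
  proof -
    have "f (0 \<cdot>\<^sub>v 0\<^sub>v n) = \<bar>0\<bar> * f (0\<^sub>v n)" using that unfolding seminorm_on_def by blast
    moreover have "0 \<cdot>\<^sub>v 0\<^sub>v n = (0\<^sub>v n :: real vec)" by (intro eq_vecI) auto
    ultimately show ?thesis by simp
  qed
  moreover have "c \<cdot>\<^sub>v 0\<^sub>v n = (0\<^sub>v n :: real vec)" for c by (intro eq_vecI) auto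
  moreover have "\<exists>C\<ge>0. \<forall>x\<in>{0\<^sub>v n}. f x \<le> C * vec_norm2 x" if "seminorm_on {0\<^sub>v n} f" for f
    using calculation(1)[OF that] by (intro exI[of _ 0]) simp
  ultimately show ?thesis unfolding tame_def by (auto simp: vec_norm2_def)
qed

text \<open>Replace \<open>v\<close> by its component \<open>v'\<close> orthogonal to
  \<open>W\<close>, which leaves the span unchanged. If \<open>v'\<close> is 0 nothing is added;
  otherwise Pythagoras bounds both the norm of \<open>w\<close> and \<open>\<bar>c\<bar>\<close>
  times the norm of \<open>v'\<close> by the norm of \<open>w + c v'\<close>, and a seminorm is
  controlled on each summand.\<close>

lemma tame_insert:
  assumes W: "tame n W" and v: "v \<in> carrier_vec n"
  shows "tame n {w + c \<cdot>\<^sub>v v | w c. w \<in> W}" (is "tame n ?V")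
proof -
  have Wc: "w \<in> W \<Longrightarrow> w \<in> carrier_vec n" and W0: "0\<^sub>v n \<in> W"
    and Wadd: "w \<in> W \<Longrightarrow> w' \<in> W \<Longrightarrow> w + w' \<in> W" and Wsm: "w \<in> W \<Longrightarrow> c \<cdot>\<^sub>v w \<in> W"
    and Wproj: "x \<in> carrier_vec n \<Longrightarrow> \<exists>p\<in>W. \<forall>w\<in>W. sprod w (x - p) = 0"
    and Wbd: "seminorm_on W f \<Longrightarrow> \<exists>C\<ge>0. \<forall>x\<in>W. f x \<le> C * vec_norm2 x" for w w' c x f
    using W by (auto simp: tame_def)
  obtain p where p: "p \<in> W" "\<And>w. w \<in> W \<Longrightarrow> sprod w (v - p) = 0" using Wproj[OF v] by blast
  define v' where "v' = v - p"
  have v': "v' \<in> carrier_vec n" using v Wc[OF p(1)] by (simp add: v'_def)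
  have orth: "w \<in> W \<Longrightarrow> sprod w v' = 0" for w using p(2) by (simp add: v'_def)
  let ?E = "{w + c \<cdot>\<^sub>v v' | w c. w \<in> W}"
  have V: "?V = ?E"
  proof (intro equalityI subsetI)
    fix x assume "x \<in> ?V"
    then obtain w c where x: "x = w + c \<cdot>\<^sub>v v" "w \<in> W" by blast
    have "x = (w + c \<cdot>\<^sub>v p) + c \<cdot>\<^sub>v v'" unfolding x v'_def
      using v Wc[OF p(1)] Wc[OF x(2)] by (intro eq_vecI) (auto simp: algebra_simps)
    then show "x \<in> ?E" using Wadd[OF x(2) Wsm[OF p(1)]] by blast
  next
    fix x assume "x \<in> ?E"
    then obtain w c where x: "x = w + c \<cdot>\<^sub>v v'" "w \<in> W" by blast
    have "x = (w + (-c) \<cdot>\<^sub>v p) + c \<cdot>\<^sub>v v" unfolding x v'_def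
      using v Wc[OF p(1)] Wc[OF x(2)] by (intro eq_vecI) (auto simp: algebra_simps)
    then show "x \<in> ?V" using Wadd[OF x(2) Wsm[OF p(1)]] by blast
  qed
  show ?thesis
  proof (cases "v' = 0\<^sub>v n")
    case True
    have z: "c \<cdot>\<^sub>v 0\<^sub>v n = (0\<^sub>v n :: real vec)" for c by (intro eq_vecI) auto
    have "w + 0\<^sub>v n = w" if "w \<in> W" for w using Wc[OF that] by simp
    then have "?V = W" unfolding V True z by force
    then show ?thesis using W by simp
  next
    case False
    then have pos: "0 < sprod v' v'" using sprod_self_zero[OF v'] sprod_self_nonneg[of v'] by linarith
    have n': "0 < vec_norm2 v'" using pos by (simp add: vec_norm2_def)
    show ?thesis unfolding V tame_def
    proof (intro conjI ballI allI impI)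
      show "?E \<subseteq> carrier_vec n" using Wc v' by auto
      show "0\<^sub>v n \<in> ?E" using W0 v' by (auto intro!: exI[of _ "0\<^sub>v n"] exI[of _ "0::real"])
    next
      fix x y assume "x \<in> ?E" "y \<in> ?E"
      then obtain w c w' c' where x: "x = w + c \<cdot>\<^sub>v v'" "w \<in> W" "y = w' + c' \<cdot>\<^sub>v v'" "w' \<in> W" by blast
      have "x + y = (w + w') + (c + c') \<cdot>\<^sub>v v'" unfolding x
        using v' Wc[OF x(2)] Wc[OF x(4)] by (intro eq_vecI) (auto simp: algebra_simps)
      then show "x + y \<in> ?E" using Wadd[OF x(2,4)] by blast
    next
      fix c x assume "x \<in> ?E"
      then obtain w c' where x: "x = w + c' \<cdot>\<^sub>v v'" "w \<in> W" by blast
      have "c \<cdot>\<^sub>v x = c \<cdot>\<^sub>v w + (c * c') \<cdot>\<^sub>v v'" unfolding x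
        using v' Wc[OF x(2)] by (intro eq_vecI) (auto simp: algebra_simps)
      then show "c \<cdot>\<^sub>v x \<in> ?E" using Wsm[OF x(2)] by blast
    next
      fix x :: "real vec" assume x: "x \<in> carrier_vec n"
      obtain p' where p': "p' \<in> W" "\<And>w. w \<in> W \<Longrightarrow> sprod w (x - p') = 0" using Wproj[OF x] by blast
      \<comment> \<open>Gram-Schmidt coefficient: it removes the component of \<open>x - p'\<close>
        along \<open>v'\<close>, and orthogonality to \<open>W\<close> survives because
        \<open>v'\<close> is orthogonal to \<open>W\<close>.\<close>
      define t where "t = sprod v' (x - p') / sprod v' v'"
      have xp: "x - p' \<in> carrier_vec n" using x Wc[OF p'(1)] by simp
      have e: "x - (p' + t \<cdot>\<^sub>v v') = (x - p') - t \<cdot>\<^sub>v v'"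
        using x v' Wc[OF p'(1)] by (intro eq_vecI) auto
      have "sprod (w + c \<cdot>\<^sub>v v') (x - (p' + t \<cdot>\<^sub>v v')) = 0" if w: "w \<in> W" for w c
      proof -
        have d: "sprod z ((x - p') - t \<cdot>\<^sub>v v') = sprod z (x - p') - t * sprod z v'" if "z \<in> carrier_vec n" for z
          using scalar_prod_minus_distrib[OF that xp smult_carrier_vec[THEN iffD2, OF v']] scalar_prod_smult_distrib[OF that v'] by simp
        have "sprod (w + c \<cdot>\<^sub>v v') (x - (p' + t \<cdot>\<^sub>v v')) = sprod w ((x - p') - t \<cdot>\<^sub>v v') + c * sprod v' ((x - p') - t \<cdot>\<^sub>v v')"
          unfolding e using xp v' Wc[OF w]
          by (subst add_scalar_prod_distrib[of _ n]) auto
        also have "\<dots> = 0" using d[OF Wc[OF w]] d[OF v'] p'(2)[OF w] orth[OF w] pos by (simp add: t_def)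
        finally show ?thesis .
      qed
      then show "\<exists>q\<in>?E. \<forall>z\<in>?E. sprod z (x - q) = 0"
        using p'(1) by (intro bexI[of _ "p' + t \<cdot>\<^sub>v v'"]) auto
    next
      fix f assume f: "seminorm_on ?E f"
      have WV: "w \<in> ?E" if "w \<in> W" for w
        using that Wc[OF that] v' by (auto intro!: exI[of _ w] exI[of _ "0::real"])
      have cV: "c \<cdot>\<^sub>v v' \<in> ?E" for c
        using W0 v' by (auto intro!: exI[of _ "0\<^sub>v n"] exI[of _ c])
      have vV: "v' \<in> ?E" using cV[of 1] v' by simp
      have "seminorm_on W f" using f WV unfolding seminorm_on_def by (meson)
      then obtain C where C: "0 \<le> C" "\<And>x. x \<in> W \<Longrightarrow> f x \<le> C * vec_norm2 x" using Wbd by blast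
      have fv: "0 \<le> f v'" using f vV unfolding seminorm_on_def by blast
      show "\<exists>C\<ge>0. \<forall>x\<in>?E. f x \<le> C * vec_norm2 x"
      proof (intro exI[of _ "C + f v' / vec_norm2 v'"] conjI ballI)
        show "0 \<le> C + f v' / vec_norm2 v'" using C fv n' by simp
        fix x assume "x \<in> ?E"
        then obtain w c where x: "x = w + c \<cdot>\<^sub>v v'" "w \<in> W" by blast
        have w: "w \<in> carrier_vec n" by (rule Wc[OF x(2)])
        have wv: "sprod w v' = 0" "sprod v' w = 0" using orth[OF x(2)] comm_scalar_prod[OF v' w] by auto
        have "sprod x x = sprod w w + c\<^sup>2 * sprod v' v'"
          unfolding x(1) using w v' wv
          by (simp add: add_scalar_prod_distrib[of _ n] scalar_prod_add_distrib[of _ n] power2_eq_square)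
        then have sq: "(vec_norm2 x)\<^sup>2 = (vec_norm2 w)\<^sup>2 + (c * vec_norm2 v')\<^sup>2"
          by (simp add: vec_norm2_square power_mult_distrib)
        have 1: "vec_norm2 w \<le> vec_norm2 x"
          by (rule power2_le_imp_le) (simp_all add: sq vec_norm2_nonneg)
        have "\<bar>c * vec_norm2 v'\<bar> \<le> vec_norm2 x"
          by (rule power2_le_imp_le) (simp_all add: sq vec_norm2_nonneg)
        then have 2: "\<bar>c\<bar> \<le> vec_norm2 x / vec_norm2 v'" using n' by (simp add: abs_mult field_simps)
        have "f x \<le> f w + f (c \<cdot>\<^sub>v v')" unfolding x(1) using f WV[OF x(2)] cV unfolding seminorm_on_def by blast
        also have "f (c \<cdot>\<^sub>v v') = \<bar>c\<bar> * f v'" using f vV unfolding seminorm_on_def by blast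
        also have "f w + \<bar>c\<bar> * f v' \<le> C * vec_norm2 x + vec_norm2 x / vec_norm2 v' * f v'"
          using C(2)[OF x(2)] mult_left_mono[OF 1 C(1)] mult_right_mono[OF 2 fv] by linarith
        finally show "f x \<le> (C + f v' / vec_norm2 v') * vec_norm2 x" by (simp add: algebra_simps)
      qed
    qed
  qed
qed

lemma tame_mat_range:
  assumes M: "M \<in> carrier_mat n m" shows "tame n (mat_range M)"
proof -
  \<comment> \<open>Images of the vectors supported on the first \<open>k\<close> coordinates:
    passing to \<open>Suc k\<close> adds one column, and \<open>W m\<close> is the whole
    range.\<close>
  define W where "W k = {M *\<^sub>v x | x. x \<in> carrier_vec m \<and> (\<forall>j<m. k \<le> j \<longrightarrow> x $ j = 0)}" for k
  have col: "M *\<^sub>v unit_vec m k = col M k" if "k < m" for k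
    using that M by (intro eq_vecI) auto
  have "tame n (W k)" if "k \<le> m" for k
    using that
  proof (induction k)
    case 0
    have "W 0 = {0\<^sub>v n}"
    proof -
      have "x = 0\<^sub>v m" if "x \<in> carrier_vec m" "\<forall>j<m. x $ j = 0" for x :: "real vec"
        using that by (intro eq_vecI) auto
      moreover have "M *\<^sub>v 0\<^sub>v m = 0\<^sub>v n" using M by (intro eq_vecI) auto
      ultimately show ?thesis unfolding W_def by (auto intro!: exI[of _ "0\<^sub>v m"])
    qed
    then show ?case using tame_zero by simp
  next
    case (Suc k)
    have "W (Suc k) = {w + c \<cdot>\<^sub>v col M k | w c. w \<in> W k}"
    proof (intro equalityI subsetI)
      fix z assume "z \<in> W (Suc k)"
      then obtain x where x: "z = M *\<^sub>v x" "x \<in> carrier_vec m" "\<And>j. j < m \<Longrightarrow> Suc k \<le> j \<Longrightarrow> x $ j = 0"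
        unfolding W_def by blast
      define x' where "x' = Matrix.vec m (\<lambda>j. if j = k then 0 else x $ j)"
      have e: "x = x' + x $ k \<cdot>\<^sub>v unit_vec m k" using x(2) Suc.prems by (intro eq_vecI) (auto simp: x'_def)
      have "z = M *\<^sub>v x' + x $ k \<cdot>\<^sub>v col M k"
        unfolding x(1) using M Suc.prems
        by (subst e, subst mult_add_distrib_mat_vec[OF M]) (auto simp: x'_def mult_mat_vec[OF M] col)
      moreover have "M *\<^sub>v x' \<in> W k" unfolding W_def using x(3) by (auto simp: x'_def intro!: exI[of _ x'])
      ultimately show "z \<in> {w + c \<cdot>\<^sub>v col M k | w c. w \<in> W k}" by blast
    next
      fix z assume "z \<in> {w + c \<cdot>\<^sub>v col M k | w c. w \<in> W k}"
      then obtain x c where x: "z = M *\<^sub>v x + c \<cdot>\<^sub>v col M k" "x \<in> carrier_vec m" "\<And>j. j < m \<Longrightarrow> k \<le> j \<Longrightarrow> x $ j = 0"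
        unfolding W_def by blast
      have "z = M *\<^sub>v (x + c \<cdot>\<^sub>v unit_vec m k)"
        unfolding x(1) using M Suc.prems x(2)
        by (subst mult_add_distrib_mat_vec[OF M]) (auto simp: mult_mat_vec[OF M] col)
      then show "z \<in> W (Suc k)" unfolding W_def using x(2,3) Suc.prems
        by (auto intro!: exI[of _ "x + c \<cdot>\<^sub>v unit_vec m k"])
    qed
    moreover have "col M k \<in> carrier_vec n" using M by auto
    ultimately show ?case using tame_insert[of n "W k" "col M k"] Suc by simp
  qed
  from this[of m] have "tame n (W m)" by simp
  moreover have "W m = mat_range M" using M by (auto simp: W_def mat_range_def)
  ultimately show ?thesis by simp
qed

text \<open>The range of \<open>B\<^sup>T\<close> is orthogonal to the kernel of \<open>B\<close>.
  The resulting injectivity of \<open>B\<close> on that range is what makes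
  \<open>range_inverse\<close> an inverse.\<close>

lemma mat_range_self_adjoint_kernel:
  assumes B: "B \<in> carrier_mat n n" and x: "x \<in> mat_range B\<^sup>T" and 0: "B *\<^sub>v x = 0\<^sub>v n"
  shows "x = 0\<^sub>v n"
proof -
  obtain y where y: "y \<in> carrier_vec n" "x = B\<^sup>T *\<^sub>v y" using x B by (auto simp: mat_range_def)
  have xc: "x \<in> carrier_vec n" using y B by simp
  have "sprod x x = sprod y (B *\<^sub>v x)" using transpose_vec_mult_scalar[OF B xc y(1)] y(2) by simp
  then show ?thesis using 0 y(1) by (intro sprod_self_zero[OF xc]) simp
qed

section \<open>The operator Lambda at a vertex and its quadratic form\<close>

lemma minus_vec_self: "w \<in> carrier_vec n \<Longrightarrow> w - w = (0\<^sub>v n :: real vec)"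
  by (intro eq_vecI) auto

lemma minus_vec_zero_imp_eq:
  fixes u v :: "real vec"
  assumes "u \<in> carrier_vec n" "v \<in> carrier_vec n" "u - v = 0\<^sub>v n" shows "u = v"
proof (rule eq_vecI)
  fix i assume i: "i < dim_vec v"
  have "u $ i - v $ i = (u - v) $ i" using i by simp
  also have "\<dots> = 0" using i assms by simp
  finally show "u $ i = v $ i" by simp
qed (use assms in auto)

lemma tame_diff: "tame n W \<Longrightarrow> x \<in> W \<Longrightarrow> y \<in> W \<Longrightarrow> x - y \<in> W"
proof -
  assume W: "tame n W" "x \<in> W" "y \<in> W"
  then have c: "x \<in> carrier_vec n" "y \<in> carrier_vec n" by (auto simp: tame_def)
  have "x - y = x + (-1) \<cdot>\<^sub>v y" using c by (intro eq_vecI) auto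
  then show ?thesis using W by (auto simp: tame_def)
qed

text \<open>The projections in \<open>range_inverse\<close> are met only at vectors that already lie
  in their subspaces; there the sandwiched map is \<open>B\<close> itself.\<close>

lemma orth_proj_id:
  assumes W: "tame n W" and x: "x \<in> W" shows "orth_proj W x = x"
  unfolding orth_proj_def
proof (rule the_equality)
  have xc: "x \<in> carrier_vec n" using W x by (auto simp: tame_def)
  have wc: "w \<in> W \<Longrightarrow> w \<in> carrier_vec n" for w using W by (auto simp: tame_def)
  have "sprod w (x - x) = 0" if "w \<in> W" for w
    unfolding minus_vec_self[OF xc] by (rule scalar_prod_right_zero[OF wc[OF that]])
  then show "x \<in> W \<and> (\<forall>w\<in>W. sprod w (x - x) = 0)" using x by blast
  fix y assume y: "y \<in> W \<and> (\<forall>w\<in>W. sprod w (x - y) = 0)"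
  then have "sprod (x - y) (x - y) = 0" using tame_diff[OF W x] by blast
  then have z: "x - y = 0\<^sub>v n" using xc wc y by (intro sprod_self_zero) auto
  show "y = x" by (rule minus_vec_zero_imp_eq[OF xc _ z, symmetric]) (use wc y in blast)
qed

text \<open>For \<open>x = B\<^sup>T y\<close>, self-adjointness rewrites \<open>A x\<close> as
  \<open>B (A\<^sup>T y)\<close>, and projecting \<open>A\<^sup>T y\<close> to the range of
  \<open>B\<^sup>T\<close> leaves its image under \<open>B\<close> unchanged; this solves
  \<open>B z = A x\<close> inside the range, uniquely by injectivity. Later arguments use this
  linear equation instead of the definite descriptions behind \<open>Lam\<close>.\<close>

lemma Lam_char:
  fixes A B :: "real mat"
  assumes A: "A \<in> carrier_mat n n" and B: "B \<in> carrier_mat n n"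
    and sym: "transpose_mat (A * B\<^sup>T) = A * B\<^sup>T"
    and x: "x \<in> mat_range B\<^sup>T"
  shows "Lam A B x \<in> mat_range B\<^sup>T" "B *\<^sub>v Lam A B x = A *\<^sub>v x"
    and "\<And>z. z \<in> mat_range B\<^sup>T \<Longrightarrow> B *\<^sub>v z = A *\<^sub>v x \<Longrightarrow> Lam A B x = z"
proof -
  let ?R = "mat_range B\<^sup>T"
  have At: "A\<^sup>T \<in> carrier_mat n n" and Bt: "B\<^sup>T \<in> carrier_mat n n" using A B by auto
  have R: "tame n ?R" and R1: "tame n (mat_range B)" using tame_mat_range B Bt by auto
  have Rc: "z \<in> ?R \<Longrightarrow> z \<in> carrier_vec n" for z using R by (auto simp: tame_def)
  have BR: "B *\<^sub>v z \<in> mat_range B" if "z \<in> carrier_vec n" for z using that B by (auto simp: mat_range_def)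
  have comm: "A * B\<^sup>T = B * A\<^sup>T" using sym A B transpose_mult[OF A Bt] by simp
  obtain y where y: "y \<in> carrier_vec n" "x = B\<^sup>T *\<^sub>v y" using x B by (auto simp: mat_range_def)
  define q where "q = A\<^sup>T *\<^sub>v y"
  have q: "q \<in> carrier_vec n" using A y by (simp add: q_def)
  have Ax: "A *\<^sub>v x = B *\<^sub>v q"
    using assoc_mult_mat_vec[OF A Bt y(1)] assoc_mult_mat_vec[OF B At y(1)] comm by (simp add: y(2) q_def)
  obtain p where p: "p \<in> ?R" "\<And>w. w \<in> ?R \<Longrightarrow> sprod w (q - p) = 0" using R q by (auto simp: tame_def)
  have qp: "q - p \<in> carrier_vec n" using q Rc[OF p(1)] by simp
  have "B *\<^sub>v (q - p) = 0\<^sub>v n"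
  proof (rule sprod_self_zero)
    let ?b = "B *\<^sub>v (q - p)"
    have b: "?b \<in> carrier_vec n" using B qp by simp
    then show "?b \<in> carrier_vec n" .
    have "B\<^sup>T *\<^sub>v ?b \<in> ?R" using b B by (auto simp: mat_range_def)
    then have "sprod (B\<^sup>T *\<^sub>v ?b) (q - p) = 0" by (rule p(2))
    then show "sprod ?b ?b = 0" using transpose_vec_mult_scalar[OF B qp b] by simp
  qed
  then have Bqp: "B *\<^sub>v q - B *\<^sub>v p = 0\<^sub>v n" using mult_minus_distrib_mat_vec[OF B q Rc[OF p(1)]] by simp
  have Bp: "B *\<^sub>v p = A *\<^sub>v x"
    using minus_vec_zero_imp_eq[OF _ _ Bqp] B q Rc[OF p(1)] Ax by simp
  define f where "f = (\<lambda>x. orth_proj (mat_range B) (B *\<^sub>v orth_proj ?R x))"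
  have fB: "f z = B *\<^sub>v z" if "z \<in> ?R" for z
    unfolding f_def using orth_proj_id[OF R that] orth_proj_id[OF R1 BR[OF Rc[OF that]]] by simp
  have inj: "inj_on f ?R"
  proof (rule inj_onI)
    fix u v assume uv: "u \<in> ?R" "v \<in> ?R" "f u = f v"
    then have "B *\<^sub>v u = B *\<^sub>v v" using fB by simp
    then have "B *\<^sub>v (u - v) = 0\<^sub>v n"
      using mult_minus_distrib_mat_vec[OF B Rc[OF uv(1)] Rc[OF uv(2)]] minus_vec_self[of "B *\<^sub>v v"] B Rc[OF uv(2)] by simp
    then have "u - v = 0\<^sub>v n" by (rule mat_range_self_adjoint_kernel[OF B tame_diff[OF R uv(1,2)]])
    then show "u = v" using minus_vec_zero_imp_eq Rc uv by blast
  qed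
  have char: "Lam A B x = z" if "z \<in> ?R" "B *\<^sub>v z = A *\<^sub>v x" for z
    unfolding Lam_def range_inverse_def f_def[symmetric]
    by (rule the_inv_into_f_eq[OF inj]) (use that fB in auto)
  show "\<And>z. z \<in> ?R \<Longrightarrow> B *\<^sub>v z = A *\<^sub>v x \<Longrightarrow> Lam A B x = z" by (rule char)
  show "Lam A B x \<in> ?R" "B *\<^sub>v Lam A B x = A *\<^sub>v x" using char[OF p(1) Bp] p(1) Bp by auto
qed

text \<open>A supremum of reals bounds its set only if the set is bounded above. The uniqueness
  clause of \<open>Lam_char\<close> makes \<open>Lam\<close> linear on \<open>R\<close>, so that its
  norm is a seminorm, which \<open>tame\<close> bounds.\<close>

lemma Lam_norm_le:
  fixes A B :: "real mat"
  assumes A: "A \<in> carrier_mat n n" and B: "B \<in> carrier_mat n n"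
    and sym: "transpose_mat (A * B\<^sup>T) = A * B\<^sup>T"
  defines "R \<equiv> mat_range B\<^sup>T"
  shows "0 \<le> spectral_norm_on R (Lam A B)"
    and "x \<in> R \<Longrightarrow> vec_norm2 (Lam A B x) \<le> spectral_norm_on R (Lam A B) * vec_norm2 x"
proof -
  have R: "tame n R" unfolding R_def by (rule tame_mat_range) (use B in auto)
  have Rc: "z \<in> R \<Longrightarrow> z \<in> carrier_vec n" for z using R by (auto simp: tame_def)
  have Radd: "z \<in> R \<Longrightarrow> w \<in> R \<Longrightarrow> z + w \<in> R" and Rsm: "z \<in> R \<Longrightarrow> c \<cdot>\<^sub>v z \<in> R" and R0: "0\<^sub>v n \<in> R" for z w c
    using R by (auto simp: tame_def)
  note ch = Lam_char[OF A B sym, folded R_def]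
  have add: "Lam A B (z + w) = Lam A B z + Lam A B w" if "z \<in> R" "w \<in> R" for z w
  proof (rule ch(3)[OF Radd[OF that] Radd[OF ch(1)[OF that(1)] ch(1)[OF that(2)]]])
    show "B *\<^sub>v (Lam A B z + Lam A B w) = A *\<^sub>v (z + w)"
      using mult_add_distrib_mat_vec[OF B Rc[OF ch(1)[OF that(1)]] Rc[OF ch(1)[OF that(2)]]]
        mult_add_distrib_mat_vec[OF A Rc[OF that(1)] Rc[OF that(2)]] ch(2) that by simp
  qed
  have sm: "Lam A B (c \<cdot>\<^sub>v z) = c \<cdot>\<^sub>v Lam A B z" if "z \<in> R" for c z
  proof (rule ch(3)[OF Rsm[OF that] Rsm[OF ch(1)[OF that]]])
    show "B *\<^sub>v (c \<cdot>\<^sub>v Lam A B z) = A *\<^sub>v (c \<cdot>\<^sub>v z)"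
      using mult_mat_vec[OF B Rc[OF ch(1)[OF that]]] mult_mat_vec[OF A Rc[OF that]] ch(2) that by simp
  qed
  have "seminorm_on R (\<lambda>z. vec_norm2 (Lam A B z))"
    unfolding seminorm_on_def using add sm Rc[OF ch(1)]
    by (auto simp: vec_norm2_nonneg intro!: vec_norm2_triangle vec_norm2_smult)
  then obtain C where C: "0 \<le> C" "\<And>z. z \<in> R \<Longrightarrow> vec_norm2 (Lam A B z) \<le> C * vec_norm2 z"
    using R unfolding tame_def by blast
  define X where "X = {vec_norm2 (Lam A B x) | x. x \<in> R \<and> vec_norm2 x \<le> 1}"
  have bdd: "bdd_above X"
  proof (rule bdd_aboveI[of _ C])
    fix t assume "t \<in> X"
    then obtain z where z: "t = vec_norm2 (Lam A B z)" "z \<in> R" "vec_norm2 z \<le> 1" unfolding X_def by blast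
    have "t \<le> C * vec_norm2 z" using C(2) z by simp
    also have "\<dots> \<le> C * 1" by (intro mult_left_mono z C)
    finally show "t \<le> C" by simp
  qed
  have up: "vec_norm2 (Lam A B z) \<le> spectral_norm_on R (Lam A B)" if "z \<in> R" "vec_norm2 z \<le> 1" for z
    unfolding spectral_norm_on_def X_def[symmetric] by (rule cSup_upper[OF _ bdd]) (use that in \<open>auto simp: X_def\<close>)
  have n0: "vec_norm2 (0\<^sub>v n) = 0" by (simp add: vec_norm2_def)
  show "0 \<le> spectral_norm_on R (Lam A B)"
    using up[OF R0] n0 vec_norm2_nonneg[of "Lam A B (0\<^sub>v n)"] by simp
  show "vec_norm2 (Lam A B x) \<le> spectral_norm_on R (Lam A B) * vec_norm2 x" if x: "x \<in> R"
  proof (cases "vec_norm2 x = 0")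
    case True
    then show ?thesis using C(2)[OF x] by simp
  next
    case False
    define t where "t = vec_norm2 x"
    have t: "0 < t" using False vec_norm2_nonneg[of x] by (simp add: t_def)
    have "vec_norm2 (Lam A B ((1/t) \<cdot>\<^sub>v x)) \<le> spectral_norm_on R (Lam A B)"
      using t vec_norm2_smult[OF Rc[OF x], of "1/t"] by (intro up Rsm x) (simp add: t_def)
    then have "1 / t * vec_norm2 (Lam A B x) \<le> spectral_norm_on R (Lam A B)"
      using t vec_norm2_smult[OF Rc[OF ch(1)[OF x]], of "1/t"] by (simp add: sm[OF x])
    then show ?thesis using t by (simp add: t_def[symmetric] field_simps)
  qed
qed

text \<open>In the application \<open>G\<close> collects the fluxes \<open>a(v) F'(v)\<close>. The
  kernel parametrisation puts \<open>F\<close> into the range of \<open>B\<^sup>T\<close>, where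
  \<open>Lam\<close> acts, and \<open>B (Lam F) = A F\<close> gives the chain \<open>Lam F \<bullet>
  F = y \<bullet> A F = A\<^sup>T y \<bullet> F = - F \<bullet> G\<close>.\<close>

lemma vertex_form_bound:
  fixes A B :: "real mat"
  assumes A: "A \<in> carrier_mat n n" and B: "B \<in> carrier_mat n n"
    and rank: "vec_space.rank n (mat_of_cols n (cols A @ cols B)) = n"
    and sym: "transpose_mat (A * B\<^sup>T) = A * B\<^sup>T"
    and F: "F \<in> carrier_vec n" and G: "G \<in> carrier_vec n"
    and eq: "A *\<^sub>v F + B *\<^sub>v G = 0\<^sub>v n"
  shows "- spectral_norm_on (mat_range B\<^sup>T) (Lam A B) * sprod F F \<le> sprod F G"
    and "Lam_nonpositive A B \<Longrightarrow> 0 \<le> sprod F G"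
proof -
  let ?R = "mat_range B\<^sup>T"
  obtain y where y: "y \<in> carrier_vec n" "F = B\<^sup>T *\<^sub>v y" "G = - (A\<^sup>T *\<^sub>v y)"
    using lagrangian_kernel[OF A B rank sym F G eq] by blast
  have FR: "F \<in> ?R" using y B by (auto simp: mat_range_def)
  note ch = Lam_char[OF A B sym FR]
  have Lc: "Lam A B F \<in> carrier_vec n" using ch(1) B by (auto simp: mat_range_def)
  have "sprod (Lam A B F) F = sprod F (Lam A B F)" by (rule comm_scalar_prod[OF Lc F])
  also have "\<dots> = sprod y (B *\<^sub>v Lam A B F)"
    using transpose_vec_mult_scalar[OF B Lc y(1)] y(2) by simp
  also have "\<dots> = sprod y (A *\<^sub>v F)" using ch(2) by simp
  also have "\<dots> = sprod (A\<^sup>T *\<^sub>v y) F" using transpose_vec_mult_scalar[OF A F y(1)] by simp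
  also have "\<dots> = sprod F (A\<^sup>T *\<^sub>v y)" by (rule comm_scalar_prod[OF _ F]) (use A y in simp)
  also have "\<dots> = - sprod F G" using A y(1) F unfolding y(3) by (subst scalar_prod_uminus_right) auto
  finally have form: "sprod F G = - sprod (Lam A B F) F" by simp
  have "sprod (Lam A B F) F \<le> vec_norm2 (Lam A B F) * vec_norm2 F" using sprod_le_norms[OF Lc F] by simp
  also have "\<dots> \<le> (spectral_norm_on ?R (Lam A B) * vec_norm2 F) * vec_norm2 F"
    by (intro mult_right_mono Lam_norm_le(2)[OF A B sym FR] vec_norm2_nonneg)
  also have "\<dots> = spectral_norm_on ?R (Lam A B) * sprod F F"
    by (simp add: vec_norm2_square[symmetric] power2_eq_square)
  finally show "- spectral_norm_on ?R (Lam A B) * sprod F F \<le> sprod F G" using form by simp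
  show "0 \<le> sprod F G" if "Lam_nonpositive A B" using that FR form by (simp add: Lam_nonpositive_def)
qed

section \<open>The energy of linear combinations of eigenfunctions\<close>

locale operator_eigenbasis =
  fixes G :: "('v, 'e) pre_digraph" and len :: "'e \<Rightarrow> real"
    and es :: "'v \<Rightarrow> ('e \<times> bool) list"
    and \<kappa> :: "'e \<Rightarrow> real \<Rightarrow> real" and \<kappa>\<^sub>0 :: real
    and a :: "('v, 'e) gpoint \<Rightarrow> real" and a\<^sub>0 :: real
    and A B :: "'v \<Rightarrow> real mat"
    and \<psi> :: "nat \<Rightarrow> 'e \<Rightarrow> real \<Rightarrow> real" and eig :: "nat \<Rightarrow> real"
  assumes fin: "fin_digraph G" and len_pos: "\<And>e. e \<in> arcs G \<Longrightarrow> 0 < len e"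
    and ends: "\<And>v. v \<in> verts G \<Longrightarrow> distinct (es v) \<and> set (es v) = ends_at G v"
    and kappa: "\<kappa> \<in> Linf_graph G len" "0 < \<kappa>\<^sub>0"
      "\<And>e. e \<in> arcs G \<Longrightarrow> AE x in lebesgue_on {0..len e}. \<kappa>\<^sub>0 \<le> \<kappa> e x"
    and a_lip: "lipschitz_on_graph G len a" and a0_pos: "0 < a\<^sub>0"
    and a_ge: "\<And>p. p \<in> points G len \<Longrightarrow> a\<^sub>0 \<le> a p"
    and AB_carrier: "\<And>v. v \<in> verts G \<Longrightarrow>
      A v \<in> carrier_mat (deg G v) (deg G v) \<and> B v \<in> carrier_mat (deg G v) (deg G v)"
    and AB_rank: "\<And>v. v \<in> verts G \<Longrightarrow>
      vec_space.rank (deg G v) (mat_of_cols (deg G v) (cols (A v) @ cols (B v))) = deg G v"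
    and AB_selfadjoint: "\<And>v. v \<in> verts G \<Longrightarrow>
      transpose_mat (A v * transpose_mat (B v)) = A v * transpose_mat (B v)"
    and A1_or_A2:
      "(4 * Lam_bound G A B / Min (len ` arcs G) < \<kappa>\<^sub>0\<^sup>2 \<and>
        2 * Lam_bound G A B * Max (len ` arcs G) \<le> a\<^sub>0)
       \<or> (\<forall>v\<in>verts G. Lam_nonpositive (A v) (B v))"
    and eigenbasis: "is_eigenbasis G len es a \<kappa> A B \<psi> eig"
begin

sublocale fin_digraph G by (rule fin)

abbreviation (input) edge_inner :: "'e \<Rightarrow> ('e \<Rightarrow> real \<Rightarrow> real) \<Rightarrow> ('e \<Rightarrow> real \<Rightarrow> real) \<Rightarrow> real" where
  "edge_inner e f g \<equiv> LINT x|Leb (len e). f e x * g e x"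
abbreviation (input) edge_sq :: "'e \<Rightarrow> ('e \<Rightarrow> real \<Rightarrow> real) \<Rightarrow> real" where
  "edge_sq e f \<equiv> LINT x|Leb (len e). (f e x)\<^sup>2"

abbreviation (input) psi_comb :: "nat set \<Rightarrow> (nat \<Rightarrow> real) \<Rightarrow> 'e \<Rightarrow> real \<Rightarrow> real" where
  "psi_comb K c e x \<equiv> \<Sum>k\<in>K. c k * \<psi> k e x"

text \<open>The flux \<open>a \<psi>\<^sub>k'\<close> has the continuous representative \<open>p k\<close>, with weak derivative \<open>z k\<close>.\<close>

definition "\<alpha> e x = a (edge_point G len e x)"
definition "U k e = cont_rep (len e) (\<psi> k e)"
definition "w k e = weak_deriv (len e) (\<psi> k e)"
definition "p k e x = \<alpha> e x * cont_rep (len e) (w k e) x"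
definition "z k e = weak_deriv (len e) (\<lambda>y. \<alpha> e y * w k e y)"

section \<open>Regularity of coefficients and eigenfunctions along the edges\<close>

lemma L2_inner_eigenbasis: "L2_inner G len (\<psi> j) (\<psi> k) = (if j = k then 1 else 0)"
  using eigenbasis by (simp add: is_eigenbasis_def)

lemma arcs_nonempty: "arcs G \<noteq> {}"
  using L2_inner_eigenbasis[of 0 0] by (auto simp: L2_inner_def)

lemma edge_point_in: "e \<in> arcs G \<Longrightarrow> x \<in> {0..len e} \<Longrightarrow> edge_point G len e x \<in> points G len"
  unfolding points_def by blast

lemma path_length_nonneg: "path_length G len q r q' \<Longrightarrow> 0 \<le> r"
  by (induction rule: path_length.induct) auto

text \<open>The segment between two points of one edge is an admissible path, so their graph
  distance is at most \<open>\<bar>x - y\<bar>\<close>; a shortcut through other edges only helps.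
  The constant becomes \<open>\<bar>K\<bar>\<close> because the given \<open>K\<close> might be
  negative.\<close>

lemma alpha_lipschitz:
  "\<exists>K. \<forall>e\<in>arcs G. \<forall>x\<in>{0..len e}. \<forall>y\<in>{0..len e}. \<bar>\<alpha> e x - \<alpha> e y\<bar> \<le> K * \<bar>x - y\<bar>"
proof -
  obtain K where K: "\<And>q q'. q \<in> points G len \<Longrightarrow> q' \<in> points G len \<Longrightarrow> \<bar>a q - a q'\<bar> \<le> K * path_dist G len q q'"
    using a_lip unfolding lipschitz_on_graph_def by blast
  have "\<bar>\<alpha> e x - \<alpha> e y\<bar> \<le> \<bar>K\<bar> * \<bar>x - y\<bar>" if e: "e \<in> arcs G" and xy: "x \<in> {0..len e}" "y \<in> {0..len e}" for e x y
  proof -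
    let ?q = "edge_point G len e x" and ?q' = "edge_point G len e y"
    have "path_length G len ?q (0 + \<bar>x - y\<bar>) ?q'"
      by (rule path_length.step[OF path_length.refl]) (use e xy edge_point_in in auto)
    then have pl: "path_length G len ?q \<bar>x - y\<bar> ?q'" by simp
    have bdd: "bdd_below {r. path_length G len ?q r ?q'}"
      using path_length_nonneg by (intro bdd_belowI[of _ 0]) auto
    have "path_dist G len ?q ?q' \<le> \<bar>x - y\<bar>"
      unfolding path_dist_def by (rule cInf_lower[OF _ bdd]) (use pl in simp)
    moreover have "0 \<le> path_dist G len ?q ?q'"
      unfolding path_dist_def by (rule cInf_greatest) (use pl path_length_nonneg in auto)
    ultimately have "K * path_dist G len ?q ?q' \<le> \<bar>K\<bar> * \<bar>x - y\<bar>" by (intro mult_mono) auto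
    then show ?thesis using K[OF edge_point_in edge_point_in, OF e xy(1) e xy(2)] by (simp add: \<alpha>_def)
  qed
  then show ?thesis by blast
qed

lemma alpha_ge: "e \<in> arcs G \<Longrightarrow> x \<in> {0..len e} \<Longrightarrow> a\<^sub>0 \<le> \<alpha> e x"
  by (simp add: \<alpha>_def a_ge edge_point_in)

lemma eigenfunction:
  assumes e: "e \<in> arcs G"
  shows "sq_integrable (len e) (\<psi> k e)" "sq_integrable (len e) (w k e)" "sq_integrable (len e) (z k e)"
    "prim_on (len e) (U k e) (w k e)" "AE x in Leb (len e). U k e x = \<psi> k e x"
    "AE x in Leb (len e). cont_rep (len e) (w k e) x = w k e x"
    "prim_on (len e) (p k e) (z k e)"
    "AE x in Leb (len e). - z k e x + (\<kappa> e x)\<^sup>2 * \<psi> k e x = eig k * \<psi> k e x"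
proof -
  have dom: "\<psi> k \<in> dom_L G len es a A B"
    and ev: "AE x in lebesgue_on {0..len e}. op_L G len a \<kappa> (\<psi> k) e x = eig k * \<psi> k e x"
    using eigenbasis e by (auto simp: is_eigenbasis_def)
  then have H2: "H2 (len e) (\<psi> k e)" using e by (auto simp: dom_L_def)
  then have H1: "H1 (len e) (\<psi> k e)" "H1 (len e) (w k e)" by (auto simp: H2_def w_def)
  note l = len_pos[OF e]
  obtain K where "\<forall>e\<in>arcs G. \<forall>x\<in>{0..len e}. \<forall>y\<in>{0..len e}. \<bar>\<alpha> e x - \<alpha> e y\<bar> \<le> K * \<bar>x - y\<bar>"
    using alpha_lipschitz by (rule exE)
  then have K: "\<And>x y. x \<in> {0..len e} \<Longrightarrow> y \<in> {0..len e} \<Longrightarrow> \<bar>\<alpha> e x - \<alpha> e y\<bar> \<le> K * \<bar>x - y\<bar>"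
    using e by blast
  show "sq_integrable (len e) (\<psi> k e)" "sq_integrable (len e) (w k e)" using H1 by (auto simp: H1_def)
  show "prim_on (len e) (U k e) (w k e)" "AE x in Leb (len e). U k e x = \<psi> k e x"
    using H1_cont_rep[OF H1(1) l] by (auto simp: U_def w_def)
  show "AE x in Leb (len e). cont_rep (len e) (w k e) x = w k e x"
    by (rule H1_cont_rep[OF H1(2) l])
  show "prim_on (len e) (p k e) (z k e)" "sq_integrable (len e) (z k e)"
    using flux_prim_on[OF H2 l K] by (auto simp: p_def[abs_def] z_def w_def)
  show "AE x in Leb (len e). - z k e x + (\<kappa> e x)\<^sup>2 * \<psi> k e x = eig k * \<psi> k e x"
    using ev by (simp add: op_L_def z_def w_def \<alpha>_def[abs_def])
qed

text \<open>The ends sorted by vertex partition all pairs of an arc and a side; a loop contributes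
  both of its ends to the same vertex. This carries edgewise boundary terms over to the vertex
  conditions.\<close>

lemma sum_over_ends:
  fixes f :: "'e \<times> bool \<Rightarrow> real"
  shows "(\<Sum>v\<in>verts G. \<Sum>i = 0..<length (es v). f (es v ! i)) = (\<Sum>e\<in>arcs G. f (e, False) + f (e, True))"
proof -
  have fe: "finite (ends_at G v)" for v
    by (rule finite_subset[of _ "arcs G \<times> UNIV"]) (auto simp: ends_at_def)
  have "(\<Sum>v\<in>verts G. \<Sum>i = 0..<length (es v). f (es v ! i)) = (\<Sum>v\<in>verts G. sum f (ends_at G v))"
  proof (rule sum.cong[OF HOL.refl])
    fix v assume v: "v \<in> verts G"
    have "(\<Sum>i = 0..<length (es v). f (es v ! i)) = sum_list (map f (es v))"
      by (simp add: sum_list_sum_nth)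
    also have "\<dots> = sum f (set (es v))" using ends[OF v] by (simp add: sum_list_distinct_conv_sum_set)
    finally show "(\<Sum>i = 0..<length (es v). f (es v ! i)) = sum f (ends_at G v)" using ends[OF v] by simp
  qed
  also have "\<dots> = sum f (\<Union>v\<in>verts G. ends_at G v)"
    by (rule sum.UNION_disjoint[symmetric]) (use fe in \<open>auto simp: ends_at_def\<close>)
  also have "(\<Union>v\<in>verts G. ends_at G v) = arcs G \<times> UNIV"
  proof (intro equalityI subsetI)
    fix eb assume "eb \<in> arcs G \<times> (UNIV :: bool set)"
    then obtain e b where eb: "eb = (e, b)" "e \<in> arcs G" by blast
    then have "eb \<in> ends_at G (if b then head G e else tail G e)" by (simp add: ends_at_def)
    moreover have "(if b then head G e else tail G e) \<in> verts G" using eb by simp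
    ultimately show "eb \<in> (\<Union>v\<in>verts G. ends_at G v)" by blast
  qed (auto simp: ends_at_def)
  also have "sum f (arcs G \<times> UNIV) = (\<Sum>e\<in>arcs G. f (e, False) + f (e, True))"
    using sum.cartesian_product[of "\<lambda>e b. f (e, b)" UNIV "arcs G"] by (simp add: UNIV_bool)
  finally show ?thesis .
qed

lemma length_es: "v \<in> verts G \<Longrightarrow> length (es v) = deg G v"
  using ends[of v] by (metis deg_def distinct_card)

definition bdryF :: "('e \<Rightarrow> real \<Rightarrow> real) \<Rightarrow> 'e \<times> bool \<Rightarrow> real" where
  "bdryF u = (\<lambda>(e, b). u e (if b then len e else 0))"
text \<open>The sign at the far end makes the derivative point away from the vertex.\<close>

definition bdryG :: "('e \<Rightarrow> real \<Rightarrow> real) \<Rightarrow> 'e \<times> bool \<Rightarrow> real" where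
  "bdryG q = (\<lambda>(e, b). if b then - q e (len e) else q e 0)"

definition bdry_vec :: "('e \<times> bool \<Rightarrow> real) \<Rightarrow> 'v \<Rightarrow> real Matrix.vec" where
  "bdry_vec f v = Matrix.vec (length (es v)) (\<lambda>i. f (es v ! i))"

lemma bdry_vec_carrier: "v \<in> verts G \<Longrightarrow> bdry_vec f v \<in> carrier_vec (deg G v)"
  by (simp add: bdry_vec_def length_es)

text \<open>The factor \<open>a (Vertex v)\<close> is absorbed into the flux, since
  \<open>edge_point\<close> sends each end at \<open>v\<close> to \<open>Vertex v\<close>. At the
  far end this uses \<open>len e \<noteq> 0\<close>, as otherwise \<open>edge_point\<close> would
  return the tail.\<close>

lemma vertex_condition:
  assumes v: "v \<in> verts G"
  shows "A v *\<^sub>v bdry_vec (bdryF (U k)) v + B v *\<^sub>v bdry_vec (bdryG (p k)) v = 0\<^sub>v (deg G v)"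
proof -
  have "\<psi> k \<in> dom_L G len es a A B" using eigenbasis by (simp add: is_eigenbasis_def)
  then have c: "A v *\<^sub>v F_vec len es (\<psi> k) v + a (Vertex v) \<cdot>\<^sub>v (B v *\<^sub>v F'_vec len es (\<psi> k) v) = 0\<^sub>v (deg G v)"
    using v by (simp add: dom_L_def)
  have F: "F_vec len es (\<psi> k) v = bdry_vec (bdryF (U k)) v"
    unfolding F_vec_def bdry_vec_def bdryF_def U_def by (simp add: case_prod_beta)
  have mem: "es v ! i \<in> ends_at G v" if "i < length (es v)" for i using ends[OF v] that nth_mem by blast
  have G: "a (Vertex v) \<cdot>\<^sub>v F'_vec len es (\<psi> k) v = bdry_vec (bdryG (p k)) v"
  proof (rule eq_vecI)
    fix i assume "i < dim_vec (bdry_vec (bdryG (p k)) v)"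
    then have i: "i < length (es v)" by (simp add: bdry_vec_def)
    obtain e b where eb: "es v ! i = (e, b)" by force
    then have "e \<in> arcs G" "(if b then head G e else tail G e) = v" using mem[OF i] by (auto simp: ends_at_def)
    then show "(a (Vertex v) \<cdot>\<^sub>v F'_vec len es (\<psi> k) v) $ i = bdry_vec (bdryG (p k)) v $ i"
      using i eb len_pos[of e]
      by (auto simp: F'_vec_def bdry_vec_def bdryG_def p_def \<alpha>_def edge_point_def w_def)
  qed (simp add: F'_vec_def bdry_vec_def)
  have Fc: "F'_vec len es (\<psi> k) v \<in> carrier_vec (deg G v)" by (simp add: F'_vec_def length_es[OF v])
  show ?thesis
    using c mult_mat_vec[OF conjunct2[OF AB_carrier[OF v]] Fc, of "a (Vertex v)"] unfolding F G by simp
qed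

lemma bdry_sum:
  "bdryF (\<lambda>e x. \<Sum>k\<in>K. c k * f k e x) eb = (\<Sum>k\<in>K. c k * bdryF (f k) eb)"
  "bdryG (\<lambda>e x. \<Sum>k\<in>K. c k * f k e x) eb = (\<Sum>k\<in>K. c k * bdryG (f k) eb)"
  by (auto simp: bdryF_def bdryG_def case_prod_beta sum_negf)

lemma vertex_condition_sum:
  assumes v: "v \<in> verts G"
  shows "A v *\<^sub>v bdry_vec (bdryF (\<lambda>e x. \<Sum>k\<in>K. c k * U k e x)) v
    + B v *\<^sub>v bdry_vec (bdryG (\<lambda>e x. \<Sum>k\<in>K. c k * p k e x)) v = 0\<^sub>v (deg G v)"
proof (rule eq_vecI)
  let ?d = "deg G v"
  have AB: "A v \<in> carrier_mat ?d ?d" "B v \<in> carrier_mat ?d ?d" using AB_carrier[OF v] by auto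
  fix i assume "i < dim_vec (0\<^sub>v ?d :: real Matrix.vec)"
  then have i: "i < ?d" by simp
  have comp: "(A v *\<^sub>v bdry_vec f v + B v *\<^sub>v bdry_vec g v) $ i
      = (\<Sum>j = 0..<?d. A v $$ (i,j) * f (es v ! j) + B v $$ (i,j) * g (es v ! j))" for f g
    using i AB by (simp add: scalar_prod_def bdry_vec_def length_es[OF v] sum.distrib)
  have z: "(\<Sum>j = 0..<?d. A v $$ (i,j) * bdryF (U k) (es v ! j) + B v $$ (i,j) * bdryG (p k) (es v ! j)) = 0" for k
    using vertex_condition[OF v, of k] comp[of "bdryF (U k)" "bdryG (p k)"] i by simp
  have "(A v *\<^sub>v bdry_vec (bdryF (\<lambda>e x. \<Sum>k\<in>K. c k * U k e x)) v
    + B v *\<^sub>v bdry_vec (bdryG (\<lambda>e x. \<Sum>k\<in>K. c k * p k e x)) v) $ i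
    = (\<Sum>j = 0..<?d. \<Sum>k\<in>K. c k * (A v $$ (i,j) * bdryF (U k) (es v ! j) + B v $$ (i,j) * bdryG (p k) (es v ! j)))"
    unfolding comp bdry_sum by (simp add: sum_distrib_left sum.distrib algebra_simps)
  also have "\<dots> = (\<Sum>k\<in>K. c k * (\<Sum>j = 0..<?d. A v $$ (i,j) * bdryF (U k) (es v ! j) + B v $$ (i,j) * bdryG (p k) (es v ! j)))"
    by (subst sum.swap) (simp only: sum_distrib_left)
  also have "\<dots> = 0" by (simp only: z) simp
  finally show "(A v *\<^sub>v bdry_vec (bdryF (\<lambda>e x. \<Sum>k\<in>K. c k * U k e x)) v
    + B v *\<^sub>v bdry_vec (bdryG (\<lambda>e x. \<Sum>k\<in>K. c k * p k e x)) v) $ i = 0\<^sub>v ?d $ i" using i by simp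
qed (use AB_carrier[OF v] in auto)

definition vertex_form_ge :: "real \<Rightarrow> bool" where
  "vertex_form_ge S \<longleftrightarrow> (\<forall>v\<in>verts G. \<forall>f\<in>carrier_vec (deg G v). \<forall>g\<in>carrier_vec (deg G v).
     A v *\<^sub>v f + B v *\<^sub>v g = 0\<^sub>v (deg G v) \<longrightarrow> - S * sprod f f \<le> sprod f g)"

text \<open>Both alternatives reach the estimates only through \<open>S\<close>: under (A2) it is 0
  and the two numerical conditions reduce to positivity, otherwise it is \<open>Lam_bound\<close>
  and they are (A1).\<close>

lemma vertex_constant:
  obtains S where "0 \<le> S" "4 * S / Min (len ` arcs G) < \<kappa>\<^sub>0\<^sup>2" "2 * S * Max (len ` arcs G) \<le> a\<^sub>0"
    "vertex_form_ge S"
proof (cases "\<forall>v\<in>verts G. Lam_nonpositive (A v) (B v)")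
  case True
  show ?thesis
  proof (rule that[of 0])
    show "vertex_form_ge 0" unfolding vertex_form_ge_def
    proof (intro ballI impI)
      fix v f g assume v: "v \<in> verts G" and fg: "f \<in> carrier_vec (deg G v)" "g \<in> carrier_vec (deg G v)"
        "A v *\<^sub>v f + B v *\<^sub>v g = 0\<^sub>v (deg G v)"
      then have "0 \<le> sprod f g"
        using vertex_form_bound(2)[OF _ _ AB_rank[OF v] AB_selfadjoint[OF v] fg] AB_carrier[OF v] True by blast
      then show "- 0 * sprod f f \<le> sprod f g" by simp
    qed
  qed (use kappa a0_pos in auto)
next
  case False
  \<comment> \<open>The failure of (A2) supplies a vertex, so \<open>Lam_bound\<close> dominates
    some nonnegative spectral norm.\<close>
  then obtain v0 where v0: "v0 \<in> verts G" by blast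
  let ?s = "\<lambda>v. spectral_norm_on (mat_range (transpose_mat (B v))) (Lam (A v) (B v))"
  have le: "?s v \<le> Lam_bound G A B" if "v \<in> verts G" for v
    unfolding Lam_bound_def using that by (intro Max_ge) auto
  have nn: "0 \<le> ?s v" if "v \<in> verts G" for v
    using Lam_norm_le(1)[OF _ _ AB_selfadjoint[OF that]] AB_carrier[OF that] by blast
  show ?thesis
  proof (rule that[of "Lam_bound G A B"])
    show "0 \<le> Lam_bound G A B" using le[OF v0] nn[OF v0] by simp
    show "vertex_form_ge (Lam_bound G A B)" unfolding vertex_form_ge_def
    proof (intro ballI impI)
      fix v f g assume v: "v \<in> verts G" and fg: "f \<in> carrier_vec (deg G v)" "g \<in> carrier_vec (deg G v)"
        "A v *\<^sub>v f + B v *\<^sub>v g = 0\<^sub>v (deg G v)"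
      have "- ?s v * sprod f f \<le> sprod f g"
        using vertex_form_bound(1)[OF _ _ AB_rank[OF v] AB_selfadjoint[OF v] fg] AB_carrier[OF v] by blast
      moreover have "?s v * sprod f f \<le> Lam_bound G A B * sprod f f"
        by (intro mult_right_mono le v sprod_self_nonneg)
      ultimately show "- Lam_bound G A B * sprod f f \<le> sprod f g" by simp
    qed
  qed (use A1_or_A2 False in auto)
qed

definition Ucomb :: "nat set \<Rightarrow> (nat \<Rightarrow> real) \<Rightarrow> 'e \<Rightarrow> real \<Rightarrow> real" where
  "Ucomb K c e x = (\<Sum>k\<in>K. c k * U k e x)"
definition wcomb :: "nat set \<Rightarrow> (nat \<Rightarrow> real) \<Rightarrow> 'e \<Rightarrow> real \<Rightarrow> real" where
  "wcomb K c e x = (\<Sum>k\<in>K. c k * w k e x)"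

lemma comb:
  assumes e: "e \<in> arcs G" 
  shows "prim_on (len e) (Ucomb K c e) (wcomb K c e)" "sq_integrable (len e) (wcomb K c e)"
    "sq_integrable (len e) (Ucomb K c e)"
proof -
  show 1: "prim_on (len e) (Ucomb K c e) (wcomb K c e)"
    unfolding Ucomb_def[abs_def] wcomb_def[abs_def] by (rule prim_on_sum) (rule eigenfunction[OF e])
  show "sq_integrable (len e) (wcomb K c e)"
    unfolding wcomb_def[abs_def] by (rule sq_integrable_sum) (rule eigenfunction[OF e])
  show "sq_integrable (len e) (Ucomb K c e)"
    by (rule sq_integrable_continuous[OF prim_on_continuous[OF 1]])
qed

text \<open>For \<open>b k = eig k * c k\<close> the left side is the quadratic form of the operator
  at the combination, for \<open>b = c\<close> its squared norm.\<close>

lemma sum_inner_comb: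
  assumes K: "finite K"
  shows "(\<Sum>e\<in>arcs G. LINT x|Leb (len e). (\<Sum>k\<in>K. b k * \<psi> k e x) * psi_comb K c e x) = (\<Sum>k\<in>K. b k * c k)"
proof -
  have "(LINT x|Leb (len e). (\<Sum>k\<in>K. b k * \<psi> k e x) * psi_comb K c e x)
    = (\<Sum>k\<in>K. \<Sum>j\<in>K. b k * c j * edge_inner e (\<psi> k) (\<psi> j))" if e: "e \<in> arcs G" for e
  proof -
    have i: "integrable (Leb (len e)) (\<lambda>x. \<psi> k e x * \<psi> j e x)" for k j
      by (rule sq_integrable_mult) (rule eigenfunction[OF e])+
    have "(LINT x|Leb (len e). (\<Sum>k\<in>K. b k * \<psi> k e x) * psi_comb K c e x)
      = (LINT x|Leb (len e). (\<Sum>k\<in>K. \<Sum>j\<in>K. b k * c j * (\<psi> k e x * \<psi> j e x)))"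
      by (simp add: sum_product ac_simps)
    also have "\<dots> = (\<Sum>k\<in>K. \<Sum>j\<in>K. b k * c j * edge_inner e (\<psi> k) (\<psi> j))"
      using i by (simp add: Bochner_Integration.integral_sum)
    finally show ?thesis .
  qed
  then have "(\<Sum>e\<in>arcs G. LINT x|Leb (len e). (\<Sum>k\<in>K. b k * \<psi> k e x) * psi_comb K c e x)
    = (\<Sum>e\<in>arcs G. \<Sum>k\<in>K. \<Sum>j\<in>K. b k * c j * edge_inner e (\<psi> k) (\<psi> j))" by simp
  also have "\<dots> = (\<Sum>k\<in>K. \<Sum>j\<in>K. b k * c j * L2_inner G len (\<psi> k) (\<psi> j))"
    unfolding L2_inner_def sum_distrib_left
    by (subst sum.swap, rule sum.cong[OF HOL.refl], subst sum.swap) simp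
  also have "\<dots> = (\<Sum>k\<in>K. b k * c k)"
    using K by (simp add: L2_inner_eigenbasis if_distrib cong: if_cong)
  finally show ?thesis .
qed

lemma AE_Ucomb:
  assumes "finite K" "e \<in> arcs G"
  shows "AE x in Leb (len e). Ucomb K c e x = psi_comb K c e x"
proof -
  have "AE x in Leb (len e). \<forall>k\<in>K. U k e x = \<psi> k e x"
    using assms eigenfunction(5) by (intro AE_finite_allI) auto
  then show ?thesis by eventually_elim (simp add: Ucomb_def)
qed

lemma norm_comb:
  assumes K: "finite K"
  shows "(\<Sum>e\<in>arcs G. LINT x|Leb (len e). (Ucomb K c e x)\<^sup>2) = (\<Sum>k\<in>K. (c k)\<^sup>2)"
proof -
  have "edge_sq e (Ucomb K c)
    = (LINT x|Leb (len e). psi_comb K c e x * psi_comb K c e x)" if e: "e \<in> arcs G" for e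
  proof (rule integral_cong_AE)
    show "AE x in Leb (len e). (Ucomb K c e x)\<^sup>2 = psi_comb K c e x * psi_comb K c e x"
      using AE_Ucomb[OF K e, of c] by eventually_elim (simp add: power2_eq_square)
    have "sq_integrable (len e) (\<lambda>x. psi_comb K c e x)" by (rule sq_integrable_sum) (rule eigenfunction[OF e])
    then show "(\<lambda>x. psi_comb K c e x * psi_comb K c e x) \<in> borel_measurable (Leb (len e))"
      unfolding sq_integrable_def by (intro borel_measurable_times) blast+
  qed (use comb(3)[OF e, of K c] in \<open>auto simp: sq_integrable_def\<close>)
  then show ?thesis using sum_inner_comb[OF K, of c c] by (simp add: power2_eq_square)
qed

text \<open>Pairing the eigenvalue equations with the combination and integrating by parts is exact;
  the inequality comes solely from \<kappa> bounded below by \<open>\<kappa>\<^sub>0\<close> and a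
  by \<open>a\<^sub>0\<close>. The end terms are regrouped from edges to vertices.\<close>

lemma energy_identity:
  fixes c :: "nat \<Rightarrow> real"
  assumes K: "finite K"
  defines "pc \<equiv> \<lambda>e x. \<Sum>k\<in>K. c k * p k e x"
  shows "(\<Sum>k\<in>K. eig k * (c k)\<^sup>2) \<ge> (\<Sum>e\<in>arcs G. \<kappa>\<^sub>0\<^sup>2 * edge_sq e (Ucomb K c)
      + a\<^sub>0 * edge_sq e (wcomb K c))
      + (\<Sum>v\<in>verts G. sprod (bdry_vec (bdryF (Ucomb K c)) v) (bdry_vec (bdryG pc) v))"
proof -
  define u where "u = Ucomb K c"
  define zc where "zc = (\<lambda>e x. \<Sum>k\<in>K. c k * z k e x)"
  have edge: "(LINT x|Leb (len e). (\<Sum>k\<in>K. eig k * c k * \<psi> k e x) * psi_comb K c e x)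
      \<ge> \<kappa>\<^sub>0\<^sup>2 * edge_sq e u + a\<^sub>0 * edge_sq e (wcomb K c)
        + (u e 0 * pc e 0 - u e (len e) * pc e (len e))" if e: "e \<in> arcs G" for e
  proof -
    let ?l = "len e"
    note l = len_pos[OF e]
    have up: "prim_on ?l (u e) (wcomb K c e)" and usq: "sq_integrable ?l (u e)"
      and wsq: "sq_integrable ?l (wcomb K c e)" unfolding u_def by (rule comb[OF e])+
    have pp: "prim_on ?l (pc e) (zc e)"
      unfolding pc_def zc_def by (rule prim_on_sum) (rule eigenfunction[OF e])
    have zsq: "sq_integrable ?l (zc e)"
      unfolding zc_def by (rule sq_integrable_sum) (rule eigenfunction[OF e])
    note uc = prim_on_continuous[OF up]
    obtain D where D: "AE x in Leb ?l. \<bar>\<kappa> e x\<bar> \<le> D" and \<kappa>m: "\<kappa> e \<in> borel_measurable (Leb ?l)"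
      using kappa(1) e unfolding Linf_graph_def by blast
    have \<kappa>u: "sq_integrable ?l (\<lambda>x. \<kappa> e x * u e x)" by (rule sq_integrable_bounded_mult[OF usq \<kappa>m D])
    have i1: "integrable (Leb ?l) (\<lambda>x. zc e x * u e x)" by (rule sq_integrable_mult[OF zsq usq])
    have i2: "integrable (Leb ?l) (\<lambda>x. pc e x * wcomb K c e x)"
      using integrable_mult_continuous[OF prim_on_integrable[OF up] prim_on_continuous[OF pp]] by (simp add: mult.commute)
    have i3: "integrable (Leb ?l) (\<lambda>x. (\<kappa> e x * u e x)\<^sup>2)" using \<kappa>u by (simp add: sq_integrable_def)
    have i4: "integrable (Leb ?l) (\<lambda>x. (u e x)\<^sup>2)" using usq by (simp add: sq_integrable_def)
    have i5: "integrable (Leb ?l) (\<lambda>x. (wcomb K c e x)\<^sup>2)" using wsq by (simp add: sq_integrable_def)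
    have AE1: "AE x in Leb ?l. u e x = psi_comb K c e x" unfolding u_def by (rule AE_Ucomb[OF K e])
    have AE2: "AE x in Leb ?l. \<forall>k\<in>K. - z k e x + (\<kappa> e x)\<^sup>2 * \<psi> k e x = eig k * \<psi> k e x"
      using K eigenfunction(8)[OF e] by (intro AE_finite_allI) auto
    \<comment> \<open>The flux is built from the continuous representative of \<open>w k e\<close>,
      which boundary values require; under the integral it may be replaced by
      \<open>w k e\<close>.\<close>
    have AE3: "AE x in Leb ?l. \<forall>k\<in>K. cont_rep ?l (w k e) x = w k e x"
      using K eigenfunction(6)[OF e] by (intro AE_finite_allI) auto
    have lhs: "(LINT x|Leb ?l. (\<Sum>k\<in>K. eig k * c k * \<psi> k e x) * psi_comb K c e x)
      = (LINT x|Leb ?l. (\<kappa> e x * u e x)\<^sup>2 - zc e x * u e x)"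
    proof (rule integral_cong_AE)
      have sq: "sq_integrable ?l (\<lambda>x. \<Sum>k\<in>K. b k * \<psi> k e x)" for b by (rule sq_integrable_sum) (rule eigenfunction[OF e])
      have m: "(\<lambda>x. \<Sum>k\<in>K. b k * \<psi> k e x) \<in> borel_measurable (Leb ?l)" for b
        using sq[of b] unfolding sq_integrable_def by (rule conjunct1)
      show "(\<lambda>x. (\<Sum>k\<in>K. eig k * c k * \<psi> k e x) * psi_comb K c e x) \<in> borel_measurable (Leb ?l)"
        by (rule borel_measurable_times[OF m m])
      show "(\<lambda>x. (\<kappa> e x * u e x)\<^sup>2 - zc e x * u e x) \<in> borel_measurable (Leb ?l)"
        using i1 i3 by (intro borel_measurable_diff) auto
      show "AE x in Leb ?l. (\<Sum>k\<in>K. eig k * c k * \<psi> k e x) * psi_comb K c e x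
          = (\<kappa> e x * u e x)\<^sup>2 - zc e x * u e x"
        using AE1 AE2
      proof eventually_elim
        case (elim x)
        have "(\<Sum>k\<in>K. eig k * c k * \<psi> k e x) = (\<Sum>k\<in>K. c k * (eig k * \<psi> k e x))" by (simp add: ac_simps)
        also have "\<dots> = (\<Sum>k\<in>K. c k * (- z k e x + (\<kappa> e x)\<^sup>2 * \<psi> k e x))" using elim(2) by simp
        also have "\<dots> = - zc e x + (\<kappa> e x)\<^sup>2 * u e x"
          unfolding elim(1) zc_def by (simp add: sum_distrib_left sum.distrib sum_negf sum_subtractf algebra_simps)
        finally have s: "(\<Sum>k\<in>K. eig k * c k * \<psi> k e x) = - zc e x + (\<kappa> e x)\<^sup>2 * u e x" .
        show ?case unfolding s elim(1)[symmetric] by (simp add: power2_eq_square algebra_simps)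
      qed
    qed
    also have "\<dots> = (LINT x|Leb ?l. (\<kappa> e x * u e x)\<^sup>2) - (LINT x|Leb ?l. zc e x * u e x)"
      using i1 i3 by simp
    also have "(LINT x|Leb ?l. zc e x * u e x) = pc e ?l * u e ?l - pc e 0 * u e 0 - (LINT x|Leb ?l. pc e x * wcomb K c e x)"
      using prim_on_end[OF prim_on_mult[OF pp up] l] i1 i2 by simp
    finally have eq: "(LINT x|Leb ?l. (\<Sum>k\<in>K. eig k * c k * \<psi> k e x) * psi_comb K c e x)
      = (LINT x|Leb ?l. (\<kappa> e x * u e x)\<^sup>2) + (LINT x|Leb ?l. pc e x * wcomb K c e x) + (u e 0 * pc e 0 - u e ?l * pc e ?l)"
      by (simp add: algebra_simps)
    have "\<kappa>\<^sub>0\<^sup>2 * (LINT x|Leb ?l. (u e x)\<^sup>2) = (LINT x|Leb ?l. \<kappa>\<^sub>0\<^sup>2 * (u e x)\<^sup>2)" by simp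
    also have "\<dots> \<le> (LINT x|Leb ?l. (\<kappa> e x * u e x)\<^sup>2)"
    proof (rule integral_mono_AE)
      show "AE x in Leb ?l. \<kappa>\<^sub>0\<^sup>2 * (u e x)\<^sup>2 \<le> (\<kappa> e x * u e x)\<^sup>2"
        using kappa(3)[OF e]
      proof eventually_elim
        case (elim x)
        then have "\<kappa>\<^sub>0\<^sup>2 \<le> (\<kappa> e x)\<^sup>2" using kappa(2) by (intro power_mono) auto
        then show ?case by (simp add: power_mult_distrib mult_right_mono)
      qed
    qed (use i3 i4 in auto)
    finally have k1: "\<kappa>\<^sub>0\<^sup>2 * (LINT x|Leb ?l. (u e x)\<^sup>2) \<le> (LINT x|Leb ?l. (\<kappa> e x * u e x)\<^sup>2)" .
    have "a\<^sub>0 * (LINT x|Leb ?l. (wcomb K c e x)\<^sup>2) = (LINT x|Leb ?l. a\<^sub>0 * (wcomb K c e x)\<^sup>2)" by simp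
    also have "\<dots> \<le> (LINT x|Leb ?l. pc e x * wcomb K c e x)"
    proof (rule integral_mono_AE)
      show "AE x in Leb ?l. a\<^sub>0 * (wcomb K c e x)\<^sup>2 \<le> pc e x * wcomb K c e x"
        using AE3 AE_space
      proof eventually_elim
        case (elim x)
        have "pc e x = (\<Sum>k\<in>K. c k * (\<alpha> e x * w k e x))" unfolding pc_def p_def using elim(1) by simp
        also have "\<dots> = \<alpha> e x * wcomb K c e x" by (simp add: wcomb_def sum_distrib_left ac_simps)
        finally have "pc e x * wcomb K c e x = \<alpha> e x * (wcomb K c e x)\<^sup>2" by (simp add: power2_eq_square)
        moreover have "a\<^sub>0 \<le> \<alpha> e x" using elim(2) by (intro alpha_ge[OF e]) simp
        ultimately show ?case by (simp add: mult_right_mono)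
      qed
    qed (use i2 i5 in auto)
    finally show ?thesis using k1 unfolding eq by linarith
  qed
  have "(\<Sum>v\<in>verts G. sprod (bdry_vec (bdryF u) v) (bdry_vec (bdryG pc) v))
      = (\<Sum>v\<in>verts G. \<Sum>i = 0..<length (es v). (\<lambda>eb. bdryF u eb * bdryG pc eb) (es v ! i))"
    by (simp add: scalar_prod_def bdry_vec_def)
  also have "\<dots> = (\<Sum>e\<in>arcs G. u e 0 * pc e 0 - u e (len e) * pc e (len e))"
    using sum_over_ends[of "\<lambda>eb. bdryF u eb * bdryG pc eb"] by (simp add: bdryF_def bdryG_def)
  finally have b: "(\<Sum>v\<in>verts G. sprod (bdry_vec (bdryF u) v) (bdry_vec (bdryG pc) v))
    = (\<Sum>e\<in>arcs G. u e 0 * pc e 0 - u e (len e) * pc e (len e))" .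
  have "(\<Sum>k\<in>K. eig k * (c k)\<^sup>2) = (\<Sum>e\<in>arcs G. LINT x|Leb (len e). (\<Sum>k\<in>K. eig k * c k * \<psi> k e x) * psi_comb K c e x)"
    unfolding sum_inner_comb[OF K] by (simp add: power2_eq_square ac_simps)
  also have "\<dots> \<ge> (\<Sum>e\<in>arcs G. \<kappa>\<^sub>0\<^sup>2 * edge_sq e u + a\<^sub>0 * edge_sq e (wcomb K c)
        + (u e 0 * pc e 0 - u e (len e) * pc e (len e)))"
    by (rule sum_mono) (rule edge)
  finally show ?thesis unfolding u_def[symmetric] b by (simp add: sum.distrib)
qed

text \<open>Each edge has two ends, so the trace inequality enters twice and produces
  \<open>4 * S / h\<close> and \<open>2 * S * h\<close>. The length \<open>h\<close> stays free
  because positivity wants it as large as the edge and coercivity wants it small.\<close>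

lemma energy_lower_bound:
  assumes K: "finite K" and S: "0 \<le> S"
    "vertex_form_ge S"
    and h: "\<And>e. e \<in> arcs G \<Longrightarrow> 0 < h e \<and> h e \<le> len e"
  shows "(\<Sum>e\<in>arcs G. (\<kappa>\<^sub>0\<^sup>2 - 4 * S / h e) * edge_sq e (Ucomb K c)
      + (a\<^sub>0 - 2 * S * h e) * edge_sq e (wcomb K c)) \<le> (\<Sum>k\<in>K. eig k * (c k)\<^sup>2)"
proof -
  define u where "u = Ucomb K c"
  define pc where "pc = (\<lambda>e x. \<Sum>k\<in>K. c k * p k e x)"
  define I J where "I e = edge_sq e u" and "J e = edge_sq e (wcomb K c)" for e
  have "- S * (\<Sum>v\<in>verts G. sprod (bdry_vec (bdryF u) v) (bdry_vec (bdryF u) v))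
    = (\<Sum>v\<in>verts G. - S * sprod (bdry_vec (bdryF u) v) (bdry_vec (bdryF u) v))"
    by (rule sum_distrib_left)
  also have "\<dots> \<le> (\<Sum>v\<in>verts G. sprod (bdry_vec (bdryF u) v) (bdry_vec (bdryG pc) v))"
  proof (rule sum_mono)
    fix v assume v: "v \<in> verts G"
    show "- S * sprod (bdry_vec (bdryF u) v) (bdry_vec (bdryF u) v) \<le> sprod (bdry_vec (bdryF u) v) (bdry_vec (bdryG pc) v)"
      using S(2) v bdry_vec_carrier[OF v] vertex_condition_sum[OF v, where K = K and c = c]
      unfolding vertex_form_ge_def u_def pc_def Ucomb_def[abs_def] by blast
  qed
  finally have 1: "- S * (\<Sum>v\<in>verts G. sprod (bdry_vec (bdryF u) v) (bdry_vec (bdryF u) v))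
    \<le> (\<Sum>v\<in>verts G. sprod (bdry_vec (bdryF u) v) (bdry_vec (bdryG pc) v))" .
  have "(\<Sum>v\<in>verts G. sprod (bdry_vec (bdryF u) v) (bdry_vec (bdryF u) v))
      = (\<Sum>v\<in>verts G. \<Sum>i = 0..<length (es v). (\<lambda>eb. (bdryF u eb)\<^sup>2) (es v ! i))"
    by (simp add: scalar_prod_def bdry_vec_def power2_eq_square)
  also have "\<dots> = (\<Sum>e\<in>arcs G. (u e 0)\<^sup>2 + (u e (len e))\<^sup>2)"
    using sum_over_ends[of "\<lambda>eb. (bdryF u eb)\<^sup>2"] by (simp add: bdryF_def)
  also have "\<dots> \<le> (\<Sum>e\<in>arcs G. 4 / h e * I e + 2 * h e * J e)"
  proof (rule sum_mono)
    fix e assume e: "e \<in> arcs G"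
    note up = comb(1)[OF e, of K c, folded u_def] and wsq = comb(2)[OF e, of K c]
    have "(u e 0)\<^sup>2 \<le> 2 / h e * I e + h e * J e" "(u e (len e))\<^sup>2 \<le> 2 / h e * I e + h e * J e"
      unfolding I_def J_def using h[OF e] len_pos[OF e] by (intro trace_ineq[OF up wsq]; simp)+
    then show "(u e 0)\<^sup>2 + (u e (len e))\<^sup>2 \<le> 4 / h e * I e + 2 * h e * J e" by simp
  qed
  finally have 2: "S * (\<Sum>v\<in>verts G. sprod (bdry_vec (bdryF u) v) (bdry_vec (bdryF u) v))
    \<le> S * (\<Sum>e\<in>arcs G. 4 / h e * I e + 2 * h e * J e)" by (rule mult_left_mono) (rule S)
  have "(\<Sum>e\<in>arcs G. (\<kappa>\<^sub>0\<^sup>2 - 4 * S / h e) * I e + (a\<^sub>0 - 2 * S * h e) * J e)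
    = (\<Sum>e\<in>arcs G. (\<kappa>\<^sub>0\<^sup>2 * I e + a\<^sub>0 * J e) - S * (4 / h e * I e + 2 * h e * J e))"
    by (intro sum.cong HOL.refl) (simp add: algebra_simps)
  also have "\<dots> = (\<Sum>e\<in>arcs G. \<kappa>\<^sub>0\<^sup>2 * I e + a\<^sub>0 * J e) - S * (\<Sum>e\<in>arcs G. 4 / h e * I e + 2 * h e * J e)"
    by (simp only: sum_subtractf sum_distrib_left)
  also have "\<dots> \<le> (\<Sum>k\<in>K. eig k * (c k)\<^sup>2)"
    using energy_identity[OF K, of c, folded u_def pc_def] 1 2 unfolding I_def J_def by linarith
  finally show ?thesis unfolding I_def J_def u_def .
qed

end

section \<open>Eigenvalue asymptotics\<close>

context operator_eigenbasis
begin

lemma min_len: "0 < Min (len ` arcs G)" "e \<in> arcs G \<Longrightarrow> Min (len ` arcs G) \<le> len e" "e \<in> arcs G \<Longrightarrow> len e \<le> Max (len ` arcs G)"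
proof -
  have "Min (len ` arcs G) \<in> len ` arcs G" using arcs_nonempty by (intro Min_in) auto
  then show "0 < Min (len ` arcs G)" using len_pos by auto
qed auto

text \<open>Taking \<open>h e = len e\<close> turns (A1) into exactly the two signs required: the
  first condition makes \<delta> positive, the second makes the derivative term nonnegative.\<close>

lemma eig_lower_bound:
  obtains \<delta> where "0 < \<delta>" "\<And>k. \<delta> \<le> eig k"
proof -
  obtain S where S: "0 \<le> S" "4 * S / Min (len ` arcs G) < \<kappa>\<^sub>0\<^sup>2" "2 * S * Max (len ` arcs G) \<le> a\<^sub>0"
    and S': "vertex_form_ge S"
    using vertex_constant by metis
  define \<delta> where "\<delta> = \<kappa>\<^sub>0\<^sup>2 - 4 * S / Min (len ` arcs G)"
  have "\<delta> \<le> eig k" for k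
  proof -
    define I where "I e = (LINT x|Leb (len e). (Ucomb {k} (\<lambda>_. 1) e x)\<^sup>2)" for e
    define J where "J e = (LINT x|Leb (len e). (wcomb {k} (\<lambda>_. 1) e x)\<^sup>2)" for e
    have nn: "0 \<le> I e" "0 \<le> J e" for e by (simp_all add: I_def J_def)
    have "\<delta> = \<delta> * (\<Sum>e\<in>arcs G. I e)" using norm_comb[of "{k}" "\<lambda>_. 1"] by (simp add: I_def)
    also have "\<dots> = (\<Sum>e\<in>arcs G. \<delta> * I e)" by (rule sum_distrib_left)
    also have "\<dots> \<le> (\<Sum>e\<in>arcs G. (\<kappa>\<^sub>0\<^sup>2 - 4 * S / len e) * I e + (a\<^sub>0 - 2 * S * len e) * J e)"
    proof (rule sum_mono)
      fix e assume e: "e \<in> arcs G"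
      have "4 * S / len e \<le> 4 * S / Min (len ` arcs G)"
        using S(1) min_len(1) min_len(2)[OF e] by (intro divide_left_mono) auto
      then have "\<delta> * I e \<le> (\<kappa>\<^sub>0\<^sup>2 - 4 * S / len e) * I e" unfolding \<delta>_def by (intro mult_right_mono nn) simp
      moreover have "2 * S * len e \<le> 2 * S * Max (len ` arcs G)"
        using S(1) min_len(3)[OF e] by (intro mult_left_mono) auto
      then have "0 \<le> (a\<^sub>0 - 2 * S * len e) * J e" using S(3) by (intro mult_nonneg_nonneg nn) simp
      ultimately show "\<delta> * I e \<le> (\<kappa>\<^sub>0\<^sup>2 - 4 * S / len e) * I e + (a\<^sub>0 - 2 * S * len e) * J e" by simp
    qed
    also have "\<dots> \<le> (\<Sum>k\<in>{k}. eig k * 1\<^sup>2)"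
      unfolding I_def J_def by (rule energy_lower_bound[OF _ S(1) S']) (auto simp: len_pos)
    finally show ?thesis by simp
  qed
  then show ?thesis using that[of \<delta>] S(2) by (simp add: \<delta>_def)
qed

lemma coercive:
  "\<exists>C\<ge>0. \<forall>K c. finite K \<longrightarrow>
    a\<^sub>0 / 2 * (\<Sum>e\<in>arcs G. LINT x|Leb (len e). (wcomb K c e x)\<^sup>2) \<le> (\<Sum>k\<in>K. eig k * (c k)\<^sup>2) + C * (\<Sum>k\<in>K. (c k)\<^sup>2)"
proof -
  obtain S where S: "0 \<le> S"
    and S': "vertex_form_ge S"
    using vertex_constant by metis
  \<comment> \<open>Small enough that the vertex terms consume at most half of the derivative
    energy: \<open>2 * S * h \<le> a\<^sub>0 / 2\<close>. The summand 1 covers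
    \<open>S = 0\<close>.\<close>
  define h where "h = min (Min (len ` arcs G)) (a\<^sub>0 / (4 * S + 1))"
  have h: "0 < h" "e \<in> arcs G \<Longrightarrow> h \<le> len e" for e
    using min_len a0_pos S by (auto simp: h_def min_le_iff_disj)
  have "2 * S * h \<le> 2 * S * (a\<^sub>0 / (4 * S + 1))" unfolding h_def using S by (intro mult_left_mono) auto
  also have "\<dots> \<le> a\<^sub>0 / 2" using S a0_pos by (simp add: field_simps)
  finally have Sh: "a\<^sub>0 / 2 \<le> a\<^sub>0 - 2 * S * h" by simp
  show ?thesis
  proof (intro exI[of _ "4 * S / h"] conjI allI impI)
    show "0 \<le> 4 * S / h" using S h by simp
    fix K :: "nat set" and c :: "nat \<Rightarrow> real" assume K: "finite K"
    define I where "I e = edge_sq e (Ucomb K c)" for e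
    define J where "J e = edge_sq e (wcomb K c)" for e
    have nn: "0 \<le> I e" "0 \<le> J e" for e by (simp_all add: I_def J_def)
    have "a\<^sub>0 / 2 * (\<Sum>e\<in>arcs G. J e) - 4 * S / h * (\<Sum>k\<in>K. (c k)\<^sup>2) = (\<Sum>e\<in>arcs G. (- (4 * S / h)) * I e + a\<^sub>0 / 2 * J e)"
      unfolding norm_comb[OF K, symmetric] I_def[symmetric] by (simp add: sum_distrib_left sum_subtractf)
    also have "\<dots> \<le> (\<Sum>e\<in>arcs G. (\<kappa>\<^sub>0\<^sup>2 - 4 * S / h) * I e + (a\<^sub>0 - 2 * S * h) * J e)"
      using Sh nn by (intro sum_mono add_mono mult_right_mono) auto
    also have "\<dots> \<le> (\<Sum>k\<in>K. eig k * (c k)\<^sup>2)"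
      unfolding I_def J_def by (rule energy_lower_bound[OF K S S']) (use h in auto)
    finally show "a\<^sub>0 / 2 * (\<Sum>e\<in>arcs G. LINT x|Leb (len e). (wcomb K c e x)\<^sup>2)
        \<le> (\<Sum>k\<in>K. eig k * (c k)\<^sup>2) + 4 * S / h * (\<Sum>k\<in>K. (c k)\<^sup>2)" by (simp add: J_def)
  qed
qed

text \<open>The point bound is quadratic in the coefficients. With coefficients
  \<open>U k e x\<close> the combination takes at \<open>x\<close> the value \<open>N\<close>, the
  sum of their squares, so that \<open>N * N \<le> C1 * sqrt \<Lambda> * N\<close> collapses to a
  bound on \<open>N\<close>. Every eigenfunction has norm 1, so integrating \<open>N\<close> over
  the graph returns the cardinality.\<close>

lemma eigenvalue_count:
  "\<exists>C\<ge>0. \<forall>\<Lambda> K. 1 \<le> \<Lambda> \<longrightarrow> finite K \<longrightarrow> (\<forall>k\<in>K. eig k \<le> \<Lambda>) \<longrightarrow> real (card K) \<le> C * sqrt \<Lambda>"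
proof -
  obtain C0 where C0: "0 \<le> C0" "\<And>K c. finite K \<Longrightarrow>
    a\<^sub>0 / 2 * (\<Sum>e\<in>arcs G. LINT x|Leb (len e). (wcomb K c e x)\<^sup>2) \<le> (\<Sum>k\<in>K. eig k * (c k)\<^sup>2) + C0 * (\<Sum>k\<in>K. (c k)\<^sup>2)"
    using coercive by blast
  define m where "m = Min (len ` arcs G)"
  have m: "0 < m" unfolding m_def by (rule min_len)
  \<comment> \<open>The two summands are the coefficients of \<open>sqrt \<Lambda>\<close> in
    \<open>2 / h\<close> and in \<open>h\<close> times the derivative bound, for
    \<open>h = m / (2 * sqrt \<Lambda>)\<close>.\<close>
  define C1 where "C1 = 4 / m + m * (1 + C0) / a\<^sub>0"
  have C1: "0 \<le> C1" using m C0 a0_pos by (simp add: C1_def)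
  have main: "real (card K) \<le> (C1 * (\<Sum>e\<in>arcs G. len e)) * sqrt \<Lambda>"
    if \<Lambda>: "1 \<le> \<Lambda>" and K: "finite K" and le: "\<And>k. k \<in> K \<Longrightarrow> eig k \<le> \<Lambda>" for \<Lambda> K
  proof -
    have s: "1 \<le> sqrt \<Lambda>" "sqrt \<Lambda> * sqrt \<Lambda> = \<Lambda>" using \<Lambda> by auto
    have point: "(Ucomb K c e x)\<^sup>2 \<le> C1 * sqrt \<Lambda> * (\<Sum>k\<in>K. (c k)\<^sup>2)" if e: "e \<in> arcs G" and x: "x \<in> {0..len e}" for c e x
    proof -
      define N where "N = (\<Sum>k\<in>K. (c k)\<^sup>2)"
      define I where "I e = edge_sq e (Ucomb K c)" for e
      define J where "J e = edge_sq e (wcomb K c)" for e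
      have nn: "0 \<le> I e" "0 \<le> J e" for e by (simp_all add: I_def J_def)
      have N0: "0 \<le> N" by (simp add: N_def sum_nonneg)
      have IN: "I e \<le> N"
        using member_le_sum[OF e, of I] nn norm_comb[OF K, of c] by (simp add: N_def I_def[abs_def])
      have "J e \<le> (\<Sum>e\<in>arcs G. J e)" by (rule member_le_sum[OF e]) (use nn in auto)
      moreover have "(\<Sum>k\<in>K. eig k * (c k)\<^sup>2) \<le> \<Lambda> * N"
        unfolding N_def sum_distrib_left by (intro sum_mono mult_right_mono le) auto
      ultimately have "a\<^sub>0 / 2 * J e \<le> \<Lambda> * N + C0 * N"
        using C0(2)[OF K, of c] mult_left_mono[of "J e" "\<Sum>e\<in>arcs G. J e" "a\<^sub>0 / 2"] a0_pos
        unfolding J_def N_def by linarith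
      \<comment> \<open>Here \<open>1 \<le> \<Lambda>\<close> absorbs the lower-order term.\<close>
      also have "\<dots> \<le> \<Lambda> * N + C0 * (\<Lambda> * N)"
        using \<Lambda> N0 C0(1) mult_right_mono[of 1 \<Lambda> N] by (intro add_left_mono mult_left_mono) auto
      finally have JN: "J e \<le> 2 / a\<^sub>0 * ((1 + C0) * \<Lambda> * N)" using a0_pos by (simp add: field_simps)
      have alg: "m / (2 * r) * (2 / a\<^sub>0 * ((1 + C0) * \<Lambda> * N)) = m * (1 + C0) / a\<^sub>0 * (\<Lambda> / r) * N" for r
        using a0_pos by (cases "r = 0") (auto simp: field_simps)
      \<comment> \<open>Order \<open>1 / sqrt \<Lambda>\<close> balances both terms of the trace
        inequality; the factor 1/2 keeps \<open>h\<close> below half of every edge, so an interval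
        of this length fits on one side of any \<open>x\<close>.\<close>
      define h where "h = m / (2 * sqrt \<Lambda>)"
      have h0: "0 < h" using m s by (simp add: h_def)
      have "m / (2 * sqrt \<Lambda>) \<le> m / (2 * 1)" using m s by (intro divide_left_mono) auto
      then have "h \<le> len e / 2" using min_len(2)[OF e] by (simp add: h_def m_def)
      then have hx: "h \<le> x \<or> x + h \<le> len e" by auto
      have "(Ucomb K c e x)\<^sup>2 \<le> 2 / h * I e + h * J e"
        unfolding I_def J_def by (rule trace_ineq[OF comb(1,2)[OF e] x h0 hx])
      also have "\<dots> \<le> 2 / h * N + h * (2 / a\<^sub>0 * ((1 + C0) * \<Lambda> * N))"
        using h0 by (intro add_mono mult_left_mono IN JN) auto
      also have "2 / h = 4 / m * sqrt \<Lambda>" using m s by (simp add: h_def)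
      also have "h * (2 / a\<^sub>0 * ((1 + C0) * \<Lambda> * N)) = m * (1 + C0) / a\<^sub>0 * (\<Lambda> / sqrt \<Lambda>) * N"
        unfolding h_def by (rule alg)
      also have "\<Lambda> / sqrt \<Lambda> = sqrt \<Lambda>" using s by (simp add: real_div_sqrt)
      finally show ?thesis unfolding C1_def N_def[symmetric] by (simp add: algebra_simps)
    qed
    have diag: "(\<Sum>k\<in>K. (U k e x)\<^sup>2) \<le> C1 * sqrt \<Lambda>" if e: "e \<in> arcs G" and x: "x \<in> {0..len e}" for e x
    proof -
      define N where "N = (\<Sum>k\<in>K. (U k e x)\<^sup>2)"
      have "Ucomb K (\<lambda>k. U k e x) e x = N" by (simp add: Ucomb_def N_def power2_eq_square)
      then have "N * N \<le> C1 * sqrt \<Lambda> * N"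
        using point[OF e x, of "\<lambda>k. U k e x"] by (simp add: N_def power2_eq_square)
      moreover have "0 \<le> N" by (simp add: N_def sum_nonneg)
      ultimately show ?thesis using C1 s unfolding N_def[symmetric]
        by (cases "N = 0") (auto simp: mult_le_cancel_right)
    qed
    have Usq: "integrable (Leb (len e)) (\<lambda>x. (U k e x)\<^sup>2)" if e: "e \<in> arcs G" for k e
      using sq_integrable_continuous[OF prim_on_continuous[OF eigenfunction(4)[OF e]]] by (simp add: sq_integrable_def)
    have one: "(\<Sum>e\<in>arcs G. LINT x|Leb (len e). (U k e x)\<^sup>2) = 1" for k
      using norm_comb[of "{k}" "\<lambda>_. 1"] by (simp add: Ucomb_def)
    have "real (card K) = (\<Sum>k\<in>K. \<Sum>e\<in>arcs G. LINT x|Leb (len e). (U k e x)\<^sup>2)" by (simp add: one)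
    also have "\<dots> = (\<Sum>e\<in>arcs G. \<Sum>k\<in>K. LINT x|Leb (len e). (U k e x)\<^sup>2)" by (rule sum.swap)
    also have "\<dots> \<le> (\<Sum>e\<in>arcs G. C1 * sqrt \<Lambda> * len e)"
    proof (rule sum_mono)
      fix e assume e: "e \<in> arcs G"
      have "(\<Sum>k\<in>K. LINT x|Leb (len e). (U k e x)\<^sup>2) = (LINT x|Leb (len e). (\<Sum>k\<in>K. (U k e x)\<^sup>2))"
        using Usq[OF e] by (intro Bochner_Integration.integral_sum[symmetric]) auto
      also have "\<dots> \<le> (LINT x|Leb (len e). C1 * sqrt \<Lambda>)"
      proof (rule integral_mono)
        show "integrable (Leb (len e)) (\<lambda>x. \<Sum>k\<in>K. (U k e x)\<^sup>2)"
          using Usq[OF e] by (intro Bochner_Integration.integrable_sum) auto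
      qed (use diag[OF e] finite_measure.integrable_const[OF finite_measure_Leb] in auto)
      also have "\<dots> = C1 * sqrt \<Lambda> * len e"
        using measure_Leb[of "len e"] len_pos[OF e] by (simp add: mult.commute)
      finally show "(\<Sum>k\<in>K. LINT x|Leb (len e). (U k e x)\<^sup>2) \<le> C1 * sqrt \<Lambda> * len e" .
    qed
    also have "\<dots> = (C1 * (\<Sum>e\<in>arcs G. len e)) * sqrt \<Lambda>" by (simp add: sum_distrib_left ac_simps)
    finally show ?thesis .
  qed
  show ?thesis
    by (rule exI[of _ "C1 * (\<Sum>e\<in>arcs G. len e)"])
      (use C1 main len_pos in \<open>auto intro!: mult_nonneg_nonneg sum_nonneg intro: less_imp_le\<close>)
qed

end

text \<open>Sort the eigenvalues into blocks by powers of 4. Block \<open>j\<close> has at most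
  \<open>C * 2 ^ j\<close> members, each contributing at most \<open>D * (4 powr - t) ^ j\<close>,
  so the sum is dominated by a geometric series of ratio \<open>2 * 4 powr - t\<close>, which is
  below 1 exactly for \<open>t > 1/2\<close>.\<close>

lemma summable_powr_of_count:
  fixes eig :: "nat \<Rightarrow> real"
  assumes \<delta>: "0 < \<delta>" "\<And>k. \<delta> \<le> eig k"
    and count: "\<And>\<Lambda> K. 1 \<le> \<Lambda> \<Longrightarrow> finite K \<Longrightarrow> (\<And>k. k \<in> K \<Longrightarrow> eig k \<le> \<Lambda>) \<Longrightarrow> real (card K) \<le> C * sqrt \<Lambda>"
    and C: "0 \<le> C" and t: "1/2 < t"
  shows "summable (\<lambda>k. eig k powr - t)"
proof -
  \<comment> \<open>Truncation by \<open>nat\<close> collects all eigenvalues up to 1 in block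
    0.\<close>
  define m where "m k = nat \<lceil>log 4 (eig k)\<rceil>" for k
  \<comment> \<open>The first entry serves block 0, where only the lower bound \<delta> is
    available; the second pays for rounding the logarithm up.\<close>
  define D where "D = max (\<delta> powr - t) (4 powr t)"
  define q where "q = 2 * 4 powr - t"
  have q: "0 \<le> q" "q < 1"
  proof -
    have "4 powr - t < (4::real) powr - (1/2)" using t by simp
    also have "\<dots> = 1 / 2" by (simp add: powr_minus powr_half_sqrt)
    finally show "q < 1" by (simp add: q_def)
  qed (simp add: q_def)
  have pos: "0 < eig k" for k using \<delta>(1) \<delta>(2)[of k] by simp
  have up: "eig k \<le> 4 ^ m k" for k
  proof -
    have "eig k = 4 powr (log 4 (eig k))" using pos[of k] by simp
    also have "\<dots> \<le> 4 powr (real (m k))" unfolding m_def by (intro powr_mono) (linarith, simp)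
    finally show ?thesis by (simp add: powr_realpow)
  qed
  have term_le: "eig k powr - t \<le> D * (4 powr - t) ^ m k" for k
  proof (cases "m k = 0")
    case True
    have "eig k powr - t \<le> \<delta> powr - t" using \<delta> t by (intro powr_mono2') auto
    then show ?thesis using True by (simp add: D_def)
  next
    case False
    then have "real (m k) - 1 \<le> log 4 (eig k)" unfolding m_def by linarith
    then have "4 powr (real (m k) - 1) \<le> 4 powr (log 4 (eig k))" by simp
    then have "4 powr (real (m k) - 1) \<le> eig k" using pos[of k] by simp
    then have "eig k powr - t \<le> (4 powr (real (m k) - 1)) powr - t" using t by (intro powr_mono2') auto
    also have "\<dots> = 4 powr t * (4 powr - t) powr (real (m k))"
      by (simp add: powr_powr powr_add[symmetric] algebra_simps)
    also have "\<dots> = 4 powr t * (4 powr - t) ^ m k" by (simp add: powr_realpow)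
    also have "\<dots> \<le> D * (4 powr - t) ^ m k" by (intro mult_right_mono) (auto simp: D_def)
    finally show ?thesis .
  qed
  have D: "0 \<le> D" by (simp add: D_def le_max_iff_disj)
  have bound: "(\<Sum>k\<in>K. eig k powr - t) \<le> C * D / (1 - q)" if K: "finite K" for K
  proof -
    have "(\<Sum>k\<in>K. eig k powr - t) \<le> (\<Sum>k\<in>K. D * (4 powr - t) ^ m k)" by (intro sum_mono term_le)
    also have "\<dots> = (\<Sum>j\<in>m ` K. \<Sum>k\<in>{k\<in>K. m k = j}. D * (4 powr - t) ^ m k)" by (rule sum.image_gen[OF K])
    also have "\<dots> \<le> (\<Sum>j\<in>m ` K. C * D * q ^ j)"
    proof (rule sum_mono)
      fix j assume "j \<in> m ` K"
      have "(\<Sum>k\<in>{k\<in>K. m k = j}. D * (4 powr - t) ^ m k) = real (card {k\<in>K. m k = j}) * (D * (4 powr - t) ^ j)" by simp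
      also have "\<dots> \<le> (C * sqrt (4 ^ j)) * (D * (4 powr - t) ^ j)"
      proof (rule mult_right_mono)
        show "real (card {k\<in>K. m k = j}) \<le> C * sqrt (4 ^ j)"
          by (rule count) (use K up in auto)
      qed (use D in simp)
      also have "sqrt (4 ^ j) = 2 ^ j" by (simp add: real_sqrt_power)
      finally show "(\<Sum>k\<in>{k\<in>K. m k = j}. D * (4 powr - t) ^ m k) \<le> C * D * q ^ j"
        by (simp add: q_def power_mult_distrib ac_simps)
    qed
    also have "\<dots> = C * D * (\<Sum>j\<in>m ` K. q ^ j)" by (rule sum_distrib_left[symmetric])
    also have "\<dots> \<le> C * D * (\<Sum>j. q ^ j)"
      using K q C D by (intro mult_left_mono sum_le_suminf) (auto intro!: summable_geometric)
    also have "(\<Sum>j. q ^ j) = 1 / (1 - q)" using q by (intro suminf_geometric) simp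
    finally show ?thesis by simp
  qed
  show ?thesis by (rule summableI_nonneg_bounded[of _ "C * D / (1 - q)"]) (use bound in auto)
qed

lemma (in operator_eigenbasis) summable_eig_powr:
  assumes "1/2 < t" shows "summable (\<lambda>k. eig k powr - t)"
proof -
  obtain \<delta> where \<delta>: "0 < \<delta>" "\<And>k. \<delta> \<le> eig k" using eig_lower_bound by metis
  obtain C where C: "0 \<le> C" "\<forall>\<Lambda> K. 1 \<le> \<Lambda> \<longrightarrow> finite K \<longrightarrow> (\<forall>k\<in>K. eig k \<le> \<Lambda>) \<longrightarrow> real (card K) \<le> C * sqrt \<Lambda>"
    using eigenvalue_count by (elim exE conjE)
  show ?thesis
    by (rule summable_powr_of_count[OF \<delta> _ C(1) assms]) (use C(2) in simp)
qed

section \<open>Measurability and completeness\<close>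

lemma summable_iff_ennreal:
  fixes f :: "nat \<Rightarrow> real"
  assumes "\<And>k. 0 \<le> f k"
  shows "summable f \<longleftrightarrow> (\<Sum>k. ennreal (f k)) \<noteq> \<top>"
  using assms summable_suminf_not_top[of f] ennreal_suminf_neq_top[of f] by blast

text \<open>For nonnegative terms, summability is finiteness of an \<open>ennreal\<close> series,
  which is itself a measurable function.\<close>

lemma pred_summable:
  fixes f :: "nat \<Rightarrow> 'a \<Rightarrow> real"
  assumes [measurable]: "\<And>k. f k \<in> borel_measurable M" and "\<And>k x. 0 \<le> f k x"
  shows "Measurable.pred M (\<lambda>x. summable (\<lambda>k. f k x))"
  unfolding summable_iff_ennreal[OF assms(2)] by measurable

text \<open>The elementary bound \<open>(x - y)\<^sup>2 \<le> 2 * x\<^sup>2 + 2 * y\<^sup>2\<close>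
  serves as a triangle inequality for squared weighted norms.\<close>

lemma weighted_square_diff_summable:
  fixes wt x y :: "nat \<Rightarrow> real"
  assumes wt: "\<And>k. 0 \<le> wt k" and x: "summable (\<lambda>k. wt k * (x k)\<^sup>2)" and y: "summable (\<lambda>k. wt k * (y k)\<^sup>2)"
  shows "summable (\<lambda>k. wt k * (x k - y k)\<^sup>2)"
    and "(\<Sum>k. wt k * (x k - y k)\<^sup>2) \<le> 2 * (\<Sum>k. wt k * (x k)\<^sup>2) + 2 * (\<Sum>k. wt k * (y k)\<^sup>2)"
proof -
  have le: "wt k * (x k - y k)\<^sup>2 \<le> 2 * (wt k * (x k)\<^sup>2) + 2 * (wt k * (y k)\<^sup>2)" for k
  proof -
    have "(x k - y k)\<^sup>2 + (x k + y k)\<^sup>2 = 2 * (x k)\<^sup>2 + 2 * (y k)\<^sup>2" by (simp add: power2_eq_square algebra_simps)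
    then have "(x k - y k)\<^sup>2 \<le> 2 * (x k)\<^sup>2 + 2 * (y k)\<^sup>2" by (smt (verit) zero_le_power2)
    then have "wt k * (x k - y k)\<^sup>2 \<le> wt k * (2 * (x k)\<^sup>2 + 2 * (y k)\<^sup>2)" by (intro mult_left_mono wt)
    then show ?thesis by (simp add: algebra_simps)
  qed
  have s: "summable (\<lambda>k. 2 * (wt k * (x k)\<^sup>2) + 2 * (wt k * (y k)\<^sup>2))"
    using x y by (intro summable_add summable_mult)
  show 1: "summable (\<lambda>k. wt k * (x k - y k)\<^sup>2)"
    by (rule summable_comparison_test'[OF s, of 0]) (use le wt in simp)
  have "(\<Sum>k. wt k * (x k - y k)\<^sup>2) \<le> (\<Sum>k. 2 * (wt k * (x k)\<^sup>2) + 2 * (wt k * (y k)\<^sup>2))"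
    by (rule suminf_le[OF le 1 s])
  also have "\<dots> = 2 * (\<Sum>k. wt k * (x k)\<^sup>2) + 2 * (\<Sum>k. wt k * (y k)\<^sup>2)"
    using x y by (simp add: suminf_add[symmetric] suminf_mult summable_mult)
  finally show "(\<Sum>k. wt k * (x k - y k)\<^sup>2) \<le> 2 * (\<Sum>k. wt k * (x k)\<^sup>2) + 2 * (\<Sum>k. wt k * (y k)\<^sup>2)" .
qed

text \<open>Finitely supported rational sequences, indexed by lists so that countability is
  immediate; they are dense in every weighted square-summable sequence space.\<close>

definition rat_seq :: "rat list \<Rightarrow> nat \<Rightarrow> real" where
  "rat_seq qs k = (if k < length qs then of_rat (qs ! k) else 0)"

lemma rat_seq_approx:
  fixes wt x :: "nat \<Rightarrow> real"
  assumes wt: "\<And>k. 0 \<le> wt k" and x: "summable (\<lambda>k. wt k * (x k)\<^sup>2)" and \<eta>: "0 < \<eta>"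
  obtains qs where "(\<Sum>k. wt k * (x k - rat_seq qs k)\<^sup>2) < \<eta>"
proof -
  obtain n where n: "\<bar>\<Sum>k. wt (k + n) * (x (k + n))\<^sup>2\<bar> < \<eta> / 2"
    using suminf_exist_split[OF _ x, of "\<eta> / 2"] \<eta> by auto
  \<comment> \<open>Each of the first \<open>n\<close> coordinates may cost at most
    \<open>\<eta> / (2 * (n + 1))\<close> after weighting, so together they stay within half of
    \<eta>, the tail taking the other half; the added ones avoid division by zero.\<close>
  define \<rho> where "\<rho> k = sqrt (\<eta> / (2 * (real n + 1) * (wt k + 1)))" for k
  have \<rho>: "0 < \<rho> k" for k using \<eta> wt[of k] by (simp add: \<rho>_def add_nonneg_pos)
  have "\<exists>q. x k - \<rho> k < real_of_rat q \<and> real_of_rat q < x k + \<rho> k" for k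
    using of_rat_dense[of "x k - \<rho> k" "x k + \<rho> k"] \<rho>[of k] by simp
  then obtain q where q: "\<And>k. x k - \<rho> k < real_of_rat (q k)" "\<And>k. real_of_rat (q k) < x k + \<rho> k" by metis
  have term_le: "wt k * (x k - of_rat (q k))\<^sup>2 \<le> \<eta> / (2 * (real n + 1))" for k
  proof -
    have "\<bar>x k - of_rat (q k)\<bar> \<le> \<rho> k" using q[of k] by linarith
    then have "(x k - of_rat (q k))\<^sup>2 \<le> (\<rho> k)\<^sup>2" using \<rho>[of k] by (simp add: abs_le_square_iff[symmetric])
    also have "(\<rho> k)\<^sup>2 = \<eta> / (2 * (real n + 1) * (wt k + 1))" using \<eta> wt[of k] by (simp add: \<rho>_def)
    finally have "wt k * (x k - of_rat (q k))\<^sup>2 \<le> wt k * (\<eta> / (2 * (real n + 1) * (wt k + 1)))"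
      by (rule mult_left_mono) (rule wt)
    also have "\<dots> = (wt k / (wt k + 1)) * (\<eta> / (2 * (real n + 1)))" using wt[of k] by (simp add: field_simps)
    also have "\<dots> \<le> 1 * (\<eta> / (2 * (real n + 1)))" using wt[of k] \<eta> by (intro mult_right_mono) (auto simp: field_simps)
    finally show ?thesis by simp
  qed
  define qs where "qs = map q [0..<n]"
  have r: "rat_seq qs k = (if k < n then of_rat (q k) else 0)" for k by (simp add: rat_seq_def qs_def)
  have s: "summable (\<lambda>k. wt k * (x k - rat_seq qs k)\<^sup>2)"
  proof (rule weighted_square_diff_summable(1)[OF wt x])
    show "summable (\<lambda>k. wt k * (rat_seq qs k)\<^sup>2)"
      by (rule summable_finite[of "{..<n}"]) (auto simp: r)
  qed
  have "(\<Sum>k. wt k * (x k - rat_seq qs k)\<^sup>2)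
    = (\<Sum>k. wt (k + n) * (x (k + n) - rat_seq qs (k + n))\<^sup>2) + (\<Sum>k<n. wt k * (x k - rat_seq qs k)\<^sup>2)"
    by (rule suminf_split_initial_segment[OF s])
  also have "(\<Sum>k<n. wt k * (x k - rat_seq qs k)\<^sup>2) \<le> (\<Sum>k<n. \<eta> / (2 * (real n + 1)))"
    by (rule sum_mono) (use term_le in \<open>simp add: r\<close>)
  also have "\<dots> \<le> \<eta> / 2" using \<eta> by (simp add: field_simps)
  also have "(\<Sum>k. wt (k + n) * (x (k + n) - rat_seq qs (k + n))\<^sup>2) = (\<Sum>k. wt (k + n) * (x (k + n))\<^sup>2)" by (simp add: r)
  finally have "(\<Sum>k. wt k * (x k - rat_seq qs k)\<^sup>2) < \<eta>" using n by linarith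
  then show ?thesis by (rule that)
qed

text \<open>A random element of a weighted sequence space is measurable as soon as its coordinates are:
  the space is separable, and distances to fixed points are series in the coordinates.\<close>

lemma measurable_norm_borel:
  fixes X :: "('b::minus) set" and coef :: "'b \<Rightarrow> nat \<Rightarrow> real"
  assumes wt: "\<And>k. 0 \<le> wt k"
    and sm: "\<And>x. x \<in> X \<Longrightarrow> summable (\<lambda>k. wt k * (coef x k)\<^sup>2)"
    and N: "\<And>x y. x \<in> X \<Longrightarrow> y \<in> X \<Longrightarrow> N (x - y) = sqrt (\<Sum>k. wt k * (coef x k - coef y k)\<^sup>2)"
    and dense: "\<And>qs. \<exists>y\<in>X. \<forall>k. coef y k = rat_seq qs k"
    and Z: "Z \<in> space M \<rightarrow> X" and meas[measurable]: "\<And>k. (\<lambda>\<omega>. coef (Z \<omega>) k) \<in> borel_measurable M"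
  shows "Z \<in> measurable M (norm_borel X N)"
  unfolding norm_borel_def
proof (rule measurable_measure_of)
  obtain y where y: "\<And>qs. y qs \<in> X" "\<And>qs k. coef (y qs) k = rat_seq qs k" using dense by metis
  fix V assume "V \<in> {V. V \<subseteq> X \<and> (\<forall>u\<in>V. \<exists>r>0. \<forall>w\<in>X. N (w - u) < r \<longrightarrow> w \<in> V)}"
  then have V: "V \<subseteq> X" "\<And>u. u \<in> V \<Longrightarrow> \<exists>r>0. \<forall>w\<in>X. N (w - u) < r \<longrightarrow> w \<in> V" by auto
  \<comment> \<open>Balls around the dense set that fit into \<open>V\<close>. They cover all of
    \<open>V\<close>, so the preimage of \<open>V\<close> is a countable union of measurable
    sets.\<close>
  define P where "P = {(qs, m::nat). \<forall>w\<in>X. N (w - y qs) < 1 / real (Suc m) \<longrightarrow> w \<in> V}"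
  have "Z -` V \<inter> space M = (\<Union>(qs, m)\<in>P. {\<omega>\<in>space M. N (Z \<omega> - y qs) < 1 / real (Suc m)})"
  proof (intro equalityI subsetI)
    fix \<omega> assume \<omega>: "\<omega> \<in> Z -` V \<inter> space M"
    then obtain r where r: "0 < r" "\<And>w. w \<in> X \<Longrightarrow> N (w - Z \<omega>) < r \<Longrightarrow> w \<in> V" using V(2)[of "Z \<omega>"] by auto
    have ZX: "Z \<omega> \<in> X" using \<omega> V(1) by auto
    obtain m where "2 / r < real m" using reals_Archimedean2 by blast
    \<comment> \<open>A ball of radius \<open>1 / Suc m\<close> that contains
      \<open>Z \<omega>\<close> stays within \<open>2 / Suc m\<close> of it, hence inside
      \<open>V\<close>.\<close>
    then have m: "2 / real (Suc m) < r" using r(1) by (simp add: field_simps)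
    define \<eta> where "\<eta> = (1 / real (Suc m))\<^sup>2"
    obtain qs where qs: "(\<Sum>k. wt k * (coef (Z \<omega>) k - rat_seq qs k)\<^sup>2) < \<eta>"
      by (rule rat_seq_approx[OF wt sm[OF ZX], of \<eta>]) (auto simp: \<eta>_def)
    have "N (Z \<omega> - y qs) < sqrt \<eta>"
      unfolding N[OF ZX y(1)] y(2) using qs by (rule real_sqrt_less_mono)
    then have near: "N (Z \<omega> - y qs) < 1 / real (Suc m)" by (simp add: \<eta>_def)
    have "(qs, m) \<in> P" unfolding P_def
    proof (clarify)
      fix w assume w: "w \<in> X" "N (w - y qs) < 1 / real (Suc m)"
      have sd: "summable (\<lambda>k. wt k * (coef v k - rat_seq qs k)\<^sup>2)" if "v \<in> X" for v
        using weighted_square_diff_summable(1)[OF wt sm[OF that] sm[OF y(1)[of qs]]] by (simp add: y)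
      have "(\<Sum>k. wt k * (coef w k - rat_seq qs k)\<^sup>2) < \<eta>"
      proof -
        have "sqrt (\<Sum>k. wt k * (coef w k - rat_seq qs k)\<^sup>2) < sqrt \<eta>"
          using w(2) N[OF w(1) y(1)[of qs]] by (simp add: y(2) \<eta>_def)
        then show ?thesis by simp
      qed
      then have "2 * (\<Sum>k. wt k * (coef w k - rat_seq qs k)\<^sup>2) + 2 * (\<Sum>k. wt k * (coef (Z \<omega>) k - rat_seq qs k)\<^sup>2) < 4 * \<eta>"
        using qs by linarith
      moreover have "(\<Sum>k. wt k * (coef w k - coef (Z \<omega>) k)\<^sup>2)
        \<le> 2 * (\<Sum>k. wt k * (coef w k - rat_seq qs k)\<^sup>2) + 2 * (\<Sum>k. wt k * (coef (Z \<omega>) k - rat_seq qs k)\<^sup>2)"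
        using weighted_square_diff_summable(2)[OF wt sd[OF w(1)] sd[OF ZX]] by simp
      ultimately have "N (w - Z \<omega>) < sqrt (4 * \<eta>)"
        unfolding N[OF w(1) ZX] by (intro real_sqrt_less_mono) linarith
      also have "sqrt (4 * \<eta>) = 2 / real (Suc m)" by (simp add: \<eta>_def real_sqrt_mult)
      finally show "w \<in> V" using r(2)[OF w(1)] m by linarith
    qed
    then show "\<omega> \<in> (\<Union>(qs, m)\<in>P. {\<omega>\<in>space M. N (Z \<omega> - y qs) < 1 / real (Suc m)})" using near \<omega> by blast
  next
    fix \<omega> assume "\<omega> \<in> (\<Union>(qs, m)\<in>P. {\<omega>\<in>space M. N (Z \<omega> - y qs) < 1 / real (Suc m)})"
    then obtain qs m where *: "(qs, m) \<in> P" "\<omega> \<in> space M" "N (Z \<omega> - y qs) < 1 / real (Suc m)" by blast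
    have "Z \<omega> \<in> X" using Z *(2) by auto
    then show "\<omega> \<in> Z -` V \<inter> space M" using * unfolding P_def by blast
  qed
  also have "\<dots> \<in> sets M"
  proof (rule sets.countable_UN'')
    show "countable P" by auto
    fix p assume "p \<in> P"
    obtain qs m where p: "p = (qs, m)" by force
    have "{\<omega>\<in>space M. N (Z \<omega> - y qs) < 1 / real (Suc m)}
        = {\<omega>\<in>space M. sqrt (\<Sum>k. wt k * (coef (Z \<omega>) k - rat_seq qs k)\<^sup>2) < 1 / real (Suc m)}"
      using N[OF _ y(1)] Z y(2) by (auto simp: Pi_iff)
    also have "\<dots> \<in> sets M" by measurable
    finally show "(case p of (qs, m) \<Rightarrow> {\<omega>\<in>space M. N (Z \<omega> - y qs) < 1 / real (Suc m)}) \<in> sets M" by (simp add: p)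
  qed
  finally show "Z -` V \<inter> space M \<in> sets M" .
qed (use Z in auto)

section \<open>Completeness of the square integrable functions\<close>

lemma sq_integrable_diff:
  "sq_integrable l u \<Longrightarrow> sq_integrable l v \<Longrightarrow> sq_integrable l (\<lambda>x. u x - v x)"
  using sq_integrable_add[OF _ sq_integrable_cmult, of l u v "-1"] by simp

text \<open>On a bounded interval a Cauchy sequence in the mean square is Cauchy in the mean, so a
  subsequence converges almost everywhere. Fatou along this subsequence, with the other index fixed,
  carries the Cauchy bound over to the limit and so yields convergence of the full sequence.\<close>

lemma sq_integrable_complete:
  assumes f: "\<And>n. sq_integrable l (f n)" and l: "0 < l"
    and cauchy: "\<And>e. 0 < e \<Longrightarrow> \<exists>N. \<forall>i\<ge>N. \<forall>j\<ge>N. (LINT x|Leb l. (f i x - f j x)\<^sup>2) < e"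
  shows "\<exists>g. sq_integrable l g \<and> (\<lambda>n. LINT x|Leb l. (f n x - g x)\<^sup>2) \<longlonglongrightarrow> 0"
proof -
  have fm[measurable]: "f n \<in> borel_measurable (Leb l)" for n using f[of n] by (simp add: sq_integrable_def)
  have d2: "integrable (Leb l) (\<lambda>x. (f i x - f j x)\<^sup>2)" for i j
    using sq_integrable_diff[OF f[of i] f[of j]] by (simp add: sq_integrable_def)
  have L1: "(LINT x|Leb l. \<bar>f i x - f j x\<bar>)\<^sup>2 \<le> (LINT x|Leb l. (f i x - f j x)\<^sup>2) * l" for i j
  proof -
    have "(LINT x|Leb l. \<bar>f i x - f j x\<bar> * 1)\<^sup>2 \<le> (LINT x|Leb l. \<bar>f i x - f j x\<bar>\<^sup>2) * (LINT x|Leb l. 1\<^sup>2)"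
      by (rule integral_Cauchy_Schwarz)
        (use d2[of i j] sq_integrable_integrable[OF sq_integrable_diff[OF f[of i] f[of j]]]
          finite_measure.integrable_const[OF finite_measure_Leb] in auto)
    then show ?thesis using measure_Leb[of l] l by simp
  qed
  obtain r where r: "strict_mono r" "AE x in Leb l. Cauchy (\<lambda>i. f (r i) x)"
  proof (rule cauchy_L1_AE_cauchy_subseq[of "Leb l" f])
    show "integrable (Leb l) (f n)" for n by (rule sq_integrable_integrable[OF f])
    fix e :: real assume e: "0 < e"
    obtain N where N: "\<And>i j. N \<le> i \<Longrightarrow> N \<le> j \<Longrightarrow> (LINT x|Leb l. (f i x - f j x)\<^sup>2) < e\<^sup>2 / l"
      using cauchy[of "e\<^sup>2 / l"] e l by auto
    show "\<exists>N. \<forall>i\<ge>N. \<forall>j\<ge>N. (LINT x|Leb l. norm (f i x - f j x)) < e"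
    proof (intro exI[of _ N] allI impI)
      fix i j assume "N \<le> i" "N \<le> j"
      then have "(LINT x|Leb l. (f i x - f j x)\<^sup>2) * l < e\<^sup>2" using N[of i j] l by (simp add: field_simps)
      then have "(LINT x|Leb l. \<bar>f i x - f j x\<bar>)\<^sup>2 < e\<^sup>2" using L1[of i j] by linarith
      then have "(LINT x|Leb l. \<bar>f i x - f j x\<bar>) < e" by (rule power_less_imp_less_base) (use e in simp)
      then show "(LINT x|Leb l. norm (f i x - f j x)) < e" by simp
    qed
  qed
  define g where "g x = lim (\<lambda>i. f (r i) x)" for x
  have gm[measurable]: "g \<in> borel_measurable (Leb l)"
    unfolding g_def by (rule borel_measurable_lim_metric) measurable
  have lim: "AE x in Leb l. (\<lambda>i. f (r i) x) \<longlonglongrightarrow> g x"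
    using r(2) by eventually_elim (simp add: g_def Cauchy_convergent_iff convergent_LIMSEQ_iff)
  have fatou: "(\<integral>\<^sup>+x. ennreal ((f n x - g x)\<^sup>2) \<partial>Leb l) \<le> ennreal e"
    if N: "\<And>i. N \<le> i \<Longrightarrow> (LINT x|Leb l. (f n x - f i x)\<^sup>2) \<le> e" for n N e
  proof -
    have "(\<integral>\<^sup>+x. ennreal ((f n x - g x)\<^sup>2) \<partial>Leb l) = (\<integral>\<^sup>+x. liminf (\<lambda>i. ennreal ((f n x - f (r i) x)\<^sup>2)) \<partial>Leb l)"
    proof (rule nn_integral_cong_AE)
      show "AE x in Leb l. ennreal ((f n x - g x)\<^sup>2) = liminf (\<lambda>i. ennreal ((f n x - f (r i) x)\<^sup>2))"
        using lim
      proof eventually_elim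
        case (elim x)
        then have "(\<lambda>i. ennreal ((f n x - f (r i) x)\<^sup>2)) \<longlonglongrightarrow> ennreal ((f n x - g x)\<^sup>2)" by (intro tendsto_intros)
        then show ?case by (intro lim_imp_Liminf[symmetric]) auto
      qed
    qed
    also have "\<dots> \<le> liminf (\<lambda>i. \<integral>\<^sup>+x. ennreal ((f n x - f (r i) x)\<^sup>2) \<partial>Leb l)"
      by (rule nn_integral_liminf) measurable
    also have "\<dots> \<le> limsup (\<lambda>i. \<integral>\<^sup>+x. ennreal ((f n x - f (r i) x)\<^sup>2) \<partial>Leb l)" by (rule Liminf_le_Limsup) simp
    also have "\<dots> \<le> ennreal e"
    proof (rule Limsup_bounded)
      show "\<forall>\<^sub>F i in sequentially. (\<integral>\<^sup>+x. ennreal ((f n x - f (r i) x)\<^sup>2) \<partial>Leb l) \<le> ennreal e"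
        using eventually_ge_at_top[of N]
      proof eventually_elim
        case (elim i)
        then have "N \<le> r i" using seq_suble[OF r(1), of i] by simp
        then show ?case using N d2[of n "r i"] by (subst nn_integral_eq_integral) (auto intro: ennreal_leI)
      qed
    qed
    finally show ?thesis .
  qed
  have sqd: "sq_integrable l (\<lambda>x. f n x - g x) \<and> (LINT x|Leb l. (f n x - g x)\<^sup>2) \<le> e"
    if N: "\<And>i. N \<le> i \<Longrightarrow> (LINT x|Leb l. (f n x - f i x)\<^sup>2) \<le> e" and e: "0 \<le> e" for n N e
  proof -
    have i: "integrable (Leb l) (\<lambda>x. (f n x - g x)\<^sup>2)"
    proof (rule integrableI_bounded)
      show "(\<integral>\<^sup>+x. ennreal (norm ((f n x - g x)\<^sup>2)) \<partial>Leb l) < \<infinity>"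
        using le_less_trans[OF fatou[of N n e, OF N] ennreal_less_top] by simp
    qed measurable
    have "ennreal (LINT x|Leb l. (f n x - g x)\<^sup>2) \<le> ennreal e"
      using fatou[of N n e, OF N] i by (subst nn_integral_eq_integral[symmetric]) auto
    then show ?thesis using i e by (simp add: sq_integrable_def)
  qed
  have "sq_integrable l g"
  proof -
    obtain N where N: "\<And>i j. N \<le> i \<Longrightarrow> N \<le> j \<Longrightarrow> (LINT x|Leb l. (f i x - f j x)\<^sup>2) < 1"
      using cauchy[of 1] by auto
    have "sq_integrable l (\<lambda>x. f N x - g x)" using sqd[of N N 1] N[of N] by (simp add: less_imp_le)
    from sq_integrable_diff[OF f[of N] this] show ?thesis by simp
  qed
  moreover have "(\<lambda>n. LINT x|Leb l. (f n x - g x)\<^sup>2) \<longlonglongrightarrow> 0"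
  proof (rule LIMSEQ_I)
    fix e :: real assume e: "0 < e"
    obtain N where N: "\<And>i j. N \<le> i \<Longrightarrow> N \<le> j \<Longrightarrow> (LINT x|Leb l. (f i x - f j x)\<^sup>2) < e / 2"
      using cauchy[of "e / 2"] e by auto
    have "(LINT x|Leb l. (f n x - g x)\<^sup>2) \<le> e / 2" if "N \<le> n" for n
      using sqd[of N n "e / 2"] N[of n] that e by (simp add: less_imp_le)
    then show "\<exists>N. \<forall>n\<ge>N. norm ((LINT x|Leb l. (f n x - g x)\<^sup>2) - 0) < e"
      using e by (intro exI[of _ N]) fastforce
  qed
  ultimately show ?thesis by blast
qed

context operator_eigenbasis
begin

section \<open>Parseval and Riesz-Fischer for the eigenbasis\<close>

lemma L2_graphD: "u \<in> L2_graph G len \<Longrightarrow> e \<in> arcs G \<Longrightarrow> sq_integrable (len e) (u e)"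
  by (simp add: L2_graph_def)

lemma psi_L2: "\<psi> k \<in> L2_graph G len"
  by (simp add: L2_graph_def eigenfunction(1))

lemma diff_L2:
  assumes "u \<in> L2_graph G len" "v \<in> L2_graph G len" shows "u - v \<in> L2_graph G len"
proof -
  have "(u - v) e = (\<lambda>x. u e x - v e x)" for e by (simp add: fun_eq_iff)
  then show ?thesis using assms sq_integrable_diff by (auto simp: L2_graph_def)
qed

lemma L2_inner_diff:
  assumes "u \<in> L2_graph G len" "v \<in> L2_graph G len" "f \<in> L2_graph G len"
  shows "L2_inner G len (u - v) f = L2_inner G len u f - L2_inner G len v f"
proof -
  have "(LINT x|Leb (len e). (u - v) e x * f e x) = (LINT x|Leb (len e). u e x * f e x) - (LINT x|Leb (len e). v e x * f e x)"
    if e: "e \<in> arcs G" for e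
    using sq_integrable_mult[OF L2_graphD[OF assms(1) e] L2_graphD[OF assms(3) e]]
      sq_integrable_mult[OF L2_graphD[OF assms(2) e] L2_graphD[OF assms(3) e]]
    by (simp add: left_diff_distrib)
  then show ?thesis by (simp add: L2_inner_def sum_subtractf)
qed

text \<open>The squared distance from \<open>u\<close> to its partial sum is the squared norm of
  \<open>u\<close> minus the partial sum of squared coefficients, and completeness of the eigenbasis
  sends it to 0.\<close>

lemma parseval:
  assumes u: "u \<in> L2_graph G len"
  shows "(\<lambda>k. (L2_inner G len u (\<psi> k))\<^sup>2) sums (L2_norm G len u)\<^sup>2"
proof -
  define c where "c k = L2_inner G len u (\<psi> k)" for k
  define s where "s n e x = (\<Sum>k<n. c k * \<psi> k e x)" for n e x
  have ssq: "sq_integrable (len e) (s n e)" if "e \<in> arcs G" for n e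
    unfolding s_def by (rule sq_integrable_sum) (rule eigenfunction(1)[OF that])
  have nonneg: "0 \<le> L2_inner G len v v" for v by (simp add: L2_inner_def sum_nonneg)
  have us: "(\<Sum>e\<in>arcs G. edge_inner e u (s n)) = (\<Sum>k<n. (c k)\<^sup>2)" for n
  proof -
    have "edge_inner e u (s n) = (\<Sum>k<n. c k * edge_inner e u (\<psi> k))" if e: "e \<in> arcs G" for e
    proof -
      have "edge_inner e u (s n) = (LINT x|Leb (len e). (\<Sum>k<n. c k * (u e x * \<psi> k e x)))"
        by (simp add: s_def sum_distrib_left ac_simps)
      also have "\<dots> = (\<Sum>k<n. c k * edge_inner e u (\<psi> k))"
        using sq_integrable_mult[OF L2_graphD[OF u e] eigenfunction(1)[OF e]] by (subst Bochner_Integration.integral_sum) auto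
      finally show ?thesis .
    qed
    then have "(\<Sum>e\<in>arcs G. edge_inner e u (s n)) = (\<Sum>e\<in>arcs G. \<Sum>k<n. c k * edge_inner e u (\<psi> k))" by simp
    also have "\<dots> = (\<Sum>k<n. c k * L2_inner G len u (\<psi> k))" by (subst sum.swap) (simp add: L2_inner_def sum_distrib_left)
    finally show ?thesis by (simp add: c_def power2_eq_square)
  qed
  have ss: "(\<Sum>e\<in>arcs G. edge_inner e (s n) (s n)) = (\<Sum>k<n. (c k)\<^sup>2)" for n
    using sum_inner_comb[of "{..<n}" c c] by (simp add: s_def power2_eq_square)
  have eq: "L2_inner G len (\<lambda>e x. u e x - s n e x) (\<lambda>e x. u e x - s n e x) = L2_inner G len u u - (\<Sum>k<n. (c k)\<^sup>2)" for n
  proof -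
    have "(LINT x|Leb (len e). (u e x - s n e x) * (u e x - s n e x))
      = edge_inner e u u - 2 * edge_inner e u (s n) + edge_inner e (s n) (s n)"
      if e: "e \<in> arcs G" for e
    proof -
      note i = sq_integrable_mult[OF L2_graphD[OF u e] L2_graphD[OF u e]] sq_integrable_mult[OF L2_graphD[OF u e] ssq[OF e, of n]]
        sq_integrable_mult[OF ssq[OF e, of n] ssq[OF e, of n]]
      have "(LINT x|Leb (len e). (u e x - s n e x) * (u e x - s n e x))
        = (LINT x|Leb (len e). u e x * u e x - 2 * (u e x * s n e x) + s n e x * s n e x)"
        by (intro lint_cong) (simp add: algebra_simps)
      then show ?thesis using i by simp
    qed
    then show ?thesis
      using us[of n] ss[of n] by (simp add: L2_inner_def sum.distrib sum_subtractf sum_distrib_left[symmetric])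
  qed
  have "(\<lambda>n. (L2_norm G len (\<lambda>e x. u e x - s n e x))\<^sup>2) \<longlonglongrightarrow> 0\<^sup>2"
    using eigenbasis u unfolding is_eigenbasis_def s_def c_def by (intro tendsto_power) blast
  then have "(\<lambda>n. L2_inner G len u u - (\<Sum>k<n. (c k)\<^sup>2)) \<longlonglongrightarrow> 0"
    unfolding L2_norm_def eq using nonneg[of "\<lambda>e x. u e x - s n e x" for n, unfolded eq]
    by (simp only: real_sqrt_pow2 zero_power2)
  then have "(\<lambda>n. L2_inner G len u u - (L2_inner G len u u - (\<Sum>k<n. (c k)\<^sup>2))) \<longlonglongrightarrow> L2_inner G len u u - 0"
    by (intro tendsto_diff tendsto_const)
  then show ?thesis using nonneg by (simp add: sums_def c_def L2_norm_def)
qed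

text \<open>Partial sums are Cauchy on every edge because the tail on one edge is dominated by the
  tail on the graph. The edgewise limits are assembled by choice, and Cauchy-Schwarz lets the
  coefficients pass to the limit.\<close>

lemma riesz_fischer:
  assumes c: "summable (\<lambda>k. (c k)\<^sup>2)"
  shows "\<exists>u\<in>L2_graph G len. \<forall>k. L2_inner G len u (\<psi> k) = c k"
proof -
  define s where "s n e x = (\<Sum>k<n. c k * \<psi> k e x)" for n e x
  have ssq: "sq_integrable (len e) (s n e)" if "e \<in> arcs G" for n e
    unfolding s_def by (rule sq_integrable_sum) (rule eigenfunction(1)[OF that])
  have tail: "(LINT x|Leb (len e). (s i e x - s j e x)\<^sup>2) \<le> (\<Sum>k\<in>{i..<j}. (c k)\<^sup>2)" if e: "e \<in> arcs G" and ij: "i \<le> j" for i j e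
  proof -
    have d: "s j e x - s i e x = (\<Sum>k\<in>{i..<j}. c k * \<psi> k e x)" for e x
      unfolding s_def using ij by (simp add: lessThan_atLeast0 sum_diff_nat_ivl)
    have "(LINT x|Leb (len e). (s i e x - s j e x)\<^sup>2) = (LINT x|Leb (len e). (s j e x - s i e x)\<^sup>2)" by (simp add: power2_commute)
    also have "\<dots> \<le> (\<Sum>e\<in>arcs G. LINT x|Leb (len e). (s j e x - s i e x)\<^sup>2)"
      by (rule member_le_sum[OF e]) auto
    also have "\<dots> = (\<Sum>k\<in>{i..<j}. (c k)\<^sup>2)"
      using sum_inner_comb[of "{i..<j}" c c] by (simp add: d power2_eq_square)
    finally show ?thesis .
  qed
  have "\<exists>g. sq_integrable (len e) g \<and> (\<lambda>n. LINT x|Leb (len e). (s n e x - g x)\<^sup>2) \<longlonglongrightarrow> 0" if e: "e \<in> arcs G" for e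
  proof (rule sq_integrable_complete[OF ssq[OF e] len_pos[OF e]])
    fix \<eta> :: real assume "0 < \<eta>"
    then obtain N where N: "\<And>m n. N \<le> m \<Longrightarrow> norm (\<Sum>k\<in>{m..<n}. (c k)\<^sup>2) < \<eta>"
      using c unfolding summable_Cauchy by blast
    show "\<exists>N. \<forall>i\<ge>N. \<forall>j\<ge>N. (LINT x|Leb (len e). (s i e x - s j e x)\<^sup>2) < \<eta>"
    proof (intro exI[of _ N] allI impI)
      fix i j assume ij: "N \<le> i" "N \<le> j"
      show "(LINT x|Leb (len e). (s i e x - s j e x)\<^sup>2) < \<eta>"
      proof (cases "i \<le> j")
        case True
        then show ?thesis using tail[OF e True] N[OF ij(1), of j] by simp
      next
        case False
        then have "(LINT x|Leb (len e). (s j e x - s i e x)\<^sup>2) < \<eta>" using tail[OF e, of j i] N[OF ij(2), of i] by simp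
        then show ?thesis by (simp add: power2_commute)
      qed
    qed
  qed
  then have "\<forall>e\<in>arcs G. \<exists>g. sq_integrable (len e) g \<and> (\<lambda>n. LINT x|Leb (len e). (s n e x - g x)\<^sup>2) \<longlonglongrightarrow> 0"
    by (rule ballI)
  from bchoice[OF this] obtain u where
    u': "\<forall>e\<in>arcs G. sq_integrable (len e) (u e) \<and> (\<lambda>n. LINT x|Leb (len e). (s n e x - u e x)\<^sup>2) \<longlonglongrightarrow> 0" ..
  have u: "sq_integrable (len e) (u e)" "(\<lambda>n. LINT x|Leb (len e). (s n e x - u e x)\<^sup>2) \<longlonglongrightarrow> 0"
    if "e \<in> arcs G" for e using bspec[OF u' that] by (rule conjunct1, rule conjunct2)
  have "L2_inner G len u (\<psi> k) = c k" for k
  proof -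
    have lim: "(\<lambda>n. edge_inner e (s n) (\<psi> k)) \<longlonglongrightarrow> edge_inner e u (\<psi> k)" if e: "e \<in> arcs G" for e
    proof -
      define D where "D n = (LINT x|Leb (len e). (s n e x - u e x)\<^sup>2)" for n
      define P where "P = edge_sq e (\<psi> k)"
      have bd: "\<bar>edge_inner e (s n) (\<psi> k) - edge_inner e u (\<psi> k)\<bar> \<le> sqrt (D n * P)" for n
      proof (rule real_le_rsqrt)
        note d = sq_integrable_diff[OF ssq[OF e, of n] u(1)[OF e]] and p = eigenfunction(1)[OF e, of k]
        have "edge_inner e (s n) (\<psi> k) - edge_inner e u (\<psi> k)
          = (LINT x|Leb (len e). (s n e x - u e x) * \<psi> k e x)"
          using sq_integrable_mult[OF ssq[OF e, of n] p] sq_integrable_mult[OF u(1)[OF e] p] by (simp add: left_diff_distrib)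
        moreover have "(LINT x|Leb (len e). (s n e x - u e x) * \<psi> k e x)\<^sup>2 \<le> D n * P"
          unfolding D_def P_def by (rule integral_Cauchy_Schwarz[OF _ _ sq_integrable_mult[OF d p]])
            (use d p in \<open>auto simp: sq_integrable_def\<close>)
        ultimately show "\<bar>edge_inner e (s n) (\<psi> k) - edge_inner e u (\<psi> k)\<bar>\<^sup>2 \<le> D n * P" by simp
      qed
      have "(\<lambda>n. sqrt (D n * P)) \<longlonglongrightarrow> sqrt (0 * P)"
        unfolding D_def by (intro tendsto_intros u(2)[OF e])
      then have lim0: "(\<lambda>n. sqrt (D n * P)) \<longlonglongrightarrow> 0" by (simp only: mult_zero_left real_sqrt_zero)
      have "(\<lambda>n. edge_inner e (s n) (\<psi> k) - edge_inner e u (\<psi> k)) \<longlonglongrightarrow> 0"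
        by (rule Lim_null_comparison[OF _ lim0], rule always_eventually, rule allI, unfold real_norm_def, rule bd)
      then show ?thesis by (rule LIM_zero_cancel)
    qed
    then have "(\<lambda>n. \<Sum>e\<in>arcs G. edge_inner e (s n) (\<psi> k)) \<longlonglongrightarrow> L2_inner G len u (\<psi> k)"
      unfolding L2_inner_def by (intro tendsto_sum)
    moreover have "(\<lambda>n. \<Sum>e\<in>arcs G. edge_inner e (s n) (\<psi> k)) \<longlonglongrightarrow> c k"
    proof (rule tendsto_eventually)
      show "\<forall>\<^sub>F n in sequentially. (\<Sum>e\<in>arcs G. edge_inner e (s n) (\<psi> k)) = c k"
        using eventually_gt_at_top[of k]
      proof eventually_elim
        case (elim n)
        \<comment> \<open>For \<open>n > k\<close>, \<open>\<psi> k\<close> is itself a combination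
          of the first \<open>n\<close> eigenfunctions, so \<open>sum_inner_comb\<close> reads off
          the coefficient.\<close>
        have "(\<Sum>j<n. (if j = k then 1 else 0) * \<psi> j e x) = \<psi> k e x" for e x
          using elim by (simp add: if_distrib[of "\<lambda>t. t * _"] cong: if_cong)
        moreover have "(\<Sum>j<n. c j * (if j = k then 1 else 0)) = c k"
          using elim by (simp add: if_distrib cong: if_cong)
        ultimately show ?case using sum_inner_comb[of "{..<n}" c "\<lambda>j. if j = k then 1 else 0"] by (simp add: s_def)
      qed
    qed
    ultimately show ?thesis by (rule LIMSEQ_unique)
  qed
  then show ?thesis using u(1) by (intro bexI[of _ u]) (auto simp: L2_graph_def)
qed

end

section \<open>White noise\<close>

lemma std_normal_second_moment:
  assumes "distributed M lborel X std_normal_density"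
  shows "integrable M (\<lambda>\<omega>. (X \<omega>)\<^sup>2)" "(LINT \<omega>|M. (X \<omega>)\<^sup>2) = 1"
proof -
  have "has_bochner_integral lborel (\<lambda>x. std_normal_density x * x ^ (2 * 1)) (fact (2 * 1) / (2 ^ 1 * fact 1))"
    by (rule std_normal_moment_even)
  then have hb: "integrable lborel (\<lambda>x. std_normal_density x * x\<^sup>2)" "(LINT x|lborel. std_normal_density x * x\<^sup>2) = 1"
    by (auto simp: has_bochner_integral_iff)
  show "integrable M (\<lambda>\<omega>. (X \<omega>)\<^sup>2)"
    using distributed_integrable[OF assms, of "\<lambda>x. x\<^sup>2"] hb(1) by simp
  show "(LINT \<omega>|M. (X \<omega>)\<^sup>2) = 1"
    using distributed_integral[OF assms, of "\<lambda>x. x\<^sup>2"] hb(2) by simp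
qed

text \<open>By Tonelli and unit second moments, the expectation of the series is the finite sum of
  \<open>b\<close>; a nonnegative random series with finite expectation converges almost
  surely.\<close>

lemma noise_series:
  assumes prob: "prob_space M" and W: "white_noise M W" and b: "summable b" "\<And>k. 0 \<le> b k"
  shows "AE \<omega> in M. summable (\<lambda>k. b k * (W \<omega> k)\<^sup>2)" "integrable M (\<lambda>\<omega>. \<Sum>k. b k * (W \<omega> k)\<^sup>2)"
    "(\<lambda>\<omega>. W \<omega> k) \<in> borel_measurable M"
proof -
  have dist: "distributed M lborel (\<lambda>\<omega>. W \<omega> k) std_normal_density" for k using W by (simp add: white_noise_def)
  have m[measurable]: "(\<lambda>\<omega>. W \<omega> k) \<in> borel_measurable M" for k
    using distributed_measurable[OF dist[of k]] by simp
  then show "(\<lambda>\<omega>. W \<omega> k) \<in> borel_measurable M" .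
  have int: "integrable M (\<lambda>\<omega>. b k * (W \<omega> k)\<^sup>2)" and val: "(LINT \<omega>|M. b k * (W \<omega> k)\<^sup>2) = b k" for k
    using std_normal_second_moment[OF dist[of k]] by auto
  have nn: "(\<integral>\<^sup>+\<omega>. ennreal (b k * (W \<omega> k)\<^sup>2) \<partial>M) = ennreal (b k)" for k
    by (subst nn_integral_eq_integral[OF int]) (use b(2) in simp, simp only: val)
  have "(\<integral>\<^sup>+\<omega>. (\<Sum>k. ennreal (b k * (W \<omega> k)\<^sup>2)) \<partial>M) = (\<Sum>k. \<integral>\<^sup>+\<omega>. ennreal (b k * (W \<omega> k)\<^sup>2) \<partial>M)"
    by (rule nn_integral_suminf) measurable
  also have "\<dots> = (\<Sum>k. ennreal (b k))"
    by (simp only: nn)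
  also have "\<dots> \<noteq> \<infinity>" using ennreal_suminf_neq_top[OF b] by simp
  finally have "AE \<omega> in M. (\<Sum>k. ennreal (b k * (W \<omega> k)\<^sup>2)) \<noteq> \<infinity>"
    by (intro nn_integral_PInf_AE) measurable
  then show AE: "AE \<omega> in M. summable (\<lambda>k. b k * (W \<omega> k)\<^sup>2)"
    by eventually_elim (subst summable_iff_ennreal, use b in auto)
  show "integrable M (\<lambda>\<omega>. \<Sum>k. b k * (W \<omega> k)\<^sup>2)"
  proof (rule integrable_suminf[OF int])
    have e: "norm (b k * (W \<omega> k)\<^sup>2) = b k * (W \<omega> k)\<^sup>2" for k \<omega> using b(2) by simp
    show "AE \<omega> in M. summable (\<lambda>k. norm (b k * (W \<omega> k)\<^sup>2))" unfolding e by (rule AE)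
    show "summable (\<lambda>k. LINT \<omega>|M. norm (b k * (W \<omega> k)\<^sup>2))" unfolding e val by (rule b)
  qed
qed

context operator_eigenbasis
begin

section \<open>The solution as a random coefficient sequence\<close>

lemma eig_pos: "0 < eig k"
  using eig_lower_bound by (metis less_le_trans)

text \<open>The default 0 on the null event of divergence puts every sample into the space, as
  measurability of a map into \<open>Hdot\<close> demands. The parameter \<open>t\<close> fixes
  which series is tested.\<close>

definition solution :: "real \<Rightarrow> real \<Rightarrow> ('w \<Rightarrow> nat \<Rightarrow> real) \<Rightarrow> 'w \<Rightarrow> nat \<Rightarrow> real" where
  "solution \<beta> t W \<omega> k = (if summable (\<lambda>k. eig k powr - t * (W \<omega> k)\<^sup>2) then eig k powr - \<beta> * W \<omega> k else 0)"

text \<open>The powers of \<beta> cancel, so the norm in the space of order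
  \<open>2 * \<beta> - t\<close> depends on \<open>t\<close> and the noise alone.\<close>

lemma solution_weighted:
  "eig k powr (2 * \<beta> - t) * (solution \<beta> t W \<omega> k)\<^sup>2
    = (if summable (\<lambda>k. eig k powr - t * (W \<omega> k)\<^sup>2) then eig k powr - t * (W \<omega> k)\<^sup>2 else 0)"
proof -
  have "(eig k powr - \<beta>)\<^sup>2 = eig k powr (- 2 * \<beta>)"
    by (simp add: power2_eq_square powr_add[symmetric])
  then have "eig k powr (2 * \<beta> - t) * (eig k powr - \<beta>)\<^sup>2 = eig k powr - t"
    by (simp add: powr_add[symmetric])
  then show ?thesis by (simp add: solution_def power_mult_distrib mult.assoc[symmetric])
qed

lemma solution_summable: "summable (\<lambda>k. eig k powr (2 * \<beta> - t) * (solution \<beta> t W \<omega> k)\<^sup>2)"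
  unfolding solution_weighted by (cases "summable (\<lambda>k. eig k powr - t * (W \<omega> k)\<^sup>2)") auto

text \<open>For \<open>s \<ge> 0\<close> the eigenvalues, bounded away from 0, make weighted
  summability imply plain square summability; Riesz-Fischer then supplies the function that
  \<open>Hdot\<close> asks for.\<close>

lemma Hdot_iff: "c \<in> Hdot G len \<psi> eig s \<longleftrightarrow> summable (\<lambda>k. eig k powr s * (c k)\<^sup>2)"
proof -
  have "\<exists>u\<in>L2_graph G len. \<forall>k. c k = L2_inner G len u (\<psi> k)" if s: "0 \<le> s" "summable (\<lambda>k. eig k powr s * (c k)\<^sup>2)"
  proof -
    obtain \<delta> where \<delta>: "0 < \<delta>" "\<And>k. \<delta> \<le> eig k" using eig_lower_bound by metis
    have "summable (\<lambda>k. (c k)\<^sup>2)"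
    proof (rule summable_comparison_test'[where N = 0])
      show "summable (\<lambda>k. \<delta> powr - s * (eig k powr s * (c k)\<^sup>2))" by (intro summable_mult s)
      fix k
      have "1 = \<delta> powr - s * \<delta> powr s" using \<delta>(1) by (simp add: powr_add[symmetric])
      also have "\<dots> \<le> \<delta> powr - s * eig k powr s" using \<delta> s(1) by (intro mult_left_mono powr_mono2) auto
      finally have "1 * (c k)\<^sup>2 \<le> (\<delta> powr - s * eig k powr s) * (c k)\<^sup>2" by (rule mult_right_mono) simp
      then show "norm ((c k)\<^sup>2) \<le> \<delta> powr - s * (eig k powr s * (c k)\<^sup>2)" by (simp add: mult.assoc)
    qed
    from riesz_fischer[OF this] show ?thesis by metis
  qed
  then show ?thesis by (auto simp: Hdot_def)
qed

lemma rat_seq_finite: "summable (\<lambda>k. wt k * (rat_seq qs k)\<^sup>2)"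
  by (rule summable_finite[of "{..<length qs}"]) (auto simp: rat_seq_def)

lemma solution_L2_rv:
  assumes prob: "prob_space M" and W: "white_noise M W" and t: "1/2 < t"
  shows "solution \<beta> t W \<in> L2_rv M (Hdot G len \<psi> eig (2 * \<beta> - t)) (Hdot_norm eig (2 * \<beta> - t))"
proof -
  let ?s = "2 * \<beta> - t"
  note ns = noise_series[OF prob W summable_eig_powr[OF t]]
  have [measurable]: "(\<lambda>\<omega>. W \<omega> k) \<in> borel_measurable M" for k by (rule ns(3)) simp
  have [measurable]: "Measurable.pred M (\<lambda>\<omega>. summable (\<lambda>k. eig k powr - t * (W \<omega> k)\<^sup>2))"
    by (rule pred_summable) auto
  have sm[measurable]: "(\<lambda>\<omega>. solution \<beta> t W \<omega> k) \<in> borel_measurable M" for k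
    unfolding solution_def by measurable
  have "solution \<beta> t W \<in> measurable M (norm_borel (Hdot G len \<psi> eig ?s) (Hdot_norm eig ?s))"
  proof (rule measurable_norm_borel[where wt = "\<lambda>k. eig k powr ?s" and coef = "\<lambda>c. c"])
    show "\<exists>y\<in>Hdot G len \<psi> eig ?s. \<forall>k. y k = rat_seq qs k" for qs
      using rat_seq_finite by (auto simp: Hdot_iff)
    show "solution \<beta> t W \<in> space M \<rightarrow> Hdot G len \<psi> eig ?s" using solution_summable by (auto simp: Hdot_iff)
  qed (auto simp: Hdot_iff Hdot_norm_def)
  moreover have "integrable M (\<lambda>\<omega>. (Hdot_norm eig ?s (solution \<beta> t W \<omega>))\<^sup>2)"
  proof -
    have sq: "(Hdot_norm eig ?s (solution \<beta> t W \<omega>))\<^sup>2 = (\<Sum>k. eig k powr ?s * (solution \<beta> t W \<omega> k)\<^sup>2)" for \<omega>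
      unfolding Hdot_norm_def by (intro real_sqrt_pow2 suminf_nonneg solution_summable) simp
    have "AE \<omega> in M. (\<Sum>k. eig k powr ?s * (solution \<beta> t W \<omega> k)\<^sup>2) = (\<Sum>k. eig k powr - t * (W \<omega> k)\<^sup>2)"
      using ns(1)[OF powr_ge_zero] by eventually_elim (simp add: solution_weighted)
    then have "integrable M (\<lambda>\<omega>. \<Sum>k. eig k powr ?s * (solution \<beta> t W \<omega> k)\<^sup>2) \<longleftrightarrow> integrable M (\<lambda>\<omega>. \<Sum>k. eig k powr - t * (W \<omega> k)\<^sup>2)"
      by (intro integrable_cong_AE) measurable
    then show ?thesis unfolding sq using ns(2) by simp
  qed
  ultimately show ?thesis by (simp add: L2_rv_def)
qed

lemma solution_solves:
  assumes prob: "prob_space M" and W: "white_noise M W" and t: "1/2 < t"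
  shows "solves M eig \<beta> W (solution \<beta> t W)"
  unfolding solves_def using noise_series(1)[OF prob W summable_eig_powr[OF t] powr_ge_zero]
proof eventually_elim
  case (elim \<omega>)
  have "eig k powr \<beta> * (eig k powr - \<beta> * x) = x" for k x
    using eig_pos[of k] by (simp add: mult.assoc[symmetric] powr_add[symmetric])
  then show ?case using elim by (simp add: fun_eq_iff L_power_def solution_def)
qed

lemma solves_unique:
  assumes "solves M eig \<beta> W u" "solves M eig \<beta> W u'"
  shows "AE \<omega> in M. u' \<omega> = u \<omega>"
  using assms unfolding solves_def
proof eventually_elim
  case (elim \<omega>)
  then have "L_power eig \<beta> (u' \<omega>) = L_power eig \<beta> (u \<omega>)" by simp
  then have "eig k powr \<beta> * u' \<omega> k = eig k powr \<beta> * u \<omega> k" for k by (auto simp: L_power_def dest: fun_cong)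
  then have "u' \<omega> k = u \<omega> k" for k using eig_pos[of k] by (metis less_irrefl mult_left_cancel powr_eq_0_iff)
  then show ?case by (rule ext)
qed

text \<open>For \<open>t = 2 * \<beta>\<close> the weight exponent is 0, and \<open>t > 1/2\<close>
  becomes \<beta> > 1/4. The resulting solution has square summable samples, which Riesz-Fischer
  turns into functions, one for each \<omega>; measurability is recovered from the coefficients. It
  agrees almost surely with the solution for the given \<open>t\<close> because both solve the same
  equation.\<close>

lemma solution_in_L2:
  assumes prob: "prob_space M" and W: "white_noise M W" and t: "1/2 < t" and \<beta>: "1/4 < \<beta>"
  shows "\<exists>U \<in> L2_rv M (L2_graph G len) (L2_norm G len). AE \<omega> in M. \<forall>k. solution \<beta> t W \<omega> k = L2_inner G len (U \<omega>) (\<psi> k)"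
proof -
  define c where "c = solution \<beta> (2 * \<beta>) W"
  have t2: "1/2 < 2 * \<beta>" using \<beta> by simp
  have csum: "summable (\<lambda>k. (c \<omega> k)\<^sup>2)" for \<omega>
    using solution_summable[of \<beta> "2 * \<beta>" W \<omega>] eig_pos by (simp add: c_def less_imp_neq[symmetric])
  obtain U where U: "\<And>\<omega>. U \<omega> \<in> L2_graph G len" "\<And>\<omega> k. L2_inner G len (U \<omega>) (\<psi> k) = c \<omega> k"
    using riesz_fischer[OF csum] by metis
  note ns = noise_series[OF prob W summable_eig_powr[OF t2]]
  have [measurable]: "(\<lambda>\<omega>. W \<omega> k) \<in> borel_measurable M" for k by (rule ns(3)) simp
  have [measurable]: "Measurable.pred M (\<lambda>\<omega>. summable (\<lambda>k. eig k powr - (2 * \<beta>) * (W \<omega> k)\<^sup>2))"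
    by (rule pred_summable) auto
  have cm[measurable]: "(\<lambda>\<omega>. c \<omega> k) \<in> borel_measurable M" for k
    unfolding c_def solution_def by measurable
  have norm: "L2_norm G len u = sqrt (\<Sum>k. (L2_inner G len u (\<psi> k))\<^sup>2)" if "u \<in> L2_graph G len" for u
  proof -
    have "0 \<le> L2_norm G len u" by (simp add: L2_norm_def L2_inner_def sum_nonneg)
    then show ?thesis using sums_unique[OF parseval[OF that]] by (metis real_sqrt_unique)
  qed
  have "U \<in> measurable M (norm_borel (L2_graph G len) (L2_norm G len))"
  proof (rule measurable_norm_borel[where wt = "\<lambda>_. 1" and coef = "\<lambda>u k. L2_inner G len u (\<psi> k)"])
    show "summable (\<lambda>k. 1 * (L2_inner G len x (\<psi> k))\<^sup>2)" if "x \<in> L2_graph G len" for x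
      using sums_summable[OF parseval[OF that]] by simp
    show "L2_norm G len (x - y) = sqrt (\<Sum>k. 1 * (L2_inner G len x (\<psi> k) - L2_inner G len y (\<psi> k))\<^sup>2)"
      if "x \<in> L2_graph G len" "y \<in> L2_graph G len" for x y
      using norm[OF diff_L2[OF that]] L2_inner_diff[OF that psi_L2] by simp
    show "\<exists>y\<in>L2_graph G len. \<forall>k. L2_inner G len y (\<psi> k) = rat_seq qs k" for qs
      using riesz_fischer[of "rat_seq qs"] rat_seq_finite[of "\<lambda>_. 1" qs] by simp
  qed (use U in \<open>auto simp: cm\<close>)
  moreover have "integrable M (\<lambda>\<omega>. (L2_norm G len (U \<omega>))\<^sup>2)"
  proof -
    have sq: "(L2_norm G len (U \<omega>))\<^sup>2 = (\<Sum>k. (c \<omega> k)\<^sup>2)" for \<omega>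
      using sums_unique[OF parseval[OF U(1)[of \<omega>]]] by (simp add: U(2))
    have "AE \<omega> in M. (\<Sum>k. (c \<omega> k)\<^sup>2) = (\<Sum>k. eig k powr - (2 * \<beta>) * (W \<omega> k)\<^sup>2)"
      using ns(1)[OF powr_ge_zero]
    proof eventually_elim
      case (elim \<omega>)
      have "(c \<omega> k)\<^sup>2 = eig k powr - (2 * \<beta>) * (W \<omega> k)\<^sup>2" for k
        using solution_weighted[of k \<beta> "2 * \<beta>" W \<omega>] elim eig_pos[of k] by (simp add: c_def)
      then show ?case by simp
    qed
    then have "integrable M (\<lambda>\<omega>. \<Sum>k. (c \<omega> k)\<^sup>2) \<longleftrightarrow> integrable M (\<lambda>\<omega>. \<Sum>k. eig k powr - (2 * \<beta>) * (W \<omega> k)\<^sup>2)"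
      by (intro integrable_cong_AE) measurable
    then show ?thesis unfolding sq using ns(2) by simp
  qed
  moreover have "AE \<omega> in M. \<forall>k. solution \<beta> t W \<omega> k = L2_inner G len (U \<omega>) (\<psi> k)"
    using solves_unique[OF solution_solves[OF prob W t2] solution_solves[OF prob W t], of \<beta>]
    by eventually_elim (simp add: U(2) c_def)
  ultimately show ?thesis by (auto simp: L2_rv_def intro!: bexI[of _ U])
qed

end

theorem proposition3p2:
  fixes G :: "('v, 'e) pre_digraph" and len :: "'e \<Rightarrow> real"
    and es :: "'v \<Rightarrow> ('e \<times> bool) list"
    and \<kappa> :: "'e \<Rightarrow> real \<Rightarrow> real" and \<kappa>\<^sub>0 :: real
    and a :: "('v, 'e) gpoint \<Rightarrow> real" and a\<^sub>0 :: real
    and A B :: "'v \<Rightarrow> real mat"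
    and \<psi> :: "nat \<Rightarrow> 'e \<Rightarrow> real \<Rightarrow> real" and eig :: "nat \<Rightarrow> real"
    and M :: "'w measure" and W :: "'w \<Rightarrow> nat \<Rightarrow> real"
    and \<beta> \<epsilon> :: real
  assumes graph: "fin_digraph G" "Digraph_Component.connected G" "\<And>e. e \<in> arcs G \<Longrightarrow> 0 < len e"
    and ends: "\<And>v. v \<in> verts G \<Longrightarrow> distinct (es v) \<and> set (es v) = ends_at G v"
    and kappa: "\<kappa> \<in> Linf_graph G len" "0 < \<kappa>\<^sub>0"
      "\<And>e. e \<in> arcs G \<Longrightarrow> AE x in lebesgue_on {0..len e}. \<kappa>\<^sub>0 \<le> \<kappa> e x"
    and a: "lipschitz_on_graph G len a" "0 < a\<^sub>0" "a\<^sub>0 \<in> a ` points G len"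
      "\<And>p. p \<in> points G len \<Longrightarrow> a\<^sub>0 \<le> a p"
    and AB_carrier: "\<And>v. v \<in> verts G \<Longrightarrow>
      A v \<in> carrier_mat (deg G v) (deg G v) \<and> B v \<in> carrier_mat (deg G v) (deg G v)"
    and AB_rank: "\<And>v. v \<in> verts G \<Longrightarrow>
      vec_space.rank (deg G v) (mat_of_cols (deg G v) (cols (A v) @ cols (B v))) = deg G v"
    and AB_selfadjoint: "\<And>v. v \<in> verts G \<Longrightarrow>
      transpose_mat (A v * transpose_mat (B v)) = A v * transpose_mat (B v)"
    and A1_or_A2:
      "(4 * Lam_bound G A B / Min (len ` arcs G) < \<kappa>\<^sub>0\<^sup>2 \<and>
        2 * Lam_bound G A B * Max (len ` arcs G) \<le> a\<^sub>0)
       \<or> (\<forall>v\<in>verts G. Lam_nonpositive (A v) (B v))"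
    and eigenbasis: "is_eigenbasis G len es a \<kappa> A B \<psi> eig"
    and noise: "prob_space M" "white_noise M W"
    and "0 < \<beta>" "0 < \<epsilon>"
  shows "\<exists>u \<in> L2_rv M (Hdot G len \<psi> eig (2 * \<beta> - 1/2 - \<epsilon>)) (Hdot_norm eig (2 * \<beta> - 1/2 - \<epsilon>)).
      solves M eig \<beta> W u \<and>
      (\<forall>u' \<in> L2_rv M (Hdot G len \<psi> eig (2 * \<beta> - 1/2 - \<epsilon>)) (Hdot_norm eig (2 * \<beta> - 1/2 - \<epsilon>)).
         solves M eig \<beta> W u' \<longrightarrow> (AE \<omega> in M. u' \<omega> = u \<omega>)) \<and>
      (1/4 < \<beta> \<longrightarrow>
         (\<exists>U \<in> L2_rv M (L2_graph G len) (L2_norm G len).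
            AE \<omega> in M. \<forall>k. u \<omega> k = L2_inner G len (U \<omega>) (\<psi> k)))"
proof -
  interpret operator_eigenbasis G len es \<kappa> \<kappa>\<^sub>0 a a\<^sub>0 A B \<psi> eig
    by (rule operator_eigenbasis.intro) (fact assms)+
  \<comment> \<open>The expected squared norm is the sum of the eigenvalues to the power
    \<open>-t\<close>, so any positive \<epsilon> clears the threshold 1/2.\<close>
  define t where "t = 1/2 + \<epsilon>"
  have t: "1/2 < t" and s: "2 * \<beta> - 1/2 - \<epsilon> = 2 * \<beta> - t"
    using \<open>0 < \<epsilon>\<close> by (simp_all add: t_def)
  show ?thesis
    unfolding s
  proof (rule bexI[of _ "solution \<beta> t W"], intro conjI ballI impI)
    show sol: "solves M eig \<beta> W (solution \<beta> t W)" by (rule solution_solves[OF noise t])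
    fix u' assume "solves M eig \<beta> W u'"
    then show "AE \<omega> in M. u' \<omega> = solution \<beta> t W \<omega>" by (rule solves_unique[OF sol])
  next
    show "\<exists>U\<in>L2_rv M (L2_graph G len) (L2_norm G len). AE \<omega> in M. \<forall>k. solution \<beta> t W \<omega> k = L2_inner G len (U \<omega>) (\<psi> k)"
      if "1/4 < \<beta>" by (rule solution_in_L2[OF noise t that])
  next
    show "solution \<beta> t W \<in> L2_rv M (Hdot G len \<psi> eig (2 * \<beta> - t)) (Hdot_norm eig (2 * \<beta> - t))"
      by (rule solution_L2_rv[OF noise t])
  qed
qed

end
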